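(* Let $p\geq 2$ and let $\Sigma^n$ be a complete non-compact Riemannian manifold with $\lambda_{1,p}(\Sigma)=0$. Then every strongly $p$-subharmonic function on $\Sigma^n$ is unbounded; that is, if $u:\Sigma^n\to\mathbb{R}$ is a smooth function for which there is a constant $k>0$ with $\Delta_p u\geq k$ on $\Sigma^n$, then $u$ is not a bounded function.
   Context: For a function $u$ on a Riemannian manifold $\Sigma^n$, the $p$-Laplacian is $\Delta_p u=\mathrm{div}(|\nabla u|^{p-2}\nabla u)$. The first eigenvalue of the $p$-Laplacian of $\Sigma^n$ is $$\lambda_{1,p}(\Sigma)=\inf\left\{\frac{\int_\Sigma|\nabla u|^p\,d\Sigma}{\int_\Sigma|u|^p\,d\Sigma}\;:\;u\in W^{1,p}_0(\Sigma)\setminus\{0\}\right\},$$ where $d\Sigma$ is the Riemannian volume element; for complete non-compact $\Sigma^n$ it equals $\lim_{k\to\infty}\lambda_{1,p}(\Omega_k)$ for any exhaustion $\{\Omega_k\}$ of $\Sigma^n$ by compact domains with $\Omega_k\subset\Omega_{k+1}$, where $\lambda_{1,p}(\Omega_k)$ is the first Dirichlet eigenvalue of the problem $\Delta_pu=-\lambda|u|^{p-2}u$ in $\Omega_k$, $u=0$ on $\partial\Omega_k$. A smooth function $u:\Sigma^n\to\mathbb{R}$ is called strongly $p$-subharmonic if $\Delta_p u\geq k>0$ on $\Sigma^n$ for some constant $k$. *)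

theory Defs
  imports "HOL-Analysis.Analysis"
begin

section \<open>Smooth functions between Euclidean spaces\<close>

text \<open>Iterated Frechet differentiability; meant for open \<^term>\<open>S\<close>.  In finite dimension,
  continuity of all iterated directional derivatives up to order \<^term>\<open>k\<close> is the usual
  class \<open>C\<^sup>k\<close>.\<close>

primrec Ck_on ::
    "nat \<Rightarrow> 'b::euclidean_space set \<Rightarrow> ('b \<Rightarrow> 'c::real_normed_vector) \<Rightarrow> bool" where
  "Ck_on 0 S f \<longleftrightarrow> continuous_on S f"
| "Ck_on (Suc k) S f \<longleftrightarrow>
     (\<forall>x\<in>S. f differentiable (at x)) \<and>
     (\<forall>v. Ck_on k S (\<lambda>x. frechet_derivative f (at x) v))"

definition smooth_on :: "'b::euclidean_space set \<Rightarrow> ('b \<Rightarrow> 'c::real_normed_vector) \<Rightarrow> bool" where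
  "smooth_on S f \<longleftrightarrow> (\<forall>k. Ck_on k S f)"

definition partial_deriv :: "'n::finite \<Rightarrow> (real^'n \<Rightarrow> real) \<Rightarrow> real^'n \<Rightarrow> real" where
  "partial_deriv i f y = frechet_derivative f (at y) (axis i 1)"


section \<open>Smooth manifolds\<close>

text \<open>The manifold is the whole type \<^typ>\<open>'a\<close>.  A chart is a pair of its domain and its
  coordinate map; the dimension is the cardinality of the index type \<^typ>\<open>'n\<close>.\<close>

type_synonym ('a, 'n) chart = "'a set \<times> ('a \<Rightarrow> real^'n)"

abbreviation chart_dom :: "('a, 'n::finite) chart \<Rightarrow> 'a set" where
  "chart_dom c \<equiv> fst c"

abbreviation chart_map :: "('a, 'n::finite) chart \<Rightarrow> 'a \<Rightarrow> real^'n" where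
  "chart_map c \<equiv> snd c"

definition chart_ran :: "('a, 'n::finite) chart \<Rightarrow> (real^'n) set" where
  "chart_ran c = chart_map c ` chart_dom c"

definition chart_inv :: "('a, 'n::finite) chart \<Rightarrow> real^'n \<Rightarrow> 'a" where
  "chart_inv c = inv_into (chart_dom c) (chart_map c)"

definition transition :: "('a, 'n::finite) chart \<Rightarrow> ('a, 'n) chart \<Rightarrow> real^'n \<Rightarrow> real^'n" where
  "transition c d = chart_map d \<circ> chart_inv c"

definition transition_jacobian ::
    "('a, 'n::finite) chart \<Rightarrow> ('a, 'n) chart \<Rightarrow> 'a \<Rightarrow> real^'n^'n" where
  "transition_jacobian c d x = matrix (frechet_derivative (transition c d) (at (chart_map c x)))"

definition smooth_atlas :: "('a::topological_space, 'n::finite) chart set \<Rightarrow> bool" where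
  "smooth_atlas A \<longleftrightarrow>
     (\<Union>c\<in>A. chart_dom c) = UNIV \<and>
     (\<forall>c\<in>A. open (chart_dom c) \<and> open (chart_ran c) \<and>
            homeomorphism (chart_dom c) (chart_ran c) (chart_map c) (chart_inv c)) \<and>
     (\<forall>c\<in>A. \<forall>d\<in>A. smooth_on (chart_map c ` (chart_dom c \<inter> chart_dom d)) (transition c d))"

text \<open>An arbitrary chart around a given point, used to evaluate coordinate expressions that
  do not depend on the choice of the chart.\<close>

definition chart_at :: "('a, 'n::finite) chart set \<Rightarrow> 'a \<Rightarrow> ('a, 'n) chart" where
  "chart_at A x = (SOME c. c \<in> A \<and> x \<in> chart_dom c)"

definition smooth_function :: "('a, 'n::finite) chart set \<Rightarrow> ('a \<Rightarrow> real) \<Rightarrow> bool" where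
  "smooth_function A f \<longleftrightarrow> (\<forall>c\<in>A. smooth_on (chart_ran c) (f \<circ> chart_inv c))"

definition test_function ::
    "('a::topological_space, 'n::finite) chart set \<Rightarrow> ('a \<Rightarrow> real) \<Rightarrow> bool" where
  "test_function A f \<longleftrightarrow> smooth_function A f \<and> compact (closure {x. f x \<noteq> 0})"


section \<open>Riemannian metrics\<close>

text \<open>A tensor field is represented by its components in every chart of the atlas, subject to
  the transformation law: \<open>g c x\<close> is the Gram matrix of the coordinate frame of the chart
  \<open>c\<close> at the point \<open>x\<close>, and \<open>X c x\<close> the component vector of the vector
  field \<open>X\<close> in that frame.\<close>

type_synonym ('a, 'n) metric = "('a, 'n) chart \<Rightarrow> 'a \<Rightarrow> real^'n^'n"
type_synonym ('a, 'n) vfield = "('a, 'n) chart \<Rightarrow> 'a \<Rightarrow> real^'n"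

definition riemannian_metric ::
    "('a, 'n::finite) chart set \<Rightarrow> ('a, 'n) metric \<Rightarrow> bool" where
  "riemannian_metric A g \<longleftrightarrow>
     (\<forall>c\<in>A. smooth_on (chart_ran c) (\<lambda>y. g c (chart_inv c y))) \<and>
     (\<forall>c\<in>A. \<forall>x\<in>chart_dom c.
        transpose (g c x) = g c x \<and> (\<forall>v. v \<noteq> 0 \<longrightarrow> v \<bullet> (g c x *v v) > 0)) \<and>
     (\<forall>c\<in>A. \<forall>d\<in>A. \<forall>x\<in>chart_dom c \<inter> chart_dom d.
        g c x = transpose (transition_jacobian c d x) ** g d x ** transition_jacobian c d x)"

text \<open>Hausdorffness and second countability of manifolds are expressed by type classes.\<close>

definition riemannian_manifold ::
    "('a::{second_countable_topology,t2_space}, 'n::finite) chart set \<Rightarrow> ('a, 'n) metric \<Rightarrow> bool"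
  where "riemannian_manifold A g \<longleftrightarrow> smooth_atlas A \<and> riemannian_metric A g"

definition vector_field :: "('a, 'n::finite) chart set \<Rightarrow> ('a, 'n) vfield \<Rightarrow> bool" where
  "vector_field A X \<longleftrightarrow>
     (\<forall>c\<in>A. \<forall>d\<in>A. \<forall>x\<in>chart_dom c \<inter> chart_dom d.
        X d x = transition_jacobian c d x *v X c x)"

definition metric_norm ::
    "('a, 'n::finite) metric \<Rightarrow> ('a, 'n) chart \<Rightarrow> 'a \<Rightarrow> real^'n \<Rightarrow> real" where
  "metric_norm g c x v = sqrt (v \<bullet> (g c x *v v))"

definition field_norm ::
    "('a, 'n::finite) chart set \<Rightarrow> ('a, 'n) metric \<Rightarrow> ('a, 'n) vfield \<Rightarrow> 'a \<Rightarrow> real" where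
  "field_norm A g X x = (let c = chart_at A x in metric_norm g c x (X c x))"


section \<open>Riemannian distance and completeness\<close>

definition piecewise_C1_curve ::
    "('a::topological_space, 'n::finite) chart set \<Rightarrow> (real \<Rightarrow> 'a) \<Rightarrow> bool" where
  "piecewise_C1_curve A \<gamma> \<longleftrightarrow>
     continuous_on {0..1} \<gamma> \<and>
     (\<forall>c\<in>A. \<forall>a b. 0 \<le> a \<and> b \<le> 1 \<and> \<gamma> ` {a..b} \<subseteq> chart_dom c \<longrightarrow>
        (chart_map c \<circ> \<gamma>) piecewise_C1_differentiable_on {a..b})"

definition curve_length ::
    "('a, 'n::finite) chart set \<Rightarrow> ('a, 'n) metric \<Rightarrow> (real \<Rightarrow> 'a) \<Rightarrow> ennreal" where
  "curve_length A g \<gamma> =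
     (\<integral>\<^sup>+ t\<in>{0..1}.
        (let c = chart_at A (\<gamma> t) in
           ennreal (metric_norm g c (\<gamma> t) (vector_derivative (chart_map c \<circ> \<gamma>) (at t))))
      \<partial>lborel)"

text \<open>The distance is infinite between points in different connected components.\<close>

definition riem_dist ::
    "('a::topological_space, 'n::finite) chart set \<Rightarrow> ('a, 'n) metric \<Rightarrow> 'a \<Rightarrow> 'a \<Rightarrow> ennreal" where
  "riem_dist A g x y =
     Inf {curve_length A g \<gamma> |\<gamma>. piecewise_C1_curve A \<gamma> \<and> \<gamma> 0 = x \<and> \<gamma> 1 = y}"

definition riem_complete ::
    "('a::topological_space, 'n::finite) chart set \<Rightarrow> ('a, 'n) metric \<Rightarrow> bool" where
  "riem_complete A g \<longleftrightarrow>
     (\<forall>s :: nat \<Rightarrow> 'a.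
        (\<forall>e>0. \<exists>N. \<forall>m\<ge>N. \<forall>n\<ge>N. riem_dist A g (s m) (s n) < e) \<longrightarrow>
        (\<exists>l. (\<lambda>n. riem_dist A g (s n) l) \<longlonglongrightarrow> 0))"


section \<open>Riemannian volume\<close>

definition volume_density ::
    "('a, 'n::finite) metric \<Rightarrow> ('a, 'n) chart \<Rightarrow> 'a \<Rightarrow> real" where
  "volume_density g c x = sqrt (det (g c x))"

text \<open>The unique Borel measure given by \<open>sqrt (det g) dx\<close> in every chart.\<close>

definition riem_volume ::
    "('a::topological_space, 'n::finite) chart set \<Rightarrow> ('a, 'n) metric \<Rightarrow> 'a measure" where
  "riem_volume A g =
     (THE M. sets M = sets borel \<and>
        (\<forall>c\<in>A. \<forall>B\<in>sets borel. B \<subseteq> chart_dom c \<longrightarrow>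
           emeasure M B =
             (\<integral>\<^sup>+ y\<in>chart_map c ` B. ennreal (volume_density g c (chart_inv c y)) \<partial>lborel)))"


section \<open>Gradient, divergence and the p-Laplacian\<close>

definition grad ::
    "('a, 'n::finite) metric \<Rightarrow> ('a \<Rightarrow> real) \<Rightarrow> ('a, 'n) vfield" where
  "grad g u c x =
     matrix_inv (g c x) *v (\<chi> i. partial_deriv i (u \<circ> chart_inv c) (chart_map c x))"

definition divergence ::
    "('a, 'n::finite) chart set \<Rightarrow> ('a, 'n) metric \<Rightarrow> ('a, 'n) vfield \<Rightarrow> 'a \<Rightarrow> real" where
  "divergence A g X x =
     (let c = chart_at A x in
        (\<Sum>i\<in>UNIV. partial_deriv i
            (\<lambda>y. volume_density g c (chart_inv c y) * X c (chart_inv c y) $ i) (chart_map c x))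
        / volume_density g c x)"

text \<open>For \<open>p = 2\<close> the convention \<open>0 powr 0 = 0\<close> is harmless: the gradient
  vanishes at such points.\<close>

definition p_laplacian ::
    "('a, 'n::finite) chart set \<Rightarrow> ('a, 'n) metric \<Rightarrow> real \<Rightarrow> ('a \<Rightarrow> real) \<Rightarrow> 'a \<Rightarrow> real" where
  "p_laplacian A g p u =
     divergence A g (\<lambda>c x. field_norm A g (grad g u) x powr (p - 2) *\<^sub>R grad g u c x)"

definition strongly_p_subharmonic ::
    "('a, 'n::finite) chart set \<Rightarrow> ('a, 'n) metric \<Rightarrow> real \<Rightarrow> ('a \<Rightarrow> real) \<Rightarrow> bool" where
  "strongly_p_subharmonic A g p u \<longleftrightarrow>
     smooth_function A u \<and> (\<exists>k>0. \<forall>x. p_laplacian A g p u x \<ge> k)"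


section \<open>Sobolev spaces and the first eigenvalue\<close>

text \<open>\<open>X\<close> is a weak gradient of \<open>f\<close> if, in every chart, the components of
  the covector field dual to \<open>X\<close> are the distributional partial derivatives of \<open>f\<close>.
  This is only used for \<open>f\<close> and \<open>X\<close> in \<open>L\<^sup>p\<close> with \<open>p \<ge> 1\<close>, where
  both integrals converge.\<close>

definition weak_gradient ::
    "('a::topological_space, 'n::finite) chart set \<Rightarrow> ('a, 'n) metric \<Rightarrow>
       ('a \<Rightarrow> real) \<Rightarrow> ('a, 'n) vfield \<Rightarrow> bool" where
  "weak_gradient A g f X \<longleftrightarrow>
     vector_field A X \<and>
     (\<forall>c\<in>A. X c \<in> borel_measurable (restrict_space borel (chart_dom c))) \<and>
     (\<forall>c\<in>A. \<forall>i. \<forall>\<psi>.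
        smooth_on UNIV \<psi> \<and> compact (closure {y. \<psi> y \<noteq> 0}) \<and>
        closure {y. \<psi> y \<noteq> 0} \<subseteq> chart_ran c \<longrightarrow>
        (LINT y:chart_ran c|lborel. f (chart_inv c y) * partial_deriv i \<psi> y) =
        - (LINT y:chart_ran c|lborel.
             (g c (chart_inv c y) *v X c (chart_inv c y)) $ i * \<psi> y))"

text \<open>Sobolev functions are represented together with their weak gradients, which are
  determined up to null sets.\<close>

definition sobolev ::
    "('a::topological_space, 'n::finite) chart set \<Rightarrow> ('a, 'n) metric \<Rightarrow> real \<Rightarrow>
       (('a \<Rightarrow> real) \<times> ('a, 'n) vfield) set" where
  "sobolev A g p =
     {(f, X). f \<in> borel_measurable borel \<and> weak_gradient A g f X \<and>
        integrable (riem_volume A g) (\<lambda>x. \<bar>f x\<bar> powr p) \<and>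
        integrable (riem_volume A g) (\<lambda>x. field_norm A g X x powr p)}"

definition sobolev_norm ::
    "('a::topological_space, 'n::finite) chart set \<Rightarrow> ('a, 'n) metric \<Rightarrow> real \<Rightarrow>
       ('a \<Rightarrow> real) \<Rightarrow> ('a, 'n) vfield \<Rightarrow> real" where
  "sobolev_norm A g p f X =
     ((LINT x|riem_volume A g. \<bar>f x\<bar> powr p) +
      (LINT x|riem_volume A g. field_norm A g X x powr p)) powr (1 / p)"

text \<open>The closure of the compactly supported smooth functions in the Sobolev norm.\<close>

definition sobolev0 ::
    "('a::topological_space, 'n::finite) chart set \<Rightarrow> ('a, 'n) metric \<Rightarrow> real \<Rightarrow>
       (('a \<Rightarrow> real) \<times> ('a, 'n) vfield) set" where
  "sobolev0 A g p =
     {(f, X) \<in> sobolev A g p.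
        \<exists>\<phi> :: nat \<Rightarrow> 'a \<Rightarrow> real. (\<forall>k. test_function A (\<phi> k)) \<and>
          (\<lambda>k. sobolev_norm A g p (\<lambda>x. f x - \<phi> k x) (\<lambda>c x. X c x - grad g (\<phi> k) c x))
            \<longlonglongrightarrow> 0}"

definition first_eigenvalue ::
    "('a::topological_space, 'n::finite) chart set \<Rightarrow> ('a, 'n) metric \<Rightarrow> real \<Rightarrow> real" where
  "first_eigenvalue A g p =
     Inf {(LINT x|riem_volume A g. field_norm A g X x powr p) /
          (LINT x|riem_volume A g. \<bar>f x\<bar> powr p) |f X.
            (f, X) \<in> sobolev0 A g p \<and> \<not> (AE x in riem_volume A g. f x = 0)}"

end

theory Submission
  imports Defs
begin

text \<open>
  A bounded strongly \<open>p\<close>-subharmonic function forces a Poincare inequality, that is, a positive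
  first eigenvalue.  Let \<open>\<bar>u\<bar> \<le> M\<close> and \<open>\<Delta>\<^sub>p u \<ge> k > 0\<close>, and write \<open>X = \<bar>\<nabla>u\<bar>\<^sup>p\<^sup>-\<^sup>2 \<nabla>u\<close>.  For a
  test function \<open>\<phi>\<close> the field \<open>\<bar>\<phi>\<bar>\<^sup>p exp ((p - 1) u) X\<close> has compact support, so its divergence
  integrates to zero.  Expanding the divergence gives the terms \<open>k \<bar>\<phi>\<bar>\<^sup>p\<close> (at least) and
  \<open>(p - 1) \<bar>\<phi>\<bar>\<^sup>p \<bar>\<nabla>u\<bar>\<^sup>p\<close>, against a mixed term of size at most \<open>p \<bar>\<phi>\<bar>\<^sup>p\<^sup>-\<^sup>1 \<bar>\<nabla>u\<bar>\<^sup>p\<^sup>-\<^sup>1 \<bar>\<nabla>\<phi>\<bar>\<close>,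
  all weighted by \<open>exp ((p - 1) u)\<close>.  Young's inequality bounds the mixed term by
  \<open>(p - 1) \<bar>\<phi>\<bar>\<^sup>p \<bar>\<nabla>u\<bar>\<^sup>p + \<bar>\<nabla>\<phi>\<bar>\<^sup>p\<close>, the gradient of \<open>u\<close> disappears, and
  \<open>k \<integral> \<bar>\<phi>\<bar>\<^sup>p exp ((p - 1) u) \<le> \<integral> \<bar>\<nabla>\<phi>\<bar>\<^sup>p exp ((p - 1) u)\<close> remains
  (\<open>test_function_inequality\<close>).  Since the weight lies between \<open>exp (\<plusminus> (p - 1) M)\<close>, this is a
  Poincare inequality for test functions; it passes to the Sobolev closure
  (\<open>sobolev0_Poincare\<close>) and bounds the first eigenvalue below (\<open>first_eigenvalue_pos\<close>).

  The main analytic tool is integration by parts on the manifold (\<open>integral_divergence\<close>).  It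
  rests on four facts.  The chart densities glue to a unique volume measure, by the
  change-of-variables theorem (\<open>riem_volume_unique_exists\<close>).  The field \<open>X\<close> is of class \<open>C\<^sup>1\<close>
  even at critical points of \<open>u\<close> (\<open>C1_field_flux\<close>).  In a single chart the identity is the
  vanishing of the integral of a derivative of a compactly supported function
  (\<open>integral_derivative_eq_0\<close>), and a partition of unity reduces to that case
  (\<open>chart_decomposition\<close>).  The coordinate formula for the divergence is independent of the chart
  (\<open>chart_divergence_eq\<close>); this is deduced from integration by parts in the two charts, without
  differentiating Jacobian determinants.

  The eigenvalue is an infimum of a set of real numbers, and the infimum of the empty set is an
  unspecified number.  Smooth bump functions show that the set is nonempty
  (\<open>exists_nonzero_sobolev0\<close>).
\<close>

section \<open>Calculus of \<open>C\<^sup>k\<close> functions\<close>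

lemma Ck_on_cong:
  assumes "open S" and "\<And>x. x \<in> S \<Longrightarrow> f x = h x" and "Ck_on k S f"
  shows "Ck_on k S h"
  using assms(2,3)
proof (induction k arbitrary: f h)
  case 0
  then show ?case
    by (simp cong: continuous_on_cong_simp)
next
  case (Suc k)
  have diff: "f differentiable (at x)" if "x \<in> S" for x
    using Suc.prems(2) that by simp
  have "h differentiable (at x)" if x: "x \<in> S" for x
    using diff[OF x] unfolding differentiable_def
    by (meson Suc.prems(1) assms(1) has_derivative_transform_within_open x)
  moreover have "frechet_derivative f (at x) = frechet_derivative h (at x)" if x: "x \<in> S" for x
    using frechet_derivative_transform_within_open[OF diff[OF x] assms(1) x Suc.prems(1)] .
  moreover have "Ck_on k S (\<lambda>x. frechet_derivative f (at x) v)" for v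
    using Suc.prems(2) by simp
  ultimately show ?case
    unfolding Ck_on.simps by (metis (mono_tags, lifting) Suc.IH)
qed

lemma Ck_on_SucI:
  assumes "open S" and "\<And>x. x \<in> S \<Longrightarrow> (f has_derivative f' x) (at x)"
    and "\<And>v. Ck_on k S (\<lambda>x. f' x v)"
  shows "Ck_on (Suc k) S f"
proof -
  have "Ck_on k S (\<lambda>x. frechet_derivative f (at x) v)" for v
    using frechet_derivative_at[OF assms(2)] by (intro Ck_on_cong[OF assms(1) _ assms(3)]) auto
  then show ?thesis
    using assms(2) by (auto simp: differentiable_def)
qed

lemma Ck_on_SucD:
  assumes "Ck_on (Suc k) S f"
  shows "x \<in> S \<Longrightarrow> (f has_derivative frechet_derivative f (at x)) (at x)"
    and "Ck_on k S (\<lambda>x. frechet_derivative f (at x) v)"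
  using assms by (auto simp: frechet_derivative_works[symmetric])

lemma Ck_on_Suc_imp: "Ck_on (Suc k) S f \<Longrightarrow> Ck_on k S f"
proof (induction k arbitrary: f)
  case 0
  then show ?case
    by (auto intro!: continuous_at_imp_continuous_on differentiable_imp_continuous_within)
next
  case (Suc k)
  then show ?case by (metis Ck_on.simps(2))
qed

lemma Ck_on_le:
  assumes "Ck_on k S f" "j \<le> k"
  shows "Ck_on j S f"
  using assms(2,1) by (induction rule: inc_induct) (blast intro: Ck_on_Suc_imp)+

lemma Ck_on_subset: "Ck_on k S f \<Longrightarrow> T \<subseteq> S \<Longrightarrow> Ck_on k T f"
  by (induction k arbitrary: f) (auto intro: continuous_on_subset)

lemma Ck_on_locally:
  assumes "\<And>x. x \<in> S \<Longrightarrow> \<exists>T. open T \<and> x \<in> T \<and> Ck_on k T f"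
  shows "Ck_on k S f"
  using assms
proof (induction k arbitrary: f)
  case 0
  have "isCont f x" if x: "x \<in> S" for x
  proof -
    obtain T where "open T" "x \<in> T" "continuous_on T f" using 0[OF x] by auto
    then show ?thesis using continuous_on_eq_continuous_at by blast
  qed
  then show ?case by (simp add: continuous_at_imp_continuous_on)
next
  case (Suc k)
  show ?case
    unfolding Ck_on.simps
  proof (intro conjI ballI allI)
    fix x assume "x \<in> S"
    then show "f differentiable at x"
      using Suc.prems[of x] by auto
  next
    fix v
    show "Ck_on k S (\<lambda>x. frechet_derivative f (at x) v)"
    proof (rule Suc.IH)
      fix x assume "x \<in> S"
      then obtain T where "open T" "x \<in> T" "Ck_on (Suc k) T f" using Suc.prems[of x] by blast
      then show "\<exists>T. open T \<and> x \<in> T \<and> Ck_on k T (\<lambda>x. frechet_derivative f (at x) v)"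
        using Ck_on_SucD(2) by blast
    qed
  qed
qed

lemma Ck_on_continuous: "Ck_on k S f \<Longrightarrow> continuous_on S f"
  using Ck_on_le[of k S f 0] by simp

lemma smooth_on_Ck: "smooth_on S f \<Longrightarrow> Ck_on k S f"
  by (simp add: smooth_on_def)

lemma Ck_on_const: "Ck_on k S (\<lambda>x. c)"
proof (induction k arbitrary: c)
  case (Suc k)
  then show ?case by simp
qed simp

text \<open>From here on, regularity is established by closure properties instead of by unfolding the
  recursion.\<close>

declare Ck_on.simps(2) [simp del]

lemma Ck_on_bounded_linear_compose:
  assumes "open S" "bounded_linear L"
  shows "Ck_on k S f \<Longrightarrow> Ck_on k S (\<lambda>x. L (f x))"
proof (induction k arbitrary: f)
  case 0
  then show ?case
    using bounded_linear.continuous_on[OF assms(2), of S f] by simp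
next
  case (Suc k)
  show ?case
  proof (rule Ck_on_SucI[OF assms(1)])
    show "((\<lambda>x. L (f x)) has_derivative (\<lambda>v. L (frechet_derivative f (at x) v))) (at x)"
      if "x \<in> S" for x
      using bounded_linear.has_derivative[OF assms(2) Ck_on_SucD(1)[OF Suc.prems that]] .
    show "Ck_on k S (\<lambda>x. L (frechet_derivative f (at x) v))" for v
      by (rule Suc.IH[OF Ck_on_SucD(2)[OF Suc.prems]])
  qed
qed

lemma Ck_on_id: "open S \<Longrightarrow> Ck_on k S (\<lambda>x. x)"
proof (cases k)
  case (Suc j)
  assume "open S"
  then show ?thesis
    unfolding Suc by (intro Ck_on_SucI[where f' = "\<lambda>x v. v"]) (auto intro: Ck_on_const)
qed simp

lemma Ck_on_bounded_linear: "open S \<Longrightarrow> bounded_linear L \<Longrightarrow> Ck_on k S L"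
  using Ck_on_bounded_linear_compose[OF _ _ Ck_on_id] by blast

lemma Ck_on_add:
  assumes "open S"
  shows "Ck_on k S f \<Longrightarrow> Ck_on k S h \<Longrightarrow> Ck_on k S (\<lambda>x. f x + h x)"
proof (induction k arbitrary: f h)
  case 0
  then show ?case by (simp add: continuous_on_add)
next
  case (Suc k)
  show ?case
  proof (rule Ck_on_SucI[OF assms])
    show "((\<lambda>x. f x + h x) has_derivative
        (\<lambda>v. frechet_derivative f (at x) v + frechet_derivative h (at x) v)) (at x)"
      if "x \<in> S" for x
      using Ck_on_SucD(1)[OF Suc.prems(1) that] Ck_on_SucD(1)[OF Suc.prems(2) that]
      by (rule has_derivative_add)
    show "Ck_on k S (\<lambda>x. frechet_derivative f (at x) v + frechet_derivative h (at x) v)" for v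
      using Suc.prems by (intro Suc.IH Ck_on_SucD(2))
  qed
qed

lemma Ck_on_sum:
  assumes "open S" "\<And>i. i \<in> I \<Longrightarrow> Ck_on k S (f i)"
  shows "Ck_on k S (\<lambda>x. \<Sum>i\<in>I. f i x)"
  using assms(2)
  by (induction I rule: infinite_finite_induct) (auto intro!: Ck_on_const Ck_on_add[OF assms(1)])

lemma Ck_on_scaleR:
  assumes "open S"
  shows "Ck_on k S f \<Longrightarrow> Ck_on k S h \<Longrightarrow> Ck_on k S (\<lambda>x. f x *\<^sub>R h x)"
proof (induction k arbitrary: f h)
  case 0
  then show ?case by (simp add: continuous_on_scaleR)
next
  case (Suc k)
  show ?case
  proof (rule Ck_on_SucI[OF assms])
    show "((\<lambda>x. f x *\<^sub>R h x) has_derivative (\<lambda>v. f x *\<^sub>R frechet_derivative h (at x) v +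
        frechet_derivative f (at x) v *\<^sub>R h x)) (at x)" if "x \<in> S" for x
      using Ck_on_SucD(1)[OF Suc.prems(1) that] Ck_on_SucD(1)[OF Suc.prems(2) that]
      by (rule has_derivative_scaleR)
    show "Ck_on k S (\<lambda>x. f x *\<^sub>R frechet_derivative h (at x) v +
        frechet_derivative f (at x) v *\<^sub>R h x)" for v
      using Suc.prems by (intro Ck_on_add[OF assms] Suc.IH Ck_on_SucD(2)) (auto intro: Ck_on_Suc_imp)
  qed
qed

lemma Ck_on_mult:
  fixes f h :: "'b::euclidean_space \<Rightarrow> real"
  assumes "open S" "Ck_on k S f" "Ck_on k S h"
  shows "Ck_on k S (\<lambda>x. f x * h x)"
  using Ck_on_scaleR[OF assms] by simp

lemma Ck_on_prod:
  fixes f :: "'i \<Rightarrow> 'b::euclidean_space \<Rightarrow> real"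
  assumes "open S" "\<And>i. i \<in> I \<Longrightarrow> Ck_on k S (f i)"
  shows "Ck_on k S (\<lambda>x. \<Prod>i\<in>I. f i x)"
  using assms(2)
  by (induction I rule: infinite_finite_induct) (auto intro!: Ck_on_const Ck_on_mult[OF assms(1)])

lemma Ck_on_compose:
  fixes f :: "'b::euclidean_space \<Rightarrow> 'c::euclidean_space"
    and h :: "'c \<Rightarrow> 'd::real_normed_vector"
  assumes "open S" "open T" "f ` S \<subseteq> T"
  shows "Ck_on k S f \<Longrightarrow> Ck_on k T h \<Longrightarrow> Ck_on k S (\<lambda>x. h (f x))"
proof (induction k arbitrary: h)
  case 0
  then show ?case
    using continuous_on_compose2[of T h S f] assms(3) by simp
next
  case (Suc k)
  let ?Df = "\<lambda>x. frechet_derivative f (at x)" and ?Dh = "\<lambda>z. frechet_derivative h (at z)"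
  show ?case
  proof (rule Ck_on_SucI[OF assms(1)])
    \<comment> \<open>The chain rule is expanded in a basis of the intermediate space, so that the derivative
      becomes a sum of products to which the induction hypothesis applies.\<close>
    show "((\<lambda>x. h (f x)) has_derivative
        (\<lambda>v. \<Sum>b\<in>Basis. (?Df x v \<bullet> b) *\<^sub>R ?Dh (f x) b)) (at x)" if x: "x \<in> S" for x
    proof -
      have fx: "f x \<in> T" using assms(3) x by auto
      have Dh: "(h has_derivative ?Dh (f x)) (at (f x))"
        by (rule Ck_on_SucD(1)[OF Suc.prems(2) fx])
      have chain: "((\<lambda>x. h (f x)) has_derivative (\<lambda>v. ?Dh (f x) (?Df x v))) (at x)"
        using diff_chain_at[OF Ck_on_SucD(1)[OF Suc.prems(1) x] Dh] by (simp add: o_def)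
      have expand: "?Dh (f x) w = (\<Sum>b\<in>Basis. (w \<bullet> b) *\<^sub>R ?Dh (f x) b)" for w
      proof -
        have lin: "linear (?Dh (f x))"
          using Dh by (rule has_derivative_linear)
        have "?Dh (f x) w = ?Dh (f x) (\<Sum>b\<in>Basis. (w \<bullet> b) *\<^sub>R b)"
          by (simp add: euclidean_representation)
        also have "\<dots> = (\<Sum>b\<in>Basis. (w \<bullet> b) *\<^sub>R ?Dh (f x) b)"
          by (simp add: linear_sum[OF lin] linear_cmul[OF lin])
        finally show ?thesis .
      qed
      show ?thesis
        using chain by (subst (asm) expand)
    qed
    show "Ck_on k S (\<lambda>x. \<Sum>b\<in>Basis. (?Df x v \<bullet> b) *\<^sub>R ?Dh (f x) b)" for v
      by (intro Ck_on_sum Ck_on_scaleR assms(1)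
          Ck_on_bounded_linear_compose[OF assms(1) bounded_linear_inner_left]
          Ck_on_SucD(2)[OF Suc.prems(1)]
          Suc.IH[OF Ck_on_Suc_imp[OF Suc.prems(1)] Ck_on_SucD(2)[OF Suc.prems(2)]])
  qed
qed

lemma Ck_on_exp: "Ck_on k UNIV (exp :: real \<Rightarrow> real)"
proof (induction k)
  case (Suc k)
  show ?case
  proof (rule Ck_on_SucI)
    show "(exp has_derivative (\<lambda>v. exp x * v)) (at x)" for x :: real
      using DERIV_exp[of x] by (simp add: has_field_derivative_def)
    show "Ck_on k UNIV (\<lambda>x. exp x * v)" for v :: real
      using Suc by (intro Ck_on_mult Ck_on_const) auto
  qed simp
qed (simp add: continuous_on_exp)

lemma Ck_on_powr: "Ck_on k {0<..} (\<lambda>x::real. x powr r)"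
proof (induction k arbitrary: r)
  case 0
  then show ?case by (auto intro!: continuous_intros)
next
  case (Suc k)
  show ?case
  proof (rule Ck_on_SucI)
    show "((\<lambda>x. x powr r) has_derivative (\<lambda>v. (r * x powr (r - 1)) * v)) (at x)"
      if "x \<in> {0<..}" for x :: real
      using has_real_derivative_powr[of x r] that
      by (simp add: has_field_derivative_def)
    show "Ck_on k {0<..} (\<lambda>x. (r * x powr (r - 1)) * v)" for v :: real
      by (intro Ck_on_mult Ck_on_const Suc) auto
  qed simp
qed

lemma Ck_on_powr_compose:
  fixes f :: "'b::euclidean_space \<Rightarrow> real"
  assumes "open S" "Ck_on k S f" "\<And>x. x \<in> S \<Longrightarrow> f x > 0"
  shows "Ck_on k S (\<lambda>x. f x powr r)"
  using Ck_on_compose[OF assms(1) open_greaterThan _ assms(2) Ck_on_powr] assms(3) by auto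

lemma Ck_on_divide:
  fixes f :: "'b::euclidean_space \<Rightarrow> real"
  assumes "open S" "Ck_on k S f" "Ck_on k S h" "\<And>x. x \<in> S \<Longrightarrow> h x > 0"
  shows "Ck_on k S (\<lambda>x. f x / h x)"
proof (rule Ck_on_cong[OF assms(1)])
  show "Ck_on k S (\<lambda>x. f x * h x powr (-1))"
    using assms by (intro Ck_on_mult Ck_on_powr_compose) auto
  show "f x * h x powr (-1) = f x / h x" if "x \<in> S" for x
    using assms(4)[OF that] by (simp add: powr_minus_divide)
qed

lemma Ck_on_sqrt:
  fixes h :: "'b::euclidean_space \<Rightarrow> real"
  assumes "open S" "Ck_on k S h" "\<And>x. x \<in> S \<Longrightarrow> h x > 0"
  shows "Ck_on k S (\<lambda>x. sqrt (h x))"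
proof (rule Ck_on_cong[OF assms(1)])
  show "Ck_on k S (\<lambda>x. h x powr (1/2))"
    using assms by (intro Ck_on_powr_compose) auto
  show "h x powr (1/2) = sqrt (h x)" if "x \<in> S" for x
    using assms(3)[OF that] by (simp add: powr_half_sqrt)
qed

lemma Ck_on_vec_nth:
  fixes f :: "'b::euclidean_space \<Rightarrow> 'c::real_normed_vector ^ 'n"
  assumes "open S" "Ck_on k S f"
  shows "Ck_on k S (\<lambda>x. f x $ i)"
  by (rule Ck_on_bounded_linear_compose[OF assms(1) bounded_linear_vec_nth assms(2)])

lemma Ck_on_det:
  fixes f :: "'b::euclidean_space \<Rightarrow> real ^ 'n ^ 'n"
  assumes "open S" "\<And>i j. Ck_on k S (\<lambda>x. f x $ i $ j)"
  shows "Ck_on k S (\<lambda>x. det (f x))"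
  unfolding det_def by (intro Ck_on_sum Ck_on_mult Ck_on_prod Ck_on_const assms)

lemma abs_powr_sgn_tendsto_0:
  fixes r :: real
  assumes "r > 0"
  shows "((\<lambda>h. \<bar>h\<bar> powr r * sgn h) \<longlongrightarrow> 0) (at 0)"
proof (rule Lim_null_comparison)
  show "((\<lambda>h::real. \<bar>h\<bar> powr r) \<longlongrightarrow> 0) (at 0)"
    using assms by (auto intro!: tendsto_eq_intros)
  show "\<forall>\<^sub>F h::real in at 0. norm (\<bar>h\<bar> powr r * sgn h) \<le> \<bar>h\<bar> powr r"
    by (auto simp: abs_mult sgn_if)
qed

text \<open>The derivative of \<open>\<bar>s\<bar>\<^sup>p\<close> at the origin vanishes for \<open>p > 1\<close> because
  \<open>\<bar>s\<bar>\<^sup>p = o(\<bar>s\<bar>)\<close>; this is why \<open>\<bar>\<phi>\<bar>\<^sup>p\<close> is an admissible \<open>C\<^sup>1\<close> weight even where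
  \<open>\<phi>\<close> changes sign.\<close>

lemma has_real_derivative_abs_powr:
  fixes p :: real
  assumes "p > 1"
  shows "((\<lambda>s. \<bar>s\<bar> powr p) has_real_derivative p * \<bar>s\<bar> powr (p - 1) * sgn s) (at s)"
proof -
  consider "s > 0" | "s < 0" | "s = 0" by linarith
  then show ?thesis
  proof cases
    case 1
    show ?thesis
    proof (rule has_field_derivative_transform_within_open[where S = "{0<..}"])
      show "((\<lambda>s. s powr p) has_real_derivative p * \<bar>s\<bar> powr (p - 1) * sgn s) (at s)"
        using has_real_derivative_powr[of s p] 1 by simp
    qed (use 1 in auto)
  next
    case 2
    show ?thesis
    proof (rule has_field_derivative_transform_within_open[where S = "{..<0}"])
      show "((\<lambda>s. (- s) powr p) has_real_derivative p * \<bar>s\<bar> powr (p - 1) * sgn s) (at s)"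
        using 2 by (auto intro!: derivative_eq_intros simp: powr_diff field_simps)
    qed (use 2 in auto)
  next
    case 3
    have "((\<lambda>h. \<bar>h\<bar> powr (p - 1) * sgn h) \<longlongrightarrow> 0) (at (0::real))"
      using assms by (intro abs_powr_sgn_tendsto_0) simp
    moreover have "(\<bar>0 + h\<bar> powr p - \<bar>0\<bar> powr p) / h = \<bar>h\<bar> powr (p - 1) * sgn h" for h :: real
      using assms by (auto simp: powr_diff sgn_if field_simps abs_if)
    ultimately show ?thesis
      unfolding 3 has_field_derivative_iff by simp
  qed
qed

lemma Ck_on_abs_powr:
  fixes p :: real
  assumes "p > 1"
  shows "Ck_on (Suc 0) UNIV (\<lambda>s::real. \<bar>s\<bar> powr p)"
proof (rule Ck_on_SucI[where f' = "\<lambda>s v. (p * \<bar>s\<bar> powr (p - 1) * sgn s) * v"])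
  show "((\<lambda>s. \<bar>s\<bar> powr p) has_derivative (\<lambda>v. (p * \<bar>s\<bar> powr (p - 1) * sgn s) * v)) (at s)" for s :: real
    using has_real_derivative_abs_powr[OF assms, of s] by (simp add: has_field_derivative_def)
  have "isCont (\<lambda>s. \<bar>s\<bar> powr (p - 1) * sgn s) s" for s :: real
  proof (cases "s = 0")
    case True
    have "((\<lambda>h. \<bar>h\<bar> powr (p - 1) * sgn h) \<longlongrightarrow> 0) (at (0::real))"
      using assms by (intro abs_powr_sgn_tendsto_0) simp
    then show ?thesis by (simp add: True isCont_def)
  next
    case False
    then show ?thesis by (intro continuous_intros) auto
  qed
  then have "continuous_on UNIV (\<lambda>s::real. p * (\<bar>s\<bar> powr (p - 1) * sgn s) * v)" for v
    by (intro continuous_intros continuous_at_imp_continuous_on) simp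
  then show "Ck_on 0 UNIV (\<lambda>s. p * \<bar>s\<bar> powr (p - 1) * sgn s * v)" for v :: real
    by (simp add: mult.assoc)
qed simp

section \<open>Smooth bump functions\<close>

text \<open>The family \<open>t\<^sup>-\<^sup>m exp(-1/t)\<close>, extended by zero to \<open>t \<le> 0\<close>, is closed under
  differentiation up to linear combinations, so smoothness follows by one induction over all
  \<open>m\<close> at once.\<close>

definition flat_exp :: "nat \<Rightarrow> real \<Rightarrow> real" where
  "flat_exp m t = (if t \<le> 0 then 0 else inverse t ^ m * exp (- inverse t))"

lemma flat_exp_tendsto_0: "(flat_exp m \<longlongrightarrow> 0) (at 0)"
proof -
  have "((\<lambda>t. inverse t ^ m / exp (inverse t)) \<longlongrightarrow> 0) (at_right (0::real))"
    using filterlim_compose[OF tendsto_power_div_exp_0 filterlim_inverse_at_top_right] .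
  then have "(flat_exp m \<longlongrightarrow> 0) (at_right 0)"
    by (rule Lim_transform_eventually)
      (auto simp: flat_exp_def eventually_at_filter exp_minus field_simps)
  moreover have "(flat_exp m \<longlongrightarrow> 0) (at_left 0)"
    by (rule tendsto_eventually) (auto simp: flat_exp_def eventually_at_filter)
  ultimately show ?thesis by (rule filterlim_split_at[rotated])
qed

lemma has_real_derivative_flat_exp:
  "(flat_exp m has_real_derivative flat_exp (m + 2) t - m * flat_exp (m + 1) t) (at t)"
proof -
  consider "t > 0" | "t < 0" | "t = 0" by linarith
  then show ?thesis
  proof cases
    case 1
    show ?thesis
    proof (rule has_field_derivative_transform_within_open[where S = "{0<..}"])
      show "((\<lambda>t. inverse t ^ m * exp (- inverse t)) has_real_derivative
          flat_exp (m + 2) t - m * flat_exp (m + 1) t) (at t)"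
      proof (cases m)
        case 0
        then show ?thesis
          using 1 by (auto intro!: derivative_eq_intros simp: flat_exp_def power2_eq_square)
      next
        case (Suc j)
        have "((\<lambda>t. inverse t ^ Suc j * exp (- inverse t)) has_real_derivative
            inverse t ^ Suc j * (exp (- inverse t) * (inverse t)\<^sup>2) +
            - (real (Suc j) * inverse t ^ j * (inverse t)\<^sup>2) * exp (- inverse t)) (at t)"
          using 1 by (auto intro!: derivative_eq_intros simp del: power_Suc
              simp: power2_eq_square inverse_eq_divide)
        then show ?thesis
          using 1 Suc by (simp add: flat_exp_def power2_eq_square algebra_simps)
      qed
    qed (use 1 in \<open>auto simp: flat_exp_def\<close>)
  next
    case 2
    show ?thesis
      by (rule has_field_derivative_transform_within_open[where S = "{..<0}" and f = "\<lambda>_. 0"])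
        (use 2 in \<open>auto simp: flat_exp_def\<close>)
  next
    case 3
    have "(\<lambda>h. (flat_exp m (0 + h) - flat_exp m 0) / h) = flat_exp (m + 1)"
      by (auto simp: flat_exp_def field_simps)
    then show ?thesis
      using flat_exp_tendsto_0[of "m + 1"] unfolding 3 has_field_derivative_iff
      by (simp add: flat_exp_def[of _ 0])
  qed
qed

lemma Ck_on_flat_exp: "Ck_on k UNIV (flat_exp m)"
proof (induction k arbitrary: m)
  case 0
  then show ?case
    using has_real_derivative_flat_exp DERIV_isCont continuous_at_imp_continuous_on by simp blast
next
  case (Suc k)
  show ?case
  proof (rule Ck_on_SucI)
    show "(flat_exp m has_derivative (\<lambda>v. (flat_exp (m + 2) x + (- real m) * flat_exp (m + 1) x) * v)) (at x)"
      for x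
      using has_real_derivative_flat_exp[of m x] by (simp add: has_field_derivative_def)
    show "Ck_on k UNIV (\<lambda>x. (flat_exp (m + 2) x + (- real m) * flat_exp (m + 1) x) * v)" for v
      by (intro Ck_on_mult Ck_on_add Ck_on_const Suc) auto
  qed simp
qed

definition bump :: "'b::euclidean_space \<Rightarrow> real \<Rightarrow> 'b \<Rightarrow> real" where
  "bump z r y = flat_exp 0 (r\<^sup>2 - (norm (y - z))\<^sup>2)"

lemma bump_nonneg: "bump z r y \<ge> 0"
  by (simp add: bump_def flat_exp_def)

lemma bump_pos_iff: "r > 0 \<Longrightarrow> bump z r y > 0 \<longleftrightarrow> y \<in> ball z r"
  using abs_le_square_iff[of r "norm (y - z)"]
  by (auto simp: bump_def flat_exp_def dist_norm norm_minus_commute)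

lemma bump_eq_0: "r > 0 \<Longrightarrow> y \<notin> ball z r \<Longrightarrow> bump z r y = 0"
  using bump_nonneg[of z r y] bump_pos_iff[of r z y] by linarith

lemma Ck_on_bump: "Ck_on k UNIV (bump z r)"
proof -
  have lin: "Ck_on k UNIV (\<lambda>y. (y - z) \<bullet> b)" for b
    using Ck_on_add[OF open_UNIV Ck_on_bounded_linear[OF open_UNIV bounded_linear_inner_left[of b]]
        Ck_on_const[of _ _ "- (z \<bullet> b)"]]
    by (simp add: inner_diff_left)
  have "Ck_on k UNIV (\<lambda>y. r\<^sup>2 + (\<Sum>b\<in>Basis. (- 1) * (((y - z) \<bullet> b) * ((y - z) \<bullet> b))))"
    by (intro Ck_on_add Ck_on_const Ck_on_sum Ck_on_mult lin open_UNIV)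
  moreover have "r\<^sup>2 + (\<Sum>b\<in>Basis. (- 1) * (((y - z) \<bullet> b) * ((y - z) \<bullet> b))) = r\<^sup>2 - (norm (y - z))\<^sup>2" for y
    unfolding power2_norm_eq_inner euclidean_inner[of "y - z" "y - z"] by (simp add: sum_negf)
  ultimately have "Ck_on k UNIV (\<lambda>y. r\<^sup>2 - (norm (y - z))\<^sup>2)" by simp
  then show ?thesis
    using Ck_on_compose[OF open_UNIV open_UNIV _ _ Ck_on_flat_exp, of _ k 0]
    unfolding bump_def[abs_def] by auto
qed


section \<open>Change of variables over an arbitrary finite index type\<close>

text \<open>The theorem \<open>has_measure_differentiable_image\<close> concerns vectors whose index type is well
  ordered.  A copy of a finite index type, ordered through an enumeration, carries it over to
  every finite index type: renaming coordinates preserves measures and determinants.\<close>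

typedef (overloaded) ('n::finite) ordered_copy = "UNIV :: 'n set"
  morphisms to_base of_base ..

instance ordered_copy :: (finite) finite
proof
  have "(UNIV :: 'a ordered_copy set) = range of_base"
    by (metis (no_types, lifting) to_base_inverse surjI)
  then show "finite (UNIV :: 'a ordered_copy set)"
    by (metis finite_code finite_imageI)
qed

instantiation ordered_copy :: (finite) wellorder
begin

definition less_eq_ordered_copy :: "'a ordered_copy \<Rightarrow> 'a ordered_copy \<Rightarrow> bool" where
  "less_eq_ordered_copy a b \<longleftrightarrow> to_nat (to_base a) \<le> to_nat (to_base b)"

definition less_ordered_copy :: "'a ordered_copy \<Rightarrow> 'a ordered_copy \<Rightarrow> bool" where
  "less_ordered_copy a b \<longleftrightarrow> to_nat (to_base a) < to_nat (to_base b)"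

instance
proof
  fix P :: "'a ordered_copy \<Rightarrow> bool" and a
  assume step: "\<And>x. (\<And>y. y < x \<Longrightarrow> P y) \<Longrightarrow> P x"
  show "P a"
    by (induction "to_nat (to_base a)" arbitrary: a rule: less_induct)
      (metis less_ordered_copy_def step)
qed (auto simp: less_eq_ordered_copy_def less_ordered_copy_def to_base_inject)

end

lemma bij_to_base: "bij to_base"
  by (metis of_base_inverse to_base_inverse UNIV_I bij_betw_byWitness subset_UNIV)

definition rename_coords :: "real^'n::finite \<Rightarrow> real^('n ordered_copy)" where
  "rename_coords x = (\<chi> j. x $ to_base j)"

definition rename_back :: "real^('n::finite ordered_copy) \<Rightarrow> real^'n" where
  "rename_back z = (\<chi> i. z $ of_base i)"

lemma rename_inverse [simp]: "rename_back (rename_coords x) = x" "rename_coords (rename_back z) = z"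
  by (simp_all add: rename_back_def rename_coords_def vec_eq_iff of_base_inverse
      to_base_inverse)

lemma bounded_linear_rename: "bounded_linear rename_coords" "bounded_linear rename_back"
  by (auto intro!: linear_conv_bounded_linear[THEN iffD1] linearI
      simp: rename_back_def rename_coords_def vec_eq_iff)

lemma bij_rename: "bij rename_coords" "bij rename_back"
  by (auto intro!: o_bij[of rename_back rename_coords] o_bij[of rename_coords rename_back]
      simp: fun_eq_iff)

lemma measurable_rename [measurable]:
  "rename_coords \<in> borel_measurable borel" "rename_back \<in> borel_measurable borel"
  by (auto intro!: borel_measurable_continuous_onI linear_continuous_on bounded_linear_rename)

lemma prod_Basis_vec:
  fixes f :: "real^'n \<Rightarrow> 'b::comm_monoid_mult"
  shows "(\<Prod>b\<in>Basis. f b) = (\<Prod>i\<in>UNIV. f (axis i 1))"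
proof -
  have "Basis = range (\<lambda>i::'n. axis i (1::real))"
    by (auto simp: Basis_vec_def)
  moreover have "inj (\<lambda>i::'n. axis i (1::real))"
    by (auto simp: inj_def axis_eq_axis)
  ultimately show ?thesis
    using prod.reindex[of "\<lambda>i::'n. axis i (1::real)" UNIV f] by (simp add: o_def)
qed

lemma distr_lborel_rename: "distr lborel borel (rename_coords :: real^'n::finite \<Rightarrow> _) = lborel"
proof (rule lborel_eqI[symmetric])
  fix l u :: "real^('n ordered_copy)"
  assume le: "\<And>b. b \<in> Basis \<Longrightarrow> l \<bullet> b \<le> u \<bullet> b"
  then have le': "l $ i \<le> u $ i" for i
    by (metis axis_in_Basis_iff Basis_real_def inner_axis insertI1 inner_real_def mult.right_neutral)
  have "rename_coords -` box l u = box (rename_back l) (rename_back u)"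
    by (auto simp: mem_box_cart rename_coords_def rename_back_def)
      (metis to_base_inverse of_base_inverse UNIV_I)+
  then have "emeasure (distr lborel borel rename_coords) (box l u) =
      emeasure lborel (box (rename_back l) (rename_back u))"
    by (subst emeasure_distr) auto
  also have "\<dots> = (\<Prod>b\<in>Basis. (rename_back u - rename_back l) \<bullet> b)"
    using le' by (subst emeasure_lborel_box)
      (auto simp: Basis_vec_def inner_axis rename_back_def)
  also have "\<dots> = (\<Prod>i\<in>UNIV. u $ of_base i - l $ of_base i)"
    by (simp add: prod_Basis_vec inner_axis rename_back_def)
  also have "\<dots> = (\<Prod>j\<in>UNIV. u $ j - l $ j)"
    using bij_to_base
    by (intro arg_cong[where f = ennreal] prod.reindex_bij_witness[of _ to_base of_base])
      (auto simp: to_base_inverse of_base_inverse)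
  also have "\<dots> = (\<Prod>b\<in>Basis. (u - l) \<bullet> b)"
    by (simp add: prod_Basis_vec inner_axis)
  finally show "emeasure (distr lborel borel rename_coords) (box l u) = (\<Prod>b\<in>Basis. (u - l) \<bullet> b)" .
qed simp

text \<open>Renaming conjugates the permutations in the Leibniz formula, and conjugation preserves
  signs.\<close>

lemma det_rename:
  fixes A :: "real^'n::finite^'n"
  shows "det (\<chi> a b. A $ to_base a $ to_base b) = det A"
proof -
  let ?R = "to_base :: 'n ordered_copy \<Rightarrow> 'n" and ?A = "of_base :: 'n \<Rightarrow> 'n ordered_copy"
  let ?conj = "map_permutation UNIV ?R"
  have conj: "?conj q = ?R \<circ> q \<circ> ?A" for q
  proof -
    have "inv_into UNIV ?R = ?A"
      by (intro inv_equality) (simp_all add: of_base_inverse to_base_inverse)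
    then show ?thesis
      by (simp add: map_permutation_def restrict_id_def bij_is_surj[OF bij_to_base] o_def)
  qed
  have "det A = (\<Sum>p | p permutes (UNIV :: 'n set). of_int (sign p) * (\<Prod>i\<in>UNIV. A $ i $ p i))"
    by (simp add: det_def)
  also have "\<dots> = (\<Sum>q | q permutes (UNIV :: 'n ordered_copy set).
      of_int (sign q) * (\<Prod>a\<in>UNIV. A $ ?R a $ ?R (q a)))"
  proof (rule sum.reindex_bij_witness[of _ ?conj "\<lambda>p. ?A \<circ> p \<circ> ?R"])
    fix p :: "'n \<Rightarrow> 'n" assume p: "p \<in> {p. p permutes UNIV}"
    show "?conj (?A \<circ> p \<circ> ?R) = p"
      by (simp add: conj fun_eq_iff of_base_inverse)
    have "bij p" using p by (simp add: permutes_bij)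
    have bA: "bij ?A"
      by (auto intro!: o_bij[of ?R] simp: fun_eq_iff of_base_inverse to_base_inverse)
    have "bij (?A \<circ> p \<circ> ?R)"
      using \<open>bij p\<close> bA bij_to_base by (intro bij_comp)
    then show q: "?A \<circ> p \<circ> ?R \<in> {q. q permutes UNIV}"
      by (auto intro: bij_imp_permutes)
    have "sign p = sign (?conj (?A \<circ> p \<circ> ?R))"
      by (simp add: conj fun_eq_iff of_base_inverse comp_def)
    also have "\<dots> = sign (?A \<circ> p \<circ> ?R)"
      using q bij_is_inj[OF bij_to_base] by (intro sign_map_permutation) simp_all
    finally have "sign (?A \<circ> p \<circ> ?R) = sign p" by simp
    moreover have "(\<Prod>a\<in>UNIV. A $ ?R a $ p (?R a)) = (\<Prod>i\<in>UNIV. A $ i $ p i)"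
      using prod.reindex_bij_betw[OF bij_to_base, of "\<lambda>i. A $ i $ p i"] by simp
    ultimately show "of_int (sign (?A \<circ> p \<circ> ?R)) *
        (\<Prod>a\<in>UNIV. A $ ?R a $ ?R ((?A \<circ> p \<circ> ?R) a)) = of_int (sign p) * (\<Prod>i\<in>UNIV. A $ i $ p i)"
      by (simp add: of_base_inverse)
  next
    fix q :: "'n ordered_copy \<Rightarrow> 'n ordered_copy" assume q: "q \<in> {q. q permutes UNIV}"
    show "?A \<circ> ?conj q \<circ> ?R = q"
      by (simp add: conj fun_eq_iff to_base_inverse)
    show "?conj q \<in> {p. p permutes UNIV}"
      using map_permutation_permutes[OF bij_to_base, of q] q by simp
  qed
  finally show ?thesis by (simp add: det_def)
qed

text \<open>An equation between extended integrals packs two facts: whether each side is finite, and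
  which value it has.  Both follow from the equivalence for every finite value \<open>r\<close>.\<close>

lemma emeasure_differentiable_image_wellorder:
  fixes T :: "real^'m::{finite,wellorder} \<Rightarrow> real^'m::_"
  assumes S: "S \<in> sets borel" "T ` S \<in> sets borel"
    and T: "\<And>x. x \<in> S \<Longrightarrow> (T has_derivative T' x) (at x)" "inj_on T S"
    and meas: "(\<lambda>x. indicator S x * \<bar>det (matrix (T' x))\<bar>) \<in> borel_measurable borel"
  shows "emeasure lborel (T ` S) = (\<integral>\<^sup>+x\<in>S. \<bar>det (matrix (T' x))\<bar> \<partial>lborel)"
proof -
  let ?h = "\<lambda>x. indicator S x * \<bar>det (matrix (T' x))\<bar>"
  have nn: "(\<integral>\<^sup>+x\<in>S. \<bar>det (matrix (T' x))\<bar> \<partial>lborel) = (\<integral>\<^sup>+x. ?h x \<partial>lborel)"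
    by (intro nn_integral_cong) (auto split: split_indicator)
  have iff: "emeasure lborel (T ` S) = ennreal r \<longleftrightarrow> (\<integral>\<^sup>+x. ?h x \<partial>lborel) = ennreal r"
    if r: "r \<ge> 0" for r
  proof -
    have "(\<integral>\<^sup>+x. ?h x \<partial>lborel) = ennreal r \<longleftrightarrow> (?h has_integral r) UNIV"
      using nn_integral_has_integral_lborel[OF meas, of r] nn_integral_has_integral[OF meas _ _ r]
      by auto
    also have "\<dots> \<longleftrightarrow> ((\<lambda>x. \<bar>det (matrix (T' x))\<bar>) has_integral r) S"
    proof -
      have "?h = (\<lambda>x. if x \<in> S then \<bar>det (matrix (T' x))\<bar> else 0)"
        by auto
      then show ?thesis by (simp only: has_integral_restrict_UNIV)
    qed
    also have "\<dots> \<longleftrightarrow> T ` S \<in> lmeasurable \<and> measure lebesgue (T ` S) = r"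
      using has_measure_differentiable_image[where S = S and f = T and f' = T' and m = r] S(1) T
      by (auto intro: has_derivative_at_withinI)
    also have "\<dots> \<longleftrightarrow> emeasure lborel (T ` S) = ennreal r"
    proof -
      have [simp]: "emeasure lebesgue (T ` S) = emeasure lborel (T ` S)"
        using S(2) by (simp add: emeasure_completion)
      have sets: "T ` S \<in> sets lebesgue" using S(2) by simp
      show ?thesis
      proof
        assume *: "T ` S \<in> lmeasurable \<and> measure lebesgue (T ` S) = r"
        then show "emeasure lborel (T ` S) = ennreal r"
          using emeasure_eq_measure2[of "T ` S" lebesgue] by simp
      next
        assume *: "emeasure lborel (T ` S) = ennreal r"
        then show "T ` S \<in> lmeasurable \<and> measure lebesgue (T ` S) = r"
          using sets r by (simp add: fmeasurable_def measure_def)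
      qed
    qed
    finally show ?thesis by blast
  qed
  show ?thesis
  proof (cases "emeasure lborel (T ` S)")
    case (real r)
    then show ?thesis using iff[OF real(1)] nn by simp
  next
    case top
    show ?thesis
    proof (cases "\<integral>\<^sup>+x. ?h x \<partial>lborel")
      case (real r)
      then show ?thesis using iff[OF real(1)] nn by simp
    next
      case top
      then show ?thesis using \<open>emeasure lborel (T ` S) = top\<close> nn by simp
    qed
  qed
qed

text \<open>The map \<open>T\<close> is conjugated with the renaming of coordinates.\<close>

theorem emeasure_differentiable_image:
  fixes T :: "real^'n::finite \<Rightarrow> real^'n::_"
  assumes S: "S \<in> sets borel" "T ` S \<in> sets borel"
    and T: "\<And>x. x \<in> S \<Longrightarrow> (T has_derivative T' x) (at x)" "inj_on T S"
    and meas: "(\<lambda>x. indicator S x * \<bar>det (matrix (T' x))\<bar>) \<in> borel_measurable borel"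
  shows "emeasure lborel (T ` S) = (\<integral>\<^sup>+x\<in>S. \<bar>det (matrix (T' x))\<bar> \<partial>lborel)"
proof -
  let ?R = "rename_coords :: real^'n \<Rightarrow> _" and ?B = "rename_back :: _ \<Rightarrow> real^'n"
  let ?T = "\<lambda>z. ?R (T (?B z))" and ?T' = "\<lambda>z v. ?R (T' (?B z) (?B v))"
  have image: "?R ` X = ?B -` X" for X
    by (force simp: image_iff)
  have vimage: "?R -` (?B -` X) = X" for X by auto
  have emeasure_R: "emeasure lborel (?R ` X) = emeasure lborel X" if "X \<in> sets borel" for X
  proof -
    have "?B -` X \<in> sets borel"
      using measurable_sets[OF measurable_rename(2) that] by simp
    then have "emeasure (distr lborel borel ?R) (?B -` X) = emeasure lborel X"
      using vimage[of X] by (subst emeasure_distr) auto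
    then show ?thesis by (simp add: image distr_lborel_rename)
  qed
  have borel_R: "?R ` X \<in> sets borel" if "X \<in> sets borel" for X
    using measurable_sets[OF measurable_rename(2) that] by (simp add: image)
  have det: "det (matrix (?T' z)) = det (matrix (T' (?B z)))" if z: "z \<in> ?R ` S" for z
  proof -
    have back_axis: "?B (axis b 1) = axis (to_base b) 1" for b
      by (auto simp: rename_back_def vec_eq_iff axis_def of_base_inverse
          to_base_inverse)
    have "matrix (?T' z) = (\<chi> a b. matrix (T' (?B z)) $ to_base a $ to_base b)"
      by (simp add: matrix_def vec_eq_iff back_axis rename_coords_def)
    then show ?thesis by (simp add: det_rename)
  qed
  have ind: "indicator (?R ` S) z = (indicator S (?B z) :: real)" for z
    by (auto simp: image split: split_indicator)
  have "emeasure lborel (T ` S) = emeasure lborel (?R ` (T ` S))"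
    using emeasure_R[OF S(2)] by simp
  also have "?R ` (T ` S) = ?T ` (?R ` S)"
    by (simp add: image_image)
  also have "emeasure lborel \<dots> = (\<integral>\<^sup>+z\<in>?R ` S. \<bar>det (matrix (?T' z))\<bar> \<partial>lborel)"
  proof (rule emeasure_differentiable_image_wellorder)
    show "?R ` S \<in> sets borel" using borel_R[OF S(1)] .
    show "?T ` ?R ` S \<in> sets borel" using borel_R[OF S(2)] by (simp add: image_image)
    show "(?T has_derivative ?T' z) (at z)" if "z \<in> ?R ` S" for z
    proof -
      have TB: "(T has_derivative T' (?B z)) (at (?B z))" using T(1) that by auto
      have B: "(?B has_derivative ?B) (at z)"
        by (rule bounded_linear_imp_has_derivative[OF bounded_linear_rename(2)])
      have "((\<lambda>z. T (?B z)) has_derivative (\<lambda>v. T' (?B z) (?B v))) (at z)"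
        using diff_chain_at[OF B TB] by (simp add: o_def)
      then show ?thesis
        by (rule bounded_linear.has_derivative[OF bounded_linear_rename(1)])
    qed
    show "inj_on ?T (?R ` S)"
      using T(2) bij_rename(1) by (auto simp: inj_on_def bij_def)
    have "(\<lambda>z. indicator S (?B z) * \<bar>det (matrix (T' (?B z)))\<bar>) \<in> borel_measurable borel"
      using measurable_compose[OF measurable_rename(2) meas] .
    moreover have "indicator (?R ` S) z * \<bar>det (matrix (?T' z))\<bar> =
        indicator S (?B z) * \<bar>det (matrix (T' (?B z)))\<bar>" for z
      using det[of z] ind[of z] by (cases "z \<in> ?R ` S") (auto split: split_indicator)
    ultimately show "(\<lambda>z. indicator (?R ` S) z * \<bar>det (matrix (?T' z))\<bar>) \<in> borel_measurable borel"
      by simp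
  qed
  also have "\<dots> = (\<integral>\<^sup>+z. ennreal (indicator S (?B z) * \<bar>det (matrix (T' (?B z)))\<bar>)
      \<partial>distr lborel borel ?R)"
    unfolding distr_lborel_rename using det
    by (intro nn_integral_cong) (auto simp: image split: split_indicator)
  also have "\<dots> = (\<integral>\<^sup>+x. ennreal (indicator S x * \<bar>det (matrix (T' x))\<bar>) \<partial>lborel)"
    using measurable_compose[OF measurable_rename(2) meas]
    by (subst nn_integral_distr) auto
  also have "\<dots> = (\<integral>\<^sup>+x\<in>S. \<bar>det (matrix (T' x))\<bar> \<partial>lborel)"
    by (intro nn_integral_cong) (auto split: split_indicator)
  finally show ?thesis .
qed

text \<open>The transformation formula for nonnegative integrands follows from the one for measures of
  images, since both sides are integrals against the same image measure.\<close>

theorem nn_integral_change_of_variables: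
  fixes T :: "real^'n::finite \<Rightarrow> real^'n::_"
  assumes S: "S \<in> sets borel" "T ` S \<in> sets borel"
    and T: "\<And>x. x \<in> S \<Longrightarrow> (T has_derivative T' x) (at x)" "inj_on T S"
    and T_meas: "T \<in> borel_measurable (restrict_space borel S)"
    and det_meas: "(\<lambda>x. \<bar>det (matrix (T' x))\<bar>) \<in> borel_measurable (restrict_space borel S)"
    and f: "f \<in> borel_measurable (restrict_space borel (T ` S))"
  shows "(\<integral>\<^sup>+y\<in>T ` S. f y \<partial>lborel) = (\<integral>\<^sup>+x\<in>S. ennreal \<bar>det (matrix (T' x))\<bar> * f (T x) \<partial>lborel)"
proof -
  let ?J = "\<lambda>x. ennreal \<bar>det (matrix (T' x))\<bar>"
  let ?\<mu> = "density (restrict_space lborel S) ?J" and ?L = "restrict_space lborel (T ` S)"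
  have sets_eq: "sets (restrict_space lborel X) = sets (restrict_space borel X)" for X :: "(real^'n) set"
    by (rule sets_restrict_space_cong) simp
  have J_meas: "?J \<in> borel_measurable (restrict_space lborel S)"
    using det_meas by (simp add: measurable_cong_sets[OF sets_eq])
  have T_meas': "T \<in> measurable ?\<mu> ?L"
  proof -
    have "T \<in> measurable (restrict_space borel S) (restrict_space borel (T ` S))"
      using T_meas by (intro measurable_restrict_space2) (auto simp: space_restrict_space)
    then show ?thesis
      by (simp add: measurable_cong_sets[OF sets_eq sets_eq])
  qed
  have distr: "distr ?\<mu> ?L T = ?L"
  proof (rule measure_eqI)
    fix X assume "X \<in> sets (distr ?\<mu> ?L T)"
    then have X: "X \<subseteq> T ` S" "X \<in> sets borel"
      using S(2) by (auto simp: sets_restrict_space_iff)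
    define Z where "Z = T -` X \<inter> S"
    have Z: "Z \<in> sets borel" "Z \<subseteq> S" "T ` Z = X"
      using measurable_sets[OF T_meas X(2)] S(1) X(1)
      by (auto simp: Z_def space_restrict_space sets_restrict_space_iff)
    have "emeasure (distr ?\<mu> ?L T) X = emeasure ?\<mu> Z"
      using X T_meas' S(2)
      by (subst emeasure_distr) (auto simp: Z_def sets_restrict_space_iff space_restrict_space)
    also have "\<dots> = (\<integral>\<^sup>+x. ?J x * indicator Z x \<partial>restrict_space lborel S)"
      using Z S(1) J_meas by (subst emeasure_density) (auto simp: sets_restrict_space_iff)
    also have "\<dots> = (\<integral>\<^sup>+x\<in>Z. ?J x \<partial>lborel)"
      using S(1) Z(2) by (subst nn_integral_restrict_space)
        (auto intro!: nn_integral_cong split: split_indicator)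
    also have "\<dots> = emeasure lborel X"
    proof -
      have "(\<lambda>x. indicator Z x * \<bar>det (matrix (T' x))\<bar>) \<in> borel_measurable borel"
      proof -
        have "(\<lambda>x. indicator S x * \<bar>det (matrix (T' x))\<bar>) \<in> borel_measurable borel"
          using det_meas S(1) by (simp add: borel_measurable_restrict_space_iff)
        then have "(\<lambda>x. indicator Z x * (indicator S x * \<bar>det (matrix (T' x))\<bar>)) \<in> borel_measurable borel"
          using Z(1) by measurable
        moreover have "indicator Z x * (indicator S x * \<bar>det (matrix (T' x))\<bar>) =
            indicator Z x * \<bar>det (matrix (T' x))\<bar>" for x
          using Z(2) by (auto split: split_indicator)
        ultimately show ?thesis by simp
      qed
      then show ?thesis
        using emeasure_differentiable_image[where S = Z and T = T and T' = T'] Z X(2) T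
        by (metis inj_on_subset subset_iff)
    qed
    also have "\<dots> = emeasure ?L X"
      using X S(2) by (simp add: emeasure_restrict_space)
    finally show "emeasure (distr ?\<mu> ?L T) X = emeasure ?L X" .
  qed simp
  have "(\<integral>\<^sup>+y\<in>T ` S. f y \<partial>lborel) = (\<integral>\<^sup>+y. f y \<partial>?L)"
    using S(2) by (simp add: nn_integral_restrict_space)
  also have "\<dots> = (\<integral>\<^sup>+y. f y \<partial>distr ?\<mu> ?L T)" by (simp add: distr)
  also have "\<dots> = (\<integral>\<^sup>+x. f (T x) \<partial>?\<mu>)"
    using f by (intro nn_integral_distr T_meas') (simp add: measurable_cong_sets[OF sets_eq])
  also have "\<dots> = (\<integral>\<^sup>+x. ?J x * f (T x) \<partial>restrict_space lborel S)"
  proof (rule nn_integral_density[OF J_meas])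
    show "(\<lambda>x. f (T x)) \<in> borel_measurable (restrict_space lborel S)"
      using measurable_compose[OF T_meas', of f borel] f
      by (simp add: measurable_cong_sets[OF sets_eq])
  qed
  also have "\<dots> = (\<integral>\<^sup>+x\<in>S. ?J x * f (T x) \<partial>lborel)"
    using S(1) by (simp add: nn_integral_restrict_space)
  finally show ?thesis .
qed


section \<open>Positive definite matrices\<close>

definition pos_def :: "real^'n::finite^'n \<Rightarrow> bool" where
  "pos_def G \<longleftrightarrow> transpose G = G \<and> (\<forall>v. v \<noteq> 0 \<longrightarrow> v \<bullet> (G *v v) > 0)"

lemma pos_def_sym: "pos_def G \<Longrightarrow> v \<bullet> (G *v w) = w \<bullet> (G *v v)"
  by (metis dot_lmul_matrix inner_commute pos_def_def transpose_matrix_vector)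

lemma pos_def_nonneg: "pos_def G \<Longrightarrow> v \<bullet> (G *v v) \<ge> 0"
  by (cases "v = 0") (auto simp: pos_def_def less_imp_le)

lemma pos_def_eq_0: "pos_def G \<Longrightarrow> v \<bullet> (G *v v) = 0 \<longleftrightarrow> v = 0"
  by (cases "v = 0") (auto simp: pos_def_def)

lemma pos_def_det_nz:
  assumes "pos_def G"
  shows "det G \<noteq> 0"
proof -
  have "v = 0" if "G *v v = 0" for v
    using pos_def_eq_0[OF assms, of v] that by simp
  then show ?thesis
    using matrix_left_invertible_ker[of G] invertible_det_nz[of G] invertible_left_inverse[of G]
    by blast
qed

text \<open>Along the segment from the identity to \<open>G\<close> the matrices remain positive definite, so the
  determinant cannot change sign.\<close>

lemma pos_def_det_pos:
  fixes G :: "real^'n::finite^'n"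
  assumes "pos_def G"
  shows "det G > 0"
proof (rule ccontr)
  assume "\<not> det G > 0"
  define P :: "real \<Rightarrow> real^'n^'n" where "P t = (1 - t) *\<^sub>R mat 1 + t *\<^sub>R G" for t
  have mult: "P t *v v = (1 - t) *\<^sub>R v + t *\<^sub>R (G *v v)" for t v
    by (simp add: P_def matrix_vector_mult_add_rdistrib flip: scaleR_matrix_vector_assoc)
  have P: "pos_def (P t)" if t: "0 \<le> t" "t \<le> 1" for t
    unfolding pos_def_def
  proof (intro conjI allI impI)
    show "transpose (P t) = P t"
      using assms by (simp add: P_def pos_def_def transpose_def vec_eq_iff mat_def)
    fix v :: "real^'n" assume v: "v \<noteq> 0"
    have "v \<bullet> (P t *v v) = (1 - t) * (v \<bullet> v) + t * (v \<bullet> (G *v v))"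
      by (simp add: mult inner_add_right)
    moreover have "v \<bullet> (G *v v) > 0" "v \<bullet> v > 0" using assms v by (auto simp: pos_def_def)
    ultimately show "v \<bullet> (P t *v v) > 0"
      using t by (cases "t = 0") (auto intro: add_nonneg_pos)
  qed
  have "continuous_on {0..1} (\<lambda>t. det (P t))"
    unfolding det_def P_def by (auto intro!: continuous_intros)
  then have "\<exists>t\<ge>0. t \<le> 1 \<and> det (P t) = 0"
    using \<open>\<not> det G > 0\<close> by (intro IVT2') (auto simp: P_def)
  then show False
    using pos_def_det_nz P by blast
qed

lemma pos_def_inverse:
  assumes "pos_def G"
  shows "G *v (matrix_inv G *v w) = w"
proof -
  have "invertible G" using pos_def_det_nz[OF assms] by (simp add: invertible_det_nz)
  then have "G ** matrix_inv G = mat 1"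
    unfolding invertible_def matrix_inv_def by (rule someI2_ex) simp
  then show ?thesis by (simp add: matrix_vector_mul_assoc)
qed

lemma pos_def_inj: "pos_def G \<Longrightarrow> G *v v = G *v w \<Longrightarrow> v = w"
  using pos_def_eq_0[of G "v - w"] by (simp add: matrix_vector_mult_diff_distrib)

lemma pos_def_Cauchy_Schwarz:
  assumes G: "pos_def G"
  shows "(v \<bullet> (G *v w))\<^sup>2 \<le> (v \<bullet> (G *v v)) * (w \<bullet> (G *v w))"
proof (cases "w = 0")
  case False
  then have pos: "w \<bullet> (G *v w) > 0" using G by (simp add: pos_def_def)
  \<comment> \<open>The value of \<open>t\<close> that minimises the quadratic form at \<open>v - t w\<close>.\<close>
  define t where "t = v \<bullet> (G *v w) / (w \<bullet> (G *v w))"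
  have t: "t * (w \<bullet> (G *v w)) = v \<bullet> (G *v w)" using pos by (simp add: t_def)
  have "0 \<le> (v - t *\<^sub>R w) \<bullet> (G *v (v - t *\<^sub>R w))" by (rule pos_def_nonneg[OF G])
  also have "\<dots> = v \<bullet> (G *v v) - 2 * t * (v \<bullet> (G *v w)) + t * (t * (w \<bullet> (G *v w)))"
    using pos_def_sym[OF G, of w v]
    by (simp add: matrix_vector_mult_diff_distrib inner_diff_left inner_diff_right
        matrix_vector_mult_scaleR algebra_simps)
  also have "\<dots> = v \<bullet> (G *v v) - t * (v \<bullet> (G *v w))" unfolding t by simp
  finally have "t * (v \<bullet> (G *v w)) \<le> v \<bullet> (G *v v)" by simp
  then have "t * (v \<bullet> (G *v w)) * (w \<bullet> (G *v w)) \<le> (v \<bullet> (G *v v)) * (w \<bullet> (G *v w))"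
    using pos by (intro mult_right_mono) auto
  moreover have "t * (v \<bullet> (G *v w)) * (w \<bullet> (G *v w)) = (v \<bullet> (G *v w))\<^sup>2"
    using t by (metis mult.assoc mult.commute power2_eq_square)
  ultimately show ?thesis by simp
qed simp

lemma pos_def_triangle:
  assumes G: "pos_def G"
  shows "sqrt ((v - w) \<bullet> (G *v (v - w))) \<le> sqrt (v \<bullet> (G *v v)) + sqrt (w \<bullet> (G *v w))"
proof (rule real_le_lsqrt)
  let ?a = "sqrt (v \<bullet> (G *v v))" and ?b = "sqrt (w \<bullet> (G *v w))"
  have sq: "?a\<^sup>2 = v \<bullet> (G *v v)" "?b\<^sup>2 = w \<bullet> (G *v w)" using pos_def_nonneg[OF G] by simp_all
  have "(v \<bullet> (G *v w))\<^sup>2 \<le> (?a * ?b)\<^sup>2"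
    using pos_def_Cauchy_Schwarz[OF G, of v w] by (simp only: power_mult_distrib sq)
  then have "\<bar>v \<bullet> (G *v w)\<bar> \<le> ?a * ?b"
    using pos_def_nonneg[OF G] by (simp add: abs_le_square_iff[symmetric])
  then have "- (v \<bullet> (G *v w)) \<le> ?a * ?b" by linarith
  moreover have "(v - w) \<bullet> (G *v (v - w)) = ?a\<^sup>2 - 2 * (v \<bullet> (G *v w)) + ?b\<^sup>2"
    unfolding sq using pos_def_sym[OF G, of w v]
    by (simp add: matrix_vector_mult_diff_distrib inner_diff_left inner_diff_right)
  ultimately show "(v - w) \<bullet> (G *v (v - w)) \<le> (?a + ?b)\<^sup>2"
    by (simp add: power2_sum)
qed (use pos_def_nonneg[OF G] in simp_all)

lemma pos_def_inverse_cramer: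
  fixes G :: "real^'n::finite^'n"
  assumes "pos_def G"
  shows "(matrix_inv G *v w) $ k = det (\<chi> i j. if j = k then w $ i else G $ i $ j) / det G"
proof -
  have "matrix_inv G *v w = (\<chi> k. det (\<chi> i j. if j = k then w $ i else G $ i $ j) / det G)"
    using cramer[OF pos_def_det_nz[OF assms]] pos_def_inverse[OF assms] by blast
  then show ?thesis by simp
qed

text \<open>Cramer's rule exhibits the solution of a linear system as a quotient of polynomials in the
  coefficients, hence as smooth as these are.\<close>

lemma Ck_on_matrix_inv_mult:
  fixes G :: "'b::euclidean_space \<Rightarrow> real^'n::finite^'n"
  assumes S: "open S" and G: "\<And>i j. Ck_on k S (\<lambda>x. G x $ i $ j)" "\<And>x. x \<in> S \<Longrightarrow> pos_def (G x)"
    and w: "\<And>i. Ck_on k S (\<lambda>x. w x $ i)"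
  shows "Ck_on k S (\<lambda>x. (matrix_inv (G x) *v w x) $ l)"
proof (rule Ck_on_cong[OF S])
  have "Ck_on k S (\<lambda>x. (\<chi> i j. if j = l then w x $ i else G x $ i $ j) $ i $ j)" for i j
    using G(1)[of i j] w[of i] by (cases "j = l") auto
  then show "Ck_on k S (\<lambda>x. det (\<chi> i j. if j = l then w x $ i else G x $ i $ j) / det (G x))"
    using G by (intro Ck_on_divide Ck_on_det S pos_def_det_pos) auto
qed (simp add: pos_def_inverse_cramer[OF G(2)])

section \<open>Integrals of derivatives of compactly supported functions\<close>

lemma continuous_compact_support_bounded:
  fixes f :: "'b::topological_space \<Rightarrow> real"
  assumes "continuous_on K f" "compact K" "\<And>y. y \<notin> K \<Longrightarrow> f y = 0"
  obtains C where "C \<ge> 0" "\<And>y. \<bar>f y\<bar> \<le> C"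
proof -
  have "bounded (f ` K)"
    using assms by (intro compact_imp_bounded compact_continuous_image)
  then obtain C where C: "\<And>y. y \<in> K \<Longrightarrow> \<bar>f y\<bar> \<le> C"
    by (auto simp: bounded_iff)
  show ?thesis
  proof (rule that[of "max C 0"])
    show "\<bar>f y\<bar> \<le> max C 0" for y
      using C[of y] assms(3)[of y] by (cases "y \<in> K") auto
  qed simp
qed

lemma set_integrable_compact_support:
  fixes f :: "'b::euclidean_space \<Rightarrow> real"
  assumes "continuous_on U f" "compact K" "K \<subseteq> U" and f0: "\<And>y. y \<in> U \<Longrightarrow> y \<notin> K \<Longrightarrow> f y = 0"
  shows "set_integrable lborel U f"
proof -
  have "integrable lborel (\<lambda>y. indicator K y *\<^sub>R f y)"
    by (rule borel_integrable_compact[OF assms(2) continuous_on_subset[OF assms(1,3)]])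
  also have "(\<lambda>y. indicator K y *\<^sub>R f y) = (\<lambda>y. indicator U y *\<^sub>R f y)"
  proof
    fix y
    show "indicator K y *\<^sub>R f y = indicator U y *\<^sub>R f y"
      using assms(3) f0[of y] by (cases "y \<in> K"; cases "y \<in> U") auto
  qed
  finally show ?thesis by (simp add: set_integrable_def)
qed

lemma frechet_derivative_eq_0:
  assumes "open U" "y \<in> U" "\<And>z. z \<in> U \<Longrightarrow> F z = c"
  shows "frechet_derivative F (at y) = (\<lambda>v. 0)"
proof -
  have "(F has_derivative (\<lambda>v. 0)) (at y)"
    by (rule has_derivative_transform_within_open[of "\<lambda>_. c" _ _ _ U])
      (use assms in auto)
  then show ?thesis by (rule frechet_derivative_at[symmetric])
qed

text \<open>By translation invariance of Lebesgue measure the difference quotients in direction \<open>v\<close>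
  have integral zero; they converge dominatedly to the directional derivative.\<close>

lemma integral_derivative_eq_0:
  fixes F :: "'b::euclidean_space \<Rightarrow> real"
  assumes F: "Ck_on (Suc 0) UNIV F" and K: "compact K" "\<And>y. y \<notin> K \<Longrightarrow> F y = 0"
  shows "integrable lborel (\<lambda>y. frechet_derivative F (at y) v)" (is ?int)
    and "(LINT y|lborel. frechet_derivative F (at y) v) = 0" (is ?zero)
proof -
  define D where "D y = frechet_derivative F (at y) v" for y
  have der: "(F has_derivative frechet_derivative F (at y)) (at y)" for y
    using Ck_on_SucD(1)[OF F] by simp
  have cont_D: "continuous_on UNIV D"
    using Ck_on_SucD(2)[OF F, of v] by (simp add: D_def[abs_def])
  have cont_F: "continuous_on UNIV F" by (rule Ck_on_continuous[OF F])
  have D0: "D y = 0" if "y \<notin> K" for y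
    using frechet_derivative_eq_0[of "- K" y F 0] that K by (auto simp: D_def compact_imp_closed open_Compl)
  obtain C where C: "C \<ge> 0" "\<And>y. \<bar>D y\<bar> \<le> C"
    using continuous_compact_support_bounded[of K D] continuous_on_subset[OF cont_D] K(1) D0 by blast
  have integrable_support: "integrable lborel f"
    if "continuous_on UNIV f" "\<And>y. y \<notin> K \<Longrightarrow> f y = 0" for f :: "'b \<Rightarrow> real"
  proof -
    have "integrable lborel (\<lambda>y. indicator K y *\<^sub>R f y)"
      using that(1) by (intro borel_integrable_compact K(1)) (auto intro: continuous_on_subset)
    also have "(\<lambda>y. indicator K y *\<^sub>R f y) = f"
      using that(2) by (auto split: split_indicator)
    finally show ?thesis .
  qed
  show ?int
    using integrable_support[OF cont_D D0] by (simp add: D_def[abs_def])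
  obtain B where B: "K \<subseteq> cball 0 B"
  proof -
    obtain B where "\<forall>y\<in>K. norm y \<le> B" using compact_imp_bounded[OF K(1)] by (auto simp: bounded_iff)
    then show ?thesis by (intro that[of B]) auto
  qed
  define Q where "Q n y = real (Suc n) * (F (y + (1 / real (Suc n)) *\<^sub>R v) - F y)" for n y
  have line: "((\<lambda>t. F (y + t *\<^sub>R v)) has_real_derivative D (y + t *\<^sub>R v)) (at t)" for y t
  proof -
    have "((\<lambda>t. y + t *\<^sub>R v) has_derivative (\<lambda>h. h *\<^sub>R v)) (at t)"
      by (auto intro!: derivative_eq_intros)
    from diff_chain_at[OF this der]
    have "((\<lambda>t. F (y + t *\<^sub>R v)) has_derivative
        (\<lambda>h. frechet_derivative F (at (y + t *\<^sub>R v)) (h *\<^sub>R v))) (at t)"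
      by (simp add: o_def)
    moreover have "frechet_derivative F (at z) (h *\<^sub>R v) = D z * h" for z h
      using linear_cmul[OF has_derivative_linear[OF der[of z]], of h v] by (simp add: D_def)
    ultimately show ?thesis
      by (simp add: has_field_derivative_def)
  qed
  have "(\<lambda>n. integral\<^sup>L lborel (Q n)) \<longlonglongrightarrow> integral\<^sup>L lborel D"
  proof (rule integral_dominated_convergence)
    show "integrable lborel (\<lambda>y::'b. C * indicator (cball 0 (B + norm v)) y)"
      by (intro integrable_mult_right integrable_real_indicator)
        (use emeasure_bounded_finite[of "cball (0::'b) (B + norm v)"] in auto)
    show "D \<in> borel_measurable lborel"
      using cont_D by (simp add: borel_measurable_continuous_onI)
    show "Q n \<in> borel_measurable lborel" for n
      unfolding Q_def[abs_def] measurable_lborel2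
      by (intro borel_measurable_continuous_onI continuous_intros continuous_on_compose2[OF cont_F]) auto
    have "(\<lambda>n. Q n y) \<longlonglongrightarrow> D y" for y
    proof -
      have "((\<lambda>h. (F (y + h *\<^sub>R v) - F y) / h) \<longlongrightarrow> D y) (at 0)"
        using line[of y 0] by (simp add: has_field_derivative_iff)
      moreover have "filterlim (\<lambda>n. 1 / real (Suc n)) (at 0) sequentially"
        unfolding filterlim_at using LIMSEQ_inverse_real_of_nat
        by (simp add: inverse_eq_divide)
      ultimately have "(\<lambda>n. (F (y + (1 / real (Suc n)) *\<^sub>R v) - F y) / (1 / real (Suc n))) \<longlonglongrightarrow> D y"
        by (rule filterlim_compose)
      then show ?thesis by (simp add: Q_def mult.commute)
    qed
    then show "AE y in lborel. (\<lambda>n. Q n y) \<longlonglongrightarrow> D y" by simp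
    have "\<bar>Q n y\<bar> \<le> C * indicator (cball 0 (B + norm v)) y" for n y
    proof -
      let ?h = "1 / real (Suc n)"
      have "\<exists>z>0. z < ?h \<and> F (y + ?h *\<^sub>R v) - F (y + 0 *\<^sub>R v) = (?h - 0) * D (y + z *\<^sub>R v)"
        using line by (intro MVT2) auto
      then obtain z where "F (y + ?h *\<^sub>R v) - F y = ?h * D (y + z *\<^sub>R v)" by auto
      then have Q: "\<bar>Q n y\<bar> \<le> C" using C(2) by (simp add: Q_def)
      show ?thesis
      proof (cases "y \<in> cball 0 (B + norm v)")
        case True
        then show ?thesis using Q by simp
      next
        case False
        have "norm (y + ?h *\<^sub>R v) \<ge> norm y - norm (?h *\<^sub>R v)"
          using norm_diff_ineq by blast
        moreover have "norm (?h *\<^sub>R v) \<le> norm v"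
          using mult_left_mono[of 1 "1 + real n" "norm v"] by (simp add: divide_le_eq)
        moreover have "norm y > B + norm v" using False by simp
        ultimately have "norm (y + ?h *\<^sub>R v) > B" "norm y > B"
          using norm_ge_zero[of v] by linarith+
        then have "y + ?h *\<^sub>R v \<notin> cball 0 B" "y \<notin> cball 0 B" by simp_all
        then have "F (y + ?h *\<^sub>R v) = 0" "F y = 0" using K(2) B by blast+
        then have "Q n y = 0" by (simp add: Q_def)
        then show ?thesis using C(1) by simp
      qed
    qed
    then show "AE y in lborel. norm (Q n y) \<le> C * indicator (cball 0 (B + norm v)) y" for n
      by simp
  qed
  moreover have "integral\<^sup>L lborel (Q n) = 0" for n
  proof -
    let ?w = "(1 / real (Suc n)) *\<^sub>R v"
    have int: "integrable lborel F" using integrable_support[OF cont_F K(2)] .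
    have eq: "integral\<^sup>L lborel F = (LINT y|lborel. F (?w + y))"
    proof -
      have "integral\<^sup>L (distr lborel borel ((+) ?w)) F = (LINT y|lborel. F (?w + y))"
        using cont_F by (intro integral_distr) (auto intro!: borel_measurable_continuous_onI)
      then show ?thesis by (simp add: lborel_distr_plus)
    qed
    have int': "integrable lborel (\<lambda>y. F (?w + y))"
    proof -
      have "integrable (distr lborel borel ((+) ?w)) F" using int by (simp add: lborel_distr_plus)
      then show ?thesis by (rule integrable_distr[rotated]) simp
    qed
    show ?thesis
      using int int' eq by (simp add: Q_def[abs_def] add.commute)
  qed
  ultimately show ?zero
    by (simp add: LIMSEQ_const_iff D_def[abs_def])
qed

lemma set_integral_derivative_eq_0:
  fixes F :: "'b::euclidean_space \<Rightarrow> real"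
  assumes U: "open U" and F: "Ck_on (Suc 0) U F" and K: "compact K" "K \<subseteq> U"
    and F0: "\<And>y. y \<in> U \<Longrightarrow> y \<notin> K \<Longrightarrow> F y = 0"
  shows "set_integrable lborel U (\<lambda>y. frechet_derivative F (at y) v)"
    and "(LINT y:U|lborel. frechet_derivative F (at y) v) = 0"
proof -
  \<comment> \<open>Extension by zero remains \<open>C\<^sup>1\<close>, since \<open>U\<close> and the complement of \<open>K\<close> are an open cover.\<close>
  define E where "E y = (if y \<in> U then F y else 0)" for y
  have E: "Ck_on (Suc 0) UNIV E"
  proof (rule Ck_on_locally)
    fix y
    show "\<exists>T. open T \<and> y \<in> T \<and> Ck_on (Suc 0) T E"
    proof (cases "y \<in> U")
      case True
      have "Ck_on (Suc 0) U E" by (rule Ck_on_cong[OF U _ F]) (simp add: E_def)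
      then show ?thesis using U True by blast
    next
      case False
      have op: "open (- K)" using K(1) by (simp add: compact_imp_closed open_Compl)
      have "Ck_on (Suc 0) (- K) E"
        by (rule Ck_on_cong[OF op _ Ck_on_const[of _ _ 0]]) (auto simp: E_def F0)
      then show ?thesis using op False K(2) by blast
    qed
  qed
  have E0: "E y = 0" if "y \<notin> K" for y using F0 that by (simp add: E_def)
  have DE: "frechet_derivative F (at y) = frechet_derivative E (at y)" if "y \<in> U" for y
    using Ck_on_SucD(1)[OF F that] U that
    by (intro frechet_derivative_transform_within_open[of _ _ U]) (auto simp: E_def differentiable_def)
  have DE0: "frechet_derivative E (at y) v = 0" if "y \<notin> U" for y
  proof -
    have "y \<in> - K" using that K(2) by auto
    then show ?thesis
      using frechet_derivative_eq_0[of "- K" y E 0] K(1) E0 by (auto simp: compact_imp_closed open_Compl)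
  qed
  have eq: "(\<lambda>y. indicator U y *\<^sub>R frechet_derivative F (at y) v) = (\<lambda>y. frechet_derivative E (at y) v)"
    using DE DE0 by (auto split: split_indicator)
  show "set_integrable lborel U (\<lambda>y. frechet_derivative F (at y) v)"
    unfolding set_integrable_def eq by (rule integral_derivative_eq_0(1)[OF E K(1) E0])
  show "(LINT y:U|lborel. frechet_derivative F (at y) v) = 0"
    unfolding set_lebesgue_integral_def eq by (rule integral_derivative_eq_0(2)[OF E K(1) E0])
qed


section \<open>Degenerate powers\<close>

lemma has_derivative_mult_zero:
  fixes k f :: "'b::real_normed_vector \<Rightarrow> real"
  assumes k: "isCont k y" "k y = 0" and f: "(f has_derivative f') (at y)" "f y = 0"
  shows "((\<lambda>z. k z * f z) has_derivative (\<lambda>v. 0)) (at y)"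
  unfolding has_derivative_at_alt
proof (intro conjI allI impI)
  fix e :: real assume e: "e > 0"
  have "bounded_linear f'" using f(1) by (rule has_derivative_bounded_linear)
  then obtain B where B: "B > 0" "\<And>v. norm (f' v) \<le> norm v * B"
    using bounded_linear.pos_bounded by blast
  obtain d1 where d1: "d1 > 0" "\<And>z. norm (z - y) < d1 \<Longrightarrow> norm (f z - f y - f' (z - y)) \<le> 1 * norm (z - y)"
    using f(1) unfolding has_derivative_at_alt by (metis zero_less_one)
  have "e / (1 + B) > 0" using e B(1) by simp
  then obtain d2 where d2: "d2 > 0" "\<And>z. dist z y < d2 \<Longrightarrow> dist (k z) (k y) < e / (1 + B)"
    using k(1) unfolding continuous_at_eps_delta by blast
  show "\<exists>d>0. \<forall>z. norm (z - y) < d \<longrightarrow> norm (k z * f z - k y * f y - 0) \<le> e * norm (z - y)"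
  proof (intro exI[of _ "min d1 d2"] conjI allI impI)
    fix z assume z: "norm (z - y) < min d1 d2"
    have "\<bar>f z\<bar> \<le> \<bar>f z - f y - f' (z - y)\<bar> + \<bar>f' (z - y)\<bar>" using f(2) by simp
    also have "\<dots> \<le> (1 + B) * norm (z - y)"
      using d1(2)[of z] B(2)[of "z - y"] z by (simp add: algebra_simps)
    finally have fz: "\<bar>f z\<bar> \<le> (1 + B) * norm (z - y)" .
    have kz: "\<bar>k z\<bar> \<le> e / (1 + B)" using d2(2)[of z] z k(2) by (simp add: dist_norm)
    have "\<bar>k z * f z\<bar> \<le> (e / (1 + B)) * ((1 + B) * norm (z - y))"
      unfolding abs_mult using fz kz e B(1) by (intro mult_mono) auto
    also have "\<dots> = e * norm (z - y)" using B(1) by simp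
    finally show "norm (k z * f z - k y * f y - 0) \<le> e * norm (z - y)" using k(2) by simp
  qed (use d1 d2 in auto)
qed simp

text \<open>Where \<open>q\<close> tends to zero, the singular term \<open>q\<^sup>s\<^sup>-\<^sup>1 \<cdot> Dq \<cdot> f\<close> of the derivative of \<open>q\<^sup>s f\<close>
  is still \<open>O(q\<^sup>s)\<close>, because \<open>f\<close> and the factors of \<open>q\<close> are of size \<open>O(\<surd>q)\<close>.  This is
  applied with \<open>q = \<bar>\<nabla>u\<bar>\<^sup>2\<close> and \<open>f\<close> a component of the gradient.  The convention
  \<open>0 powr r = 0\<close> makes one formula for the derivative valid everywhere.\<close>

lemma Ck_on_powr_mult_degenerate:
  fixes a f :: "'n::finite \<Rightarrow> 'b::euclidean_space \<Rightarrow> real" and q C :: "'b \<Rightarrow> real"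
  assumes S: "open S" and s: "s > 0"
    and a: "\<And>j. Ck_on (Suc 0) S (a j)" and f: "\<And>j. Ck_on (Suc 0) S (f j)"
    and q: "\<And>y. q y = (\<Sum>j\<in>UNIV. a j y * f j y)" and q0: "\<And>y. y \<in> S \<Longrightarrow> q y \<ge> 0"
    and C: "continuous_on S C"
    and a_le: "\<And>y j. y \<in> S \<Longrightarrow> (a j y)\<^sup>2 \<le> C y * q y"
    and f_le: "\<And>y j. y \<in> S \<Longrightarrow> (f j y)\<^sup>2 \<le> C y * q y"
  shows "Ck_on (Suc 0) S (\<lambda>y. q y powr s * f i y)"
proof (rule Ck_on_SucI[OF S])
  define Da where "Da j y v = frechet_derivative (a j) (at y) v" for j y v
  define Df where "Df j y v = frechet_derivative (f j) (at y) v" for j y v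
  define Dq where "Dq y v = (\<Sum>j\<in>UNIV. a j y * Df j y v + Da j y v * f j y)" for y v
  have der_a: "(a j has_derivative Da j y) (at y)" if "y \<in> S" for j y
    using Ck_on_SucD(1)[OF a that] by (simp add: Da_def[abs_def])
  have der_f: "(f j has_derivative Df j y) (at y)" if "y \<in> S" for j y
    using Ck_on_SucD(1)[OF f that] by (simp add: Df_def[abs_def])
  have der_q: "(q has_derivative Dq y) (at y)" if "y \<in> S" for y
    unfolding q[abs_def] Dq_def[abs_def]
    by (intro has_derivative_sum has_derivative_mult der_a der_f that)
  have cont_a: "continuous_on S (a j)" and cont_f: "continuous_on S (f j)" for j
    using Ck_on_continuous a f by blast+
  have cont_Da: "continuous_on S (\<lambda>y. Da j y v)" and cont_Df: "continuous_on S (\<lambda>y. Df j y v)" for j v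
    using Ck_on_SucD(2)[OF a] Ck_on_SucD(2)[OF f] by (simp_all add: Da_def Df_def)
  have cont_q: "continuous_on S q"
    unfolding q[abs_def] by (intro continuous_intros cont_a cont_f)
  have cont_Dq: "continuous_on S (\<lambda>y. Dq y v)" for v
    unfolding Dq_def by (intro continuous_intros cont_a cont_f cont_Da cont_Df)
  have cont_qs: "continuous_on S (\<lambda>y. q y powr s)"
    using q0 s by (intro continuous_on_powr' cont_q continuous_on_const) auto
  show "((\<lambda>y. q y powr s * f i y) has_derivative
      (\<lambda>v. q y powr s * Df i y v + (s * q y powr (s - 1) * Dq y v) * f i y)) (at y)"
    if y: "y \<in> S" for y
  proof (cases "q y = 0")
    case True
    have "isCont (\<lambda>y. q y powr s) y"
      using cont_qs S y by (simp add: continuous_on_eq_continuous_at)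
    moreover have "f i y = 0" using f_le[OF y, of i] True by simp
    ultimately have "((\<lambda>y. q y powr s * f i y) has_derivative (\<lambda>v. 0)) (at y)"
      using True by (intro has_derivative_mult_zero[OF _ _ der_f[OF y]]) auto
    then show ?thesis using True by simp
  next
    case False
    then have "q y > 0" using q0[OF y] by simp
    then have "((\<lambda>t. t powr s) has_derivative (\<lambda>v. (s * q y powr (s - 1)) * v)) (at (q y))"
      using has_real_derivative_powr[of "q y" s] by (simp add: has_field_derivative_def)
    from diff_chain_at[OF der_q[OF y] this]
    have "((\<lambda>y. q y powr s) has_derivative (\<lambda>v. s * q y powr (s - 1) * Dq y v)) (at y)"
      by (simp add: o_def)
    from has_derivative_mult[OF this der_f[OF y]] show ?thesis by simp
  qed
  fix v
  have sing: "continuous_on S (\<lambda>y. (s * q y powr (s - 1) * Dq y v) * f i y)"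
  proof (intro continuous_at_imp_continuous_on ballI)
    fix y assume y: "y \<in> S"
    show "isCont (\<lambda>y. (s * q y powr (s - 1) * Dq y v) * f i y) y"
    proof (cases "q y = 0")
      case False
      have "isCont q y" "isCont (\<lambda>y. Dq y v) y" "isCont (f i) y"
        using cont_q cont_Dq cont_f S y by (simp_all add: continuous_on_eq_continuous_at)
      then show ?thesis using False by (intro continuous_intros) auto
    next
      case True
      define M where "M y = s * C y * (\<Sum>j\<in>UNIV. \<bar>Df j y v\<bar> + \<bar>Da j y v\<bar>) * q y powr s" for y
      have "continuous_on S M"
        unfolding M_def by (intro continuous_intros C cont_Da cont_Df cont_qs)
      then have "isCont M y" using S y by (simp add: continuous_on_eq_continuous_at)
      then have M: "(M \<longlongrightarrow> 0) (at y)" using True by (simp add: isCont_def M_def)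
      have bound: "\<bar>s * q z powr (s - 1) * Dq z v * f i z\<bar> \<le> M z" if z: "z \<in> S" for z
      proof -
        have sq: "\<bar>a j z\<bar> \<le> sqrt (C z * q z)" "\<bar>f j z\<bar> \<le> sqrt (C z * q z)" for j
          using a_le[OF z] f_le[OF z] real_sqrt_le_mono by fastforce+
        have Cq: "C z * q z \<ge> 0"
          using f_le[OF z, of i] by (meson order_trans zero_le_power2)
        have "\<bar>Dq z v\<bar> \<le> (\<Sum>j\<in>UNIV. \<bar>a j z * Df j z v + Da j z v * f j z\<bar>)"
          unfolding Dq_def by (rule sum_abs)
        also have "\<dots> \<le> (\<Sum>j\<in>UNIV. sqrt (C z * q z) * (\<bar>Df j z v\<bar> + \<bar>Da j z v\<bar>))"
        proof (rule sum_mono)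
          fix j
          have "\<bar>a j z * Df j z v + Da j z v * f j z\<bar> \<le> \<bar>a j z\<bar> * \<bar>Df j z v\<bar> + \<bar>Da j z v\<bar> * \<bar>f j z\<bar>"
            by (metis abs_mult abs_triangle_ineq)
          also have "\<dots> \<le> sqrt (C z * q z) * \<bar>Df j z v\<bar> + \<bar>Da j z v\<bar> * sqrt (C z * q z)"
            using sq by (intro add_mono mult_right_mono mult_left_mono) auto
          finally show "\<bar>a j z * Df j z v + Da j z v * f j z\<bar> \<le>
              sqrt (C z * q z) * (\<bar>Df j z v\<bar> + \<bar>Da j z v\<bar>)"
            by (simp add: algebra_simps)
        qed
        finally have "\<bar>Dq z v\<bar> * \<bar>f i z\<bar> \<le>
            (\<Sum>j\<in>UNIV. sqrt (C z * q z) * (\<bar>Df j z v\<bar> + \<bar>Da j z v\<bar>)) * sqrt (C z * q z)"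
          using sq(2)[of i] Cq by (intro mult_mono) (auto intro!: sum_nonneg)
        also have "\<dots> = C z * q z * (\<Sum>j\<in>UNIV. \<bar>Df j z v\<bar> + \<bar>Da j z v\<bar>)"
        proof -
          have "(\<Sum>j\<in>UNIV. sqrt (C z * q z) * (\<bar>Df j z v\<bar> + \<bar>Da j z v\<bar>)) * sqrt (C z * q z)
              = (sqrt (C z * q z) * sqrt (C z * q z)) * (\<Sum>j\<in>UNIV. \<bar>Df j z v\<bar> + \<bar>Da j z v\<bar>)"
            unfolding sum_distrib_left[symmetric] by (simp only: mult_ac)
          then show ?thesis using Cq by simp
        qed
        finally have D: "\<bar>Dq z v\<bar> * \<bar>f i z\<bar> \<le> C z * q z * (\<Sum>j\<in>UNIV. \<bar>Df j z v\<bar> + \<bar>Da j z v\<bar>)" .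
        have "\<bar>s * q z powr (s - 1) * Dq z v * f i z\<bar> = s * q z powr (s - 1) * (\<bar>Dq z v\<bar> * \<bar>f i z\<bar>)"
          using s by (simp add: abs_mult)
        also have "\<dots> \<le> s * q z powr (s - 1) * (C z * q z * (\<Sum>j\<in>UNIV. \<bar>Df j z v\<bar> + \<bar>Da j z v\<bar>))"
          using D s by (intro mult_left_mono) auto
        also have "\<dots> = s * C z * (\<Sum>j\<in>UNIV. \<bar>Df j z v\<bar> + \<bar>Da j z v\<bar>) * (q z powr (s - 1) * q z)"
          by (simp only: mult_ac)
        also have "q z powr (s - 1) * q z = q z powr s"
          using q0[OF z] by (cases "q z = 0") (auto simp: powr_diff)
        finally show ?thesis by (simp add: M_def)
      qed
      have "((\<lambda>z. (s * q z powr (s - 1) * Dq z v) * f i z) \<longlongrightarrow> 0) (at y)"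
        by (rule Lim_null_comparison[OF _ M])
          (use bound S y in \<open>auto simp: eventually_at_topological intro!: exI[of _ S]\<close>)
      then show ?thesis using True by (simp add: isCont_def)
    qed
  qed
  show "Ck_on 0 S (\<lambda>y. q y powr s * Df i y v + (s * q y powr (s - 1) * Dq y v) * f i y)"
    using sing by (simp add: continuous_on_add continuous_on_mult cont_qs cont_Df)
qed

section \<open>Two inequalities for powers\<close>

lemma powr_add_le:
  fixes a b c p :: real
  assumes "a \<ge> 0" "b \<ge> 0" "c \<ge> 0" "c \<le> a + b" "p \<ge> 0"
  shows "c powr p \<le> 2 powr p * (a powr p + b powr p)"
proof -
  have "c powr p \<le> (2 * max a b) powr p"
    using assms by (intro powr_mono2) auto
  also have "\<dots> = 2 powr p * (max a b) powr p" using assms by (simp add: powr_mult)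
  also have "\<dots> \<le> 2 powr p * (a powr p + b powr p)"
    by (intro mult_left_mono) (auto simp: max_def)
  finally show ?thesis .
qed

lemma Young_weighted:
  fixes p s t :: real
  assumes "p > 1" "s \<ge> 0" "t \<ge> 0"
  shows "p * (s powr (p - 1) * t) \<le> (p - 1) * s powr p + t powr p"
proof -
  define q where "q = p / (p - 1)"
  have q: "q > 1" "1 / q + 1 / p = 1" "1 / q = (p - 1) / p" "(p - 1) * q = p"
    using assms by (auto simp: q_def field_simps)
  have "s powr (p - 1) * t \<le> (s powr (p - 1)) powr q / q + t powr p / p"
    using assms q by (intro Youngs_inequality) auto
  also have "(s powr (p - 1)) powr q / q = (p - 1) / p * s powr p"
    using q(3,4) by (metis mult.commute powr_powr times_divide_eq_right mult.right_neutral)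
  also have "(p - 1) / p * s powr p + t powr p / p = ((p - 1) * s powr p + t powr p) / p"
    by (simp add: add_divide_distrib)
  finally show ?thesis using assms by (simp add: field_simps)
qed

section \<open>Charts of a Riemannian manifold\<close>

locale riemannian =
  fixes A :: "('a::{second_countable_topology,t2_space}, 'n::finite) chart set"
    and g :: "('a, 'n) metric"
  assumes manifold: "riemannian_manifold A g"
begin

lemma open_chart: "c \<in> A \<Longrightarrow> open (chart_dom c)" "c \<in> A \<Longrightarrow> open (chart_ran c)"
  using manifold by (auto simp: riemannian_manifold_def smooth_atlas_def)

lemma chart_homeomorphism:
  "c \<in> A \<Longrightarrow> homeomorphism (chart_dom c) (chart_ran c) (chart_map c) (chart_inv c)"
  using manifold by (auto simp: riemannian_manifold_def smooth_atlas_def)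

lemma chart_inverse [simp]:
  "c \<in> A \<Longrightarrow> x \<in> chart_dom c \<Longrightarrow> chart_inv c (chart_map c x) = x"
  "c \<in> A \<Longrightarrow> y \<in> chart_ran c \<Longrightarrow> chart_map c (chart_inv c y) = y"
  "c \<in> A \<Longrightarrow> x \<in> chart_dom c \<Longrightarrow> chart_map c x \<in> chart_ran c"
  "c \<in> A \<Longrightarrow> y \<in> chart_ran c \<Longrightarrow> chart_inv c y \<in> chart_dom c"
  using chart_homeomorphism[of c] by (auto simp: homeomorphism_def)

lemma chart_continuous:
  "c \<in> A \<Longrightarrow> continuous_on (chart_dom c) (chart_map c)"
  "c \<in> A \<Longrightarrow> continuous_on (chart_ran c) (chart_inv c)"
  using chart_homeomorphism[of c] by (auto simp: homeomorphism_def)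

lemma chart_at: "chart_at A x \<in> A" "x \<in> chart_dom (chart_at A x)"
proof -
  have "\<exists>c. c \<in> A \<and> x \<in> chart_dom c"
    using manifold unfolding riemannian_manifold_def smooth_atlas_def by blast
  from someI_ex[OF this] show "chart_at A x \<in> A" "x \<in> chart_dom (chart_at A x)"
    unfolding chart_at_def by (rule conjunct1, rule conjunct2)
qed

lemma chart_image: "c \<in> A \<Longrightarrow> B \<subseteq> chart_dom c \<Longrightarrow> chart_map c ` B = chart_inv c -` B \<inter> chart_ran c"
  by (force simp: image_iff)

lemma open_chart_image:
  assumes "c \<in> A" "open B" "B \<subseteq> chart_dom c"
  shows "open (chart_map c ` B)"
  unfolding chart_image[OF assms(1,3)]
  using chart_continuous(2)[OF assms(1)] open_chart(2)[OF assms(1)] assms(2)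
  by (metis Int_commute continuous_on_open_vimage)

lemma measurable_chart_inv:
  assumes "c \<in> A"
  shows "chart_inv c \<in> borel_measurable (restrict_space borel (chart_ran c))"
  using chart_continuous(2)[OF assms] by (rule borel_measurable_continuous_on_restrict)

lemma borel_chart_image:
  assumes "c \<in> A" "B \<in> sets borel" "B \<subseteq> chart_dom c"
  shows "chart_map c ` B \<in> sets borel"
  using measurable_sets[OF measurable_chart_inv[OF assms(1)] assms(2)] open_chart(2)[OF assms(1)]
  unfolding chart_image[OF assms(1,3)] by (auto simp: sets_restrict_space_iff space_restrict_space)

section \<open>Transition maps and the metric\<close>

lemma overlap_open:
  "c \<in> A \<Longrightarrow> d \<in> A \<Longrightarrow> open (chart_map c ` (chart_dom c \<inter> chart_dom d))"
  by (intro open_chart_image) (auto intro: open_chart)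

lemma transition_apply [simp]:
  "c \<in> A \<Longrightarrow> x \<in> chart_dom c \<Longrightarrow> transition c d (chart_map c x) = chart_map d x"
  by (simp add: transition_def)

lemma Ck_on_transition:
  "c \<in> A \<Longrightarrow> d \<in> A \<Longrightarrow> Ck_on k (chart_map c ` (chart_dom c \<inter> chart_dom d)) (transition c d)"
  using manifold by (auto simp: riemannian_manifold_def smooth_atlas_def smooth_on_def)

lemma transition_has_derivative:
  assumes "c \<in> A" "d \<in> A" "x \<in> chart_dom c" "x \<in> chart_dom d"
  shows "(transition c d has_derivative (\<lambda>v. transition_jacobian c d x *v v)) (at (chart_map c x))"
proof -
  have der: "(transition c d has_derivative frechet_derivative (transition c d) (at (chart_map c x)))
      (at (chart_map c x))"
    using Ck_on_SucD(1)[OF Ck_on_transition[OF assms(1,2), of "Suc 0"]] assms by blast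
  then show ?thesis
    unfolding transition_jacobian_def using matrix_vector_mul(2)[OF has_derivative_linear[OF der]] by simp
qed

lemma transition_jacobian_inverse:
  assumes "c \<in> A" "d \<in> A" "x \<in> chart_dom c" "x \<in> chart_dom d"
  shows "transition_jacobian d c x *v (transition_jacobian c d x *v v) = v"
proof -
  let ?U = "chart_map c ` (chart_dom c \<inter> chart_dom d)"
  have "((transition d c \<circ> transition c d) has_derivative
      ((\<lambda>v. transition_jacobian d c x *v v) \<circ> (\<lambda>v. transition_jacobian c d x *v v))) (at (chart_map c x))"
    using transition_has_derivative[OF assms] transition_has_derivative[OF assms(2,1,4,3)] assms
    by (intro diff_chain_at) auto
  moreover have "((transition d c \<circ> transition c d) has_derivative (\<lambda>v. v)) (at (chart_map c x))"
    by (rule has_derivative_transform_within_open[of "\<lambda>y. y" _ _ _ ?U])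
      (use assms overlap_open in auto)
  ultimately have "((\<lambda>v. transition_jacobian d c x *v v) \<circ> (\<lambda>v. transition_jacobian c d x *v v)) = (\<lambda>v. v)"
    by (rule has_derivative_unique)
  then show ?thesis by (auto simp: fun_eq_iff)
qed

lemma metric_pos_def: "c \<in> A \<Longrightarrow> x \<in> chart_dom c \<Longrightarrow> pos_def (g c x)"
  using manifold unfolding riemannian_manifold_def riemannian_metric_def pos_def_def by blast

lemma metric_transform:
  assumes "c \<in> A" "d \<in> A" "x \<in> chart_dom c" "x \<in> chart_dom d"
  shows "g c x = transpose (transition_jacobian c d x) ** g d x ** transition_jacobian c d x"
  using manifold assms unfolding riemannian_manifold_def riemannian_metric_def by blast

lemma metric_transform_inner:
  assumes "c \<in> A" "d \<in> A" "x \<in> chart_dom c" "x \<in> chart_dom d"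
  shows "v \<bullet> (g c x *v w) =
    (transition_jacobian c d x *v v) \<bullet> (g d x *v (transition_jacobian c d x *v w))"
proof -
  have "v \<bullet> (transpose J *v z) = (J *v v) \<bullet> z" for J :: "real^'n^'n" and z
    by (metis dot_lmul_matrix inner_commute transpose_matrix_vector)
  then show ?thesis
    unfolding metric_transform[OF assms] by (simp add: matrix_vector_mul_assoc[symmetric])
qed

lemma Ck_on_metric:
  assumes "c \<in> A"
  shows "Ck_on k (chart_ran c) (\<lambda>y. g c (chart_inv c y) $ i $ j)"
proof -
  have "smooth_on (chart_ran c) (\<lambda>y. g c (chart_inv c y))"
    using manifold assms unfolding riemannian_manifold_def riemannian_metric_def by blast
  then show ?thesis
    by (intro Ck_on_vec_nth open_chart(2)[OF assms] smooth_on_Ck)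
qed

abbreviation dens :: "('a, 'n) chart \<Rightarrow> real^'n \<Rightarrow> real" where
  "dens c y \<equiv> volume_density g c (chart_inv c y)"

lemma volume_density_pos: "c \<in> A \<Longrightarrow> x \<in> chart_dom c \<Longrightarrow> volume_density g c x > 0"
  using pos_def_det_pos[OF metric_pos_def] by (simp add: volume_density_def)

lemma Ck_on_volume_density:
  assumes "c \<in> A"
  shows "Ck_on k (chart_ran c) (\<lambda>y. dens c y)"
  unfolding volume_density_def using assms open_chart(2)[OF assms]
  by (intro Ck_on_sqrt Ck_on_det Ck_on_metric pos_def_det_pos metric_pos_def) auto

lemma volume_density_transform:
  assumes "c \<in> A" "d \<in> A" "x \<in> chart_dom c" "x \<in> chart_dom d"
  shows "volume_density g c x = \<bar>det (transition_jacobian c d x)\<bar> * volume_density g d x"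
proof -
  have "det (g c x) = (det (transition_jacobian c d x))\<^sup>2 * det (g d x)"
    unfolding metric_transform[OF assms] by (simp add: det_mul det_transpose power2_eq_square)
  then show ?thesis
    by (simp add: volume_density_def real_sqrt_mult)
qed

section \<open>The Riemannian volume measure\<close>

text \<open>The part of the volume measure that a single chart sees.\<close>

definition chart_volume :: "('a, 'n) chart \<Rightarrow> 'a measure" where
  "chart_volume c = distr (density (restrict_space lborel (chart_ran c))
     (\<lambda>y. ennreal (dens c y))) borel (chart_inv c)"

lemma sets_restrict_lborel: "sets (restrict_space lborel X) = sets (restrict_space borel X)"
  by (rule sets_restrict_space_cong) simp

lemma measurable_chart_density:
  assumes "c \<in> A"
  shows "(\<lambda>y. dens c y) \<in> borel_measurable (restrict_space lborel (chart_ran c))"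
  using borel_measurable_continuous_on_restrict[OF Ck_on_continuous[OF Ck_on_volume_density[OF assms]]]
  by (simp add: measurable_cong_sets[OF sets_restrict_lborel])

lemma measurable_chart_inv':
  assumes "c \<in> A"
  shows "chart_inv c \<in> borel_measurable (restrict_space lborel (chart_ran c))"
  using measurable_chart_inv[OF assms] by (simp add: measurable_cong_sets[OF sets_restrict_lborel])

lemma emeasure_chart_volume:
  assumes c: "c \<in> A" and B: "B \<in> sets borel" "B \<subseteq> chart_dom c"
  shows "emeasure (chart_volume c) B =
    (\<integral>\<^sup>+y\<in>chart_map c ` B. ennreal (dens c y) \<partial>lborel)"
proof -
  let ?L = "restrict_space lborel (chart_ran c)"
  have ran: "chart_ran c \<in> sets borel" using open_chart(2)[OF c] by simp
  have sets: "chart_map c ` B \<in> sets ?L" "chart_map c ` B \<subseteq> chart_ran c"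
    using borel_chart_image[OF c B] B c ran by (auto simp: sets_restrict_space_iff)
  have "emeasure (chart_volume c) B = emeasure (density ?L
      (\<lambda>y. ennreal (dens c y))) (chart_map c ` B)"
    unfolding chart_volume_def using measurable_chart_inv'[OF c] B
    by (subst emeasure_distr) (auto simp: chart_image[OF c B(2)] space_restrict_space)
  also have "\<dots> = (\<integral>\<^sup>+y\<in>chart_map c ` B. ennreal (dens c y) \<partial>?L)"
    using measurable_chart_density[OF c] sets by (intro emeasure_density) auto
  also have "\<dots> = (\<integral>\<^sup>+y\<in>chart_map c ` B. ennreal (dens c y) \<partial>lborel)"
  proof -
    have "indicator (chart_map c ` B) y * indicator (chart_ran c) y = (indicator (chart_map c ` B) y :: ennreal)" for y
      using sets(2) by (cases "y \<in> chart_map c ` B") (auto simp: subset_iff)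
    then show ?thesis
      using ran by (simp add: nn_integral_restrict_space mult.assoc)
  qed
  finally show ?thesis .
qed

text \<open>The Jacobian factor of the change of variables is exactly the factor by which the two
  densities differ.\<close>

lemma chart_volume_overlap:
  assumes c: "c \<in> A" and d: "d \<in> A" and B: "B \<in> sets borel" "B \<subseteq> chart_dom c" "B \<subseteq> chart_dom d"
  shows "emeasure (chart_volume c) B = emeasure (chart_volume d) B"
proof -
  let ?T = "transition c d" and ?S = "chart_map c ` B" and ?U = "chart_map c ` (chart_dom c \<inter> chart_dom d)"
  let ?T' = "\<lambda>y v. transition_jacobian c d (chart_inv c y) *v v"
  have SU: "?S \<subseteq> ?U" using B by auto
  have TS: "?T ` ?S = chart_map d ` B"
    using c B(2) by (auto simp: image_image intro!: image_cong)
  have S: "?S \<in> sets borel" "?T ` ?S \<in> sets borel"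
    using borel_chart_image c d B TS by auto
  have der: "(?T has_derivative ?T' y) (at y)" if "y \<in> ?S" for y
  proof -
    from that obtain x where x: "y = chart_map c x" "x \<in> B" by auto
    then have "x \<in> chart_dom c" "x \<in> chart_dom d" using B by auto
    then show ?thesis using transition_has_derivative[OF c d] c x(1) by simp
  qed
  have mat: "matrix (?T' y) = transition_jacobian c d (chart_inv c y)" for y
    by (simp add: matrix_of_matrix_vector_mul)
  have inj: "inj_on ?T ?S"
  proof (rule inj_onI)
    fix y z assume yz: "y \<in> ?S" "z \<in> ?S" "?T y = ?T z"
    then obtain a b where ab: "y = chart_map c a" "z = chart_map c b" "a \<in> B" "b \<in> B" by auto
    have "a \<in> chart_dom c" "b \<in> chart_dom c" using ab B(2) by blast+
    then have "chart_map d a = chart_map d b"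
      using yz(3) ab(1,2) c by simp
    then have "a = b" using chart_inverse(1)[OF d] ab B(3) by (metis subsetD)
    then show "y = z" using ab by simp
  qed
  have T_meas: "?T \<in> borel_measurable (restrict_space borel ?S)"
    using Ck_on_continuous[OF Ck_on_transition[OF c d, of 0]] SU
    by (intro borel_measurable_continuous_on_restrict) (auto intro: continuous_on_subset)
  have jac: "continuous_on ?U (\<lambda>y. transition_jacobian c d (chart_inv c y) $ i $ j)" for i j
  proof -
    have "continuous_on ?U (\<lambda>y. frechet_derivative ?T (at y) (axis j 1) $ i)"
      using Ck_on_SucD(2)[OF Ck_on_transition[OF c d, of "Suc 0"], of "axis j 1"]
      by (auto intro: continuous_intros)
    then show ?thesis
      by (rule continuous_on_eq) (use c in \<open>auto simp: transition_jacobian_def matrix_def\<close>)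
  qed
  have det_meas: "(\<lambda>y. \<bar>det (matrix (?T' y))\<bar>) \<in> borel_measurable (restrict_space borel ?S)"
    unfolding mat det_def
    by (intro borel_measurable_continuous_on_restrict continuous_intros continuous_on_subset[OF jac SU])
  have f_meas: "(\<lambda>z. ennreal (dens d z)) \<in>
      borel_measurable (restrict_space borel (?T ` ?S))"
  proof -
    have "continuous_on (chart_map d ` B) (\<lambda>z. dens d z)"
    proof (rule continuous_on_subset[OF Ck_on_continuous[OF Ck_on_volume_density[OF d, of 0]]])
      show "chart_map d ` B \<subseteq> chart_ran d"
        using chart_inverse(3)[OF d] B(3) by blast
    qed
    then show ?thesis
      unfolding TS using borel_measurable_continuous_on_restrict by measurable
  qed
  have "emeasure (chart_volume d) B =
      (\<integral>\<^sup>+z\<in>?T ` ?S. ennreal (dens d z) \<partial>lborel)"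
    using emeasure_chart_volume[OF d B(1,3)] TS by simp
  also have "\<dots> = (\<integral>\<^sup>+y\<in>?S. ennreal \<bar>det (matrix (?T' y))\<bar> *
      ennreal (dens d (?T y)) \<partial>lborel)"
    by (rule nn_integral_change_of_variables[OF S der inj T_meas det_meas f_meas])
  also have "\<dots> = (\<integral>\<^sup>+y\<in>?S. ennreal (dens c y) \<partial>lborel)"
  proof (intro nn_integral_cong)
    fix y
    show "ennreal \<bar>det (matrix (?T' y))\<bar> * ennreal (dens d (?T y)) * indicator ?S y
        = ennreal (dens c y) * indicator ?S y"
    proof (cases "y \<in> ?S")
      case True
      then obtain x where x: "y = chart_map c x" "x \<in> B" by auto
      then have "x \<in> chart_dom c" "x \<in> chart_dom d" using B by auto
      then show ?thesis
        using x c d volume_density_transform[of c d x] mat[of y]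
        by (simp add: ennreal_mult' flip: ennreal_mult'')
    qed simp
  qed
  also have "\<dots> = emeasure (chart_volume c) B"
    using emeasure_chart_volume[OF c B(1,2)] by simp
  finally show ?thesis by simp
qed

lemma countable_subatlas: "\<exists>C. countable C \<and> C \<noteq> {} \<and> C \<subseteq> A \<and> (\<Union>c\<in>C. chart_dom c) = UNIV"
proof -
  obtain \<D> where \<D>: "\<D> \<subseteq> chart_dom ` A" "countable \<D>" "\<Union>\<D> = \<Union>(chart_dom ` A)"
  proof (rule Lindelof[of "chart_dom ` A"])
    show "open S" if "S \<in> chart_dom ` A" for S
      using that open_chart(1) by (auto simp del: split_paired_All)
  qed
  then obtain C where C: "C \<subseteq> A" "countable C" "\<D> = chart_dom ` C"
    using countable_subset_image by metis
  have "\<Union>(chart_dom ` A) = UNIV" using chart_at by blast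
  then have "(\<Union>c\<in>C. chart_dom c) = UNIV" using \<D>(3) C(3) by simp
  moreover then have "C \<noteq> {}" by auto
  ultimately show ?thesis using C by blast
qed

text \<open>The chart measures agree on overlaps, so they glue along a countable disjoint cover by
  pieces of chart domains; the same cover shows that the result is unique.\<close>

lemma riem_volume_unique_exists:
  "\<exists>!M. sets M = sets borel \<and> (\<forall>c\<in>A. \<forall>B\<in>sets borel. B \<subseteq> chart_dom c \<longrightarrow>
     emeasure M B = (\<integral>\<^sup>+ y\<in>chart_map c ` B. ennreal (dens c y) \<partial>lborel))"
    (is "\<exists>!M. ?P M")
proof -
  obtain C where C: "countable C" "C \<noteq> {}" "C \<subseteq> A" "(\<Union>c\<in>C. chart_dom c) = UNIV"
    using countable_subatlas by blast
  define ch where "ch n = from_nat_into C n" for n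
  have ch: "ch n \<in> A" for n using C(2,3) from_nat_into[of C n] by (auto simp: ch_def)
  define D where "D = disjointed (\<lambda>n. chart_dom (ch n))"
  have dom_borel: "chart_dom (ch n) \<in> sets borel" for n using open_chart(1)[OF ch] by simp
  have D_borel [measurable]: "D n \<in> sets borel" for n
    unfolding D_def using sets.range_disjointed_sets[of "\<lambda>n. chart_dom (ch n)" borel] dom_borel by blast
  have D_sub: "D n \<subseteq> chart_dom (ch n)" for n
    unfolding D_def by (rule disjointed_subset)
  have D_disj: "disjoint_family D" unfolding D_def by (rule disjoint_family_disjointed)
  have D_UN: "(\<Union>n. D n) = UNIV"
  proof -
    have "range ch = C" unfolding ch_def using range_from_nat_into[OF C(2,1)] .
    then show ?thesis
      unfolding D_def UN_disjointed_eq using C(4) by (metis image_image)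
  qed
  have split: "emeasure M B = (\<Sum>n. emeasure M (B \<inter> D n))"
    if "sets M = sets borel" "B \<in> sets borel" for M B
  proof -
    have "(\<Sum>n. emeasure M (B \<inter> D n)) = emeasure M (\<Union>n. B \<inter> D n)"
      using that D_disj by (intro suminf_emeasure) (auto simp: disjoint_family_on_def)
    also have "(\<Union>n. B \<inter> D n) = B" using D_UN by auto
    finally show ?thesis by simp
  qed
  have sets_cv: "sets (chart_volume c) = sets borel" for c by (simp add: chart_volume_def)
  define F where "F B = (\<Sum>n. emeasure (chart_volume (ch n)) (B \<inter> D n))" for B
  define M where "M = measure_of UNIV (sets borel) F"
  have "sigma_sets UNIV (sets borel) = (sets borel :: 'a set set)"
    using sets.sigma_sets_eq[of "borel :: 'a measure"] by simp
  then have sets_M: "sets M = sets borel"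
    by (simp add: M_def)
  \<comment> \<open>Countable additivity exchanges two series of extended reals, written as integrals over the
    counting measure.\<close>
  have em_M: "emeasure M B = F B" if "B \<in> sets borel" for B
  proof (rule emeasure_measure_of[OF M_def])
    show "positive (sets M) F" by (simp add: positive_def F_def)
    show "countably_additive (sets M) F"
    proof (rule countably_additiveI)
      fix X :: "nat \<Rightarrow> 'a set"
      assume X: "range X \<subseteq> sets M" "disjoint_family X"
      have "(\<Sum>i. F (X i)) = (\<Sum>i. \<integral>\<^sup>+n. emeasure (chart_volume (ch n)) (X i \<inter> D n) \<partial>count_space UNIV)"
        by (simp add: F_def nn_integral_count_space_nat)
      also have "\<dots> = (\<integral>\<^sup>+n. (\<Sum>i. emeasure (chart_volume (ch n)) (X i \<inter> D n)) \<partial>count_space UNIV)"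
        by (subst nn_integral_suminf) auto
      also have "\<dots> = (\<integral>\<^sup>+n. emeasure (chart_volume (ch n)) ((\<Union>i. X i) \<inter> D n) \<partial>count_space UNIV)"
      proof (intro nn_integral_cong)
        fix n
        have "(\<Sum>i. emeasure (chart_volume (ch n)) (X i \<inter> D n)) =
            emeasure (chart_volume (ch n)) (\<Union>i. X i \<inter> D n)"
          using X sets_M sets_cv by (intro suminf_emeasure) (auto simp: disjoint_family_on_def)
        also have "(\<Union>i. X i \<inter> D n) = (\<Union>i. X i) \<inter> D n" by auto
        finally show "(\<Sum>i. emeasure (chart_volume (ch n)) (X i \<inter> D n)) =
            emeasure (chart_volume (ch n)) ((\<Union>i. X i) \<inter> D n)" .
      qed
      also have "\<dots> = F (\<Union>i. X i)"
        by (simp add: F_def nn_integral_count_space_nat)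
      finally show "(\<Sum>i. F (X i)) = F (\<Union>i. X i)" .
    qed
  qed (use that sets_M in auto)
  have M: "?P M"
  proof (intro conjI ballI impI sets_M)
    fix c B assume c: "c \<in> A" and B: "B \<in> sets (borel :: 'a measure)" "B \<subseteq> chart_dom c"
    have "emeasure M B = (\<Sum>n. emeasure (chart_volume c) (B \<inter> D n))"
      unfolding em_M[OF B(1)] F_def using c ch B D_sub
      by (intro suminf_cong chart_volume_overlap) auto
    also have "\<dots> = emeasure (chart_volume c) B"
      using split[OF sets_cv B(1)] by simp
    finally show "emeasure M B =
        (\<integral>\<^sup>+ y\<in>chart_map c ` B. ennreal (dens c y) \<partial>lborel)"
      using emeasure_chart_volume[OF c B] by simp
  qed
  show ?thesis
  proof (rule ex1I[of ?P, OF M])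
    fix M' assume M': "?P M'"
    show "M' = M"
    proof (rule measure_eqI)
      show "sets M' = sets M" using M' sets_M by simp
      fix B assume "B \<in> sets M'"
      then have B: "B \<in> sets borel" using M' by simp
      have "emeasure M' (B \<inter> D n) = emeasure M (B \<inter> D n)" for n
      proof -
        have "B \<inter> D n \<in> sets borel" "B \<inter> D n \<subseteq> chart_dom (ch n)"
          using B D_borel D_sub by auto
        then show ?thesis
          using M[THEN conjunct2, rule_format, OF ch] M'[THEN conjunct2, rule_format, OF ch] by metis
      qed
      then show "emeasure M' B = emeasure M B"
        using split[of M' B] split[of M B] M' sets_M B by simp
    qed
  qed
qed

abbreviation vol :: "'a measure" where "vol \<equiv> riem_volume A g"

lemma sets_vol [simp, measurable_cong]: "sets vol = sets borel"
  using theI'[OF riem_volume_unique_exists] by (simp add: riem_volume_def)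

lemma space_vol [simp]: "space vol = UNIV"
  using sets_eq_imp_space_eq[OF sets_vol] by simp

lemma emeasure_vol_chart:
  assumes "c \<in> A" "B \<in> sets borel" "B \<subseteq> chart_dom c"
  shows "emeasure vol B = emeasure (chart_volume c) B"
  using theI'[OF riem_volume_unique_exists] assms emeasure_chart_volume[OF assms]
  by (simp add: riem_volume_def)

lemma chart_volume_eq:
  assumes c: "c \<in> A"
  shows "chart_volume c = density vol (indicator (chart_dom c))"
proof (rule measure_eqI)
  fix B assume "B \<in> sets (chart_volume c)"
  then have B: "B \<in> sets borel" by (simp add: chart_volume_def)
  have dom: "chart_dom c \<in> sets borel" using open_chart(1)[OF c] by simp
  have "emeasure (chart_volume c) B = emeasure (chart_volume c) (B \<inter> chart_dom c)"
    unfolding chart_volume_def using measurable_chart_inv'[OF c] B dom c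
    by (subst (1 2) emeasure_distr) (auto intro!: arg_cong2[where f = emeasure] simp: space_restrict_space)
  also have "\<dots> = emeasure vol (B \<inter> chart_dom c)"
    using emeasure_vol_chart[OF c, of "B \<inter> chart_dom c"] B dom by auto
  also have "\<dots> = emeasure (density vol (indicator (chart_dom c))) B"
    using B dom by (subst emeasure_density) (auto simp flip: nn_integral_indicator
        intro!: nn_integral_cong split: split_indicator)
  finally show "emeasure (chart_volume c) B = emeasure (density vol (indicator (chart_dom c))) B" .
qed (simp add: chart_volume_def)

text \<open>The chart measure is the restriction of the volume to the chart domain, and an integral
  against it is by construction a Lebesgue integral weighted by the density.\<close>

lemma
  fixes h :: "'a \<Rightarrow> real"
  assumes c: "c \<in> A" and h: "h \<in> borel_measurable borel" and supp: "\<And>x. x \<notin> chart_dom c \<Longrightarrow> h x = 0"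
  shows integrable_vol_chart: "integrable vol h \<longleftrightarrow>
      set_integrable lborel (chart_ran c) (\<lambda>y. dens c y * h (chart_inv c y))"
    and integral_vol_chart: "(LINT x|vol. h x) =
      (LINT y:chart_ran c|lborel. dens c y * h (chart_inv c y))"
proof -
  let ?L = "restrict_space lborel (chart_ran c)" and ?w = "\<lambda>y. dens c y"
  have dom: "chart_dom c \<in> sets borel" using open_chart(1)[OF c] by simp
  have ran: "chart_ran c \<in> sets borel" using open_chart(2)[OF c] by simp
  have ind: "density vol (indicator (chart_dom c)) = density vol (\<lambda>x. ennreal (indicator (chart_dom c) x))"
    by (simp add: ennreal_indicator)
  have supp': "(\<lambda>x. indicator (chart_dom c) x *\<^sub>R h x) = h"
    using supp by (auto split: split_indicator)
  have hinv: "(\<lambda>y. h (chart_inv c y)) \<in> borel_measurable ?L"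
    using measurable_compose[OF measurable_chart_inv'[OF c] h] .
  have w0: "AE y in ?L. 0 \<le> ?w y"
    using volume_density_pos[OF c] c by (intro AE_I2) (auto simp: space_restrict_space less_imp_le)
  have meas: "chart_inv c \<in> measurable (density ?L ?w) borel"
    using measurable_chart_inv'[OF c] by simp
  have "integrable vol h \<longleftrightarrow> integrable (chart_volume c) h"
    unfolding chart_volume_eq[OF c] ind
    using integrable_density[of h vol "indicator (chart_dom c)"] h dom supp' by simp
  also have "\<dots> \<longleftrightarrow> integrable (density ?L ?w) (\<lambda>y. h (chart_inv c y))"
    unfolding chart_volume_def by (rule integrable_distr_eq[OF meas h])
  also have "\<dots> \<longleftrightarrow> integrable ?L (\<lambda>y. ?w y *\<^sub>R h (chart_inv c y))"
    by (rule integrable_density[OF hinv measurable_chart_density[OF c] w0])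
  also have "\<dots> \<longleftrightarrow> set_integrable lborel (chart_ran c) (\<lambda>y. ?w y * h (chart_inv c y))"
    using ran by (simp add: integrable_restrict_space set_integrable_def)
  finally show "integrable vol h \<longleftrightarrow> set_integrable lborel (chart_ran c) (\<lambda>y. ?w y * h (chart_inv c y))" .
  have "(LINT x|vol. h x) = (LINT x|chart_volume c. h x)"
    unfolding chart_volume_eq[OF c] ind
    using integral_density[of h vol "indicator (chart_dom c)"] h dom supp' by simp
  also have "\<dots> = (LINT y|density ?L ?w. h (chart_inv c y))"
    unfolding chart_volume_def by (rule integral_distr[OF meas h])
  also have "\<dots> = (LINT y|?L. ?w y *\<^sub>R h (chart_inv c y))"
    by (rule integral_density[OF hinv measurable_chart_density[OF c] w0])
  also have "\<dots> = (LINT y:chart_ran c|lborel. ?w y * h (chart_inv c y))"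
    using ran by (simp add: integral_restrict_space set_lebesgue_integral_def)
  finally show "(LINT x|vol. h x) = (LINT y:chart_ran c|lborel. ?w y * h (chart_inv c y))" .
qed

lemma emeasure_vol_open_pos:
  assumes "open U" "U \<noteq> {}"
  shows "emeasure vol U > 0"
proof -
  obtain x where x: "x \<in> U" using assms by auto
  define c where "c = chart_at A x"
  have c: "c \<in> A" "x \<in> chart_dom c" using chart_at by (auto simp: c_def)
  let ?V = "U \<inter> chart_dom c" and ?w = "\<lambda>y. ennreal (dens c y)"
  have V: "open ?V" "?V \<subseteq> chart_dom c" "x \<in> ?V" using assms(1) x c open_chart(1)[OF c(1)] by auto
  let ?W = "chart_map c ` ?V"
  have W: "open ?W" "?W \<subseteq> chart_ran c" using open_chart_image[OF c(1) V(1,2)] c by auto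
  have "emeasure (chart_volume c) ?V \<noteq> 0"
  proof
    assume "emeasure (chart_volume c) ?V = 0"
    then have "(\<integral>\<^sup>+y. ?w y * indicator ?W y \<partial>lborel) = 0"
      using emeasure_chart_volume[OF c(1) _ V(2)] V(1) by simp
    moreover have "(\<lambda>y. ?w y * indicator ?W y) \<in> borel_measurable lborel"
    proof -
      have "(\<lambda>y. indicator ?W y *\<^sub>R dens c y) \<in> borel_measurable borel"
        using W(1) continuous_on_subset[OF Ck_on_continuous[OF Ck_on_volume_density[OF c(1)]] W(2)]
        by (intro borel_measurable_continuous_on_indicator) auto
      then have "(\<lambda>y. ennreal (indicator ?W y *\<^sub>R dens c y)) \<in> borel_measurable lborel"
        by simp
      also have "(\<lambda>y. ennreal (indicator ?W y *\<^sub>R dens c y)) = (\<lambda>y. ?w y * indicator ?W y)"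
        by (auto split: split_indicator)
      finally show ?thesis .
    qed
    ultimately have "AE y in lborel. ?w y * indicator ?W y = 0"
      by (simp add: nn_integral_0_iff_AE)
    then have "AE y in lborel. y \<notin> ?W"
    proof (rule AE_mp, intro AE_I2 impI)
      fix y assume *: "?w y * indicator ?W y = 0"
      show "y \<notin> ?W"
      proof
        assume "y \<in> ?W"
        then have "dens c y > 0"
          using volume_density_pos[OF c(1)] W(2) c(1) by auto
        then show False using * \<open>y \<in> ?W\<close> by simp
      qed
    qed
    then have "emeasure lborel ?W = 0"
      using W(1) by (subst (asm) AE_iff_measurable[of ?W]) auto
    moreover have "\<not> negligible ?W"
      using open_not_negligible[OF W(1)] V(3) by auto
    ultimately show False
      using W(1) by (simp add: negligible_iff_null_sets null_sets_completion_iff null_sets_def)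
  qed
  then have "0 < emeasure vol ?V"
    using emeasure_vol_chart[OF c(1) _ V(2)] V(1) by (simp add: zero_less_iff_neq_zero)
  also have "\<dots> \<le> emeasure vol U"
    using assms(1) by (intro emeasure_mono) auto
  finally show ?thesis .
qed

lemma AE_vol_notin_open:
  assumes "open P" "AE x in vol. x \<notin> P"
  shows "P = {}"
proof (rule ccontr)
  assume "P \<noteq> {}"
  moreover have "emeasure vol P = 0"
    using assms by (subst (asm) AE_iff_measurable[of P]) auto
  ultimately show False using emeasure_vol_open_pos[OF assms(1)] by simp
qed

text \<open>The density is bounded on small coordinate balls, so the volume is locally finite.\<close>

lemma emeasure_vol_compact_finite:
  assumes "compact K"
  shows "emeasure vol K < \<infinity>"
proof -
  have local: "\<exists>U. open U \<and> x \<in> U \<and> emeasure vol U < \<infinity>" for x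
  proof -
    define c where "c = chart_at A x"
    have c: "c \<in> A" "x \<in> chart_dom c" using chart_at by (auto simp: c_def)
    obtain r where r: "r > 0" "cball (chart_map c x) r \<subseteq> chart_ran c"
      using open_chart(2)[OF c(1)] c open_contains_cball chart_inverse(3) by blast
    let ?B = "ball (chart_map c x) r" and ?w = "\<lambda>y. dens c y"
    have Bran: "?B \<subseteq> chart_ran c" using r(2) by auto
    have "open (chart_dom c \<inter> chart_map c -` ?B)"
      using chart_continuous(1)[OF c(1)] open_chart(1)[OF c(1)]
      by (metis continuous_on_open_vimage Int_commute open_ball)
    moreover define U where "U = chart_dom c \<inter> chart_map c -` ?B"
    ultimately have U: "open U" "U \<subseteq> chart_dom c" "x \<in> U" "chart_map c ` U \<subseteq> ?B"
      using c r by auto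
    have "continuous_on (cball (chart_map c x) r) ?w"
      using Ck_on_continuous[OF Ck_on_volume_density[OF c(1)]] r(2) by (rule continuous_on_subset)
    then obtain C where C: "\<And>y. y \<in> cball (chart_map c x) r \<Longrightarrow> ?w y \<le> C"
      using compact_imp_bounded[OF compact_continuous_image[OF _ compact_cball]]
      by (metis (no_types, lifting) bounded_pos abs_le_D1 imageI real_norm_def)
    have "emeasure vol U = (\<integral>\<^sup>+y\<in>chart_map c ` U. ennreal (?w y) \<partial>lborel)"
      using emeasure_vol_chart[OF c(1) _ U(2)] emeasure_chart_volume[OF c(1) _ U(2)] U(1) by simp
    also have "\<dots> \<le> (\<integral>\<^sup>+y\<in>?B. ennreal C \<partial>lborel)"
      using U(4) C by (intro nn_integral_mono) (auto split: split_indicator intro!: ennreal_leI)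
    also have "\<dots> = ennreal C * emeasure lborel ?B"
      by (simp add: nn_integral_cmult_indicator)
    also have "\<dots> < \<infinity>"
      using emeasure_bounded_finite[of ?B] by (simp add: ennreal_mult_less_top)
    finally show ?thesis using U by blast
  qed
  let ?\<C> = "{U. open U \<and> emeasure vol U < \<infinity>}"
  have "K \<subseteq> \<Union>?\<C>" using local by blast
  then obtain \<F> where \<F>: "\<F> \<subseteq> ?\<C>" "finite \<F>" "K \<subseteq> \<Union>\<F>"
    using compactE[OF assms, of ?\<C>] by blast
  have "emeasure vol K \<le> emeasure vol (\<Union>\<F>)"
    using \<F> by (intro emeasure_mono) (auto intro!: borel_open open_Union)
  also have "\<dots> = emeasure vol (\<Union>U\<in>\<F>. U)" by simp
  also have "\<dots> \<le> (\<Sum>U\<in>\<F>. emeasure vol U)"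
    using \<F> by (intro emeasure_subadditive_finite) auto
  also have "\<dots> < \<infinity>" using \<F> by (auto simp: less_top)
  finally show ?thesis .
qed


section \<open>Differentials and gradients\<close>

definition C1_function :: "('a \<Rightarrow> real) \<Rightarrow> bool" where
  "C1_function f \<longleftrightarrow> (\<forall>c\<in>A. Ck_on (Suc 0) (chart_ran c) (f \<circ> chart_inv c))"

text \<open>The coordinate components of the covector \<open>df\<close>; the gradient is the vector that the metric
  turns into it.\<close>

definition differential :: "('a, 'n) chart \<Rightarrow> ('a \<Rightarrow> real) \<Rightarrow> 'a \<Rightarrow> real^'n" where
  "differential c f x = (\<chi> i. partial_deriv i (f \<circ> chart_inv c) (chart_map c x))"

lemma smooth_imp_C1: "smooth_function A f \<Longrightarrow> C1_function f"
  by (simp add: smooth_function_def C1_function_def smooth_on_def)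

lemma test_imp_C1: "test_function A f \<Longrightarrow> C1_function f"
  by (simp add: test_function_def smooth_imp_C1)

lemma C1_D: "C1_function f \<Longrightarrow> c \<in> A \<Longrightarrow> Ck_on (Suc 0) (chart_ran c) (\<lambda>y. f (chart_inv c y))"
  by (simp add: C1_function_def o_def)

lemma C1_I: "(\<And>c. c \<in> A \<Longrightarrow> Ck_on (Suc 0) (chart_ran c) (\<lambda>y. f (chart_inv c y))) \<Longrightarrow> C1_function f"
  by (simp add: C1_function_def o_def)

lemma has_derivative_axis_expand:
  fixes F :: "real^'n \<Rightarrow> real"
  assumes "(F has_derivative D) (at y)"
  shows "D = (\<lambda>v. (\<chi> i. partial_deriv i F y) \<bullet> v)"
proof
  fix v
  have lin: "linear D" using assms by (rule has_derivative_linear)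
  have D: "D = frechet_derivative F (at y)" using frechet_derivative_at[OF assms] .
  have "D v = D (\<Sum>i\<in>UNIV. v $ i *\<^sub>R axis i 1)"
    using basis_expansion[of v] by (simp add: scalar_mult_eq_scaleR)
  also have "\<dots> = (\<Sum>i\<in>UNIV. v $ i * D (axis i 1))"
    by (simp add: linear_sum[OF lin] linear_cmul[OF lin])
  finally show "D v = (\<chi> i. partial_deriv i F y) \<bullet> v"
    by (simp add: D partial_deriv_def inner_vec_def mult.commute)
qed

lemma C1_has_derivative:
  assumes "C1_function f" "c \<in> A" "x \<in> chart_dom c"
  shows "((\<lambda>y. f (chart_inv c y)) has_derivative (\<lambda>v. differential c f x \<bullet> v)) (at (chart_map c x))"
proof -
  have "((\<lambda>y. f (chart_inv c y)) has_derivative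
      frechet_derivative (\<lambda>y. f (chart_inv c y)) (at (chart_map c x))) (at (chart_map c x))"
    using Ck_on_SucD(1)[OF C1_D[OF assms(1,2)]] assms(2,3) by simp
  then show ?thesis
    using has_derivative_axis_expand by (fastforce simp: differential_def o_def)
qed

lemma differential_unique:
  assumes "((\<lambda>y. f (chart_inv c y)) has_derivative (\<lambda>v. w \<bullet> v)) (at (chart_map c x))"
  shows "differential c f x = w"
proof -
  have "differential c f x \<bullet> v = w \<bullet> v" for v
    using fun_cong[OF has_derivative_axis_expand[OF assms], of v] by (simp add: differential_def o_def)
  then show ?thesis by (metis inner_commute vector_eq_rdot)
qed

lemma differential_compose:
  assumes f: "C1_function f" and c: "c \<in> A" "x \<in> chart_dom c" and h: "(h has_real_derivative h') (at (f x))"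
  shows "differential c (\<lambda>x. h (f x)) x = h' *\<^sub>R differential c f x"
proof (rule differential_unique)
  have "(h has_derivative (*) h') (at (f (chart_inv c (chart_map c x))))"
    using h c by (simp add: has_field_derivative_def)
  from diff_chain_at[OF C1_has_derivative[OF f c] this]
  show "((\<lambda>y. h (f (chart_inv c y))) has_derivative (\<lambda>v. (h' *\<^sub>R differential c f x) \<bullet> v)) (at (chart_map c x))"
    by (simp add: o_def)
qed

lemma differential_mult:
  assumes f: "C1_function f" and h: "C1_function h" and c: "c \<in> A" "x \<in> chart_dom c"
  shows "differential c (\<lambda>x. f x * h x) x = f x *\<^sub>R differential c h x + h x *\<^sub>R differential c f x"
proof (rule differential_unique)
  show "((\<lambda>y. f (chart_inv c y) * h (chart_inv c y)) has_derivative
      (\<lambda>v. (f x *\<^sub>R differential c h x + h x *\<^sub>R differential c f x) \<bullet> v)) (at (chart_map c x))"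
    using has_derivative_mult[OF C1_has_derivative[OF f c] C1_has_derivative[OF h c]] c
    by (simp add: inner_add_left mult.commute)
qed

lemma differential_sum:
  assumes f: "\<And>i. i \<in> I \<Longrightarrow> C1_function (f i)" and c: "c \<in> A" "x \<in> chart_dom c"
  shows "differential c (\<lambda>x. \<Sum>i\<in>I. f i x) x = (\<Sum>i\<in>I. differential c (f i) x)"
proof (rule differential_unique)
  show "((\<lambda>y. \<Sum>i\<in>I. f i (chart_inv c y)) has_derivative
      (\<lambda>v. (\<Sum>i\<in>I. differential c (f i) x) \<bullet> v)) (at (chart_map c x))"
    unfolding inner_sum_left by (intro has_derivative_sum C1_has_derivative f c)
qed

lemma differential_cong:
  assumes "open U" "x \<in> U" "\<And>z. z \<in> U \<Longrightarrow> f z = h z" and c: "c \<in> A" "x \<in> chart_dom c"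
    and h: "C1_function h"
  shows "differential c f x = differential c h x"
proof (rule differential_unique)
  have op: "open (chart_map c ` (U \<inter> chart_dom c))"
    using assms(1) open_chart(1)[OF c(1)] by (intro open_chart_image[OF c(1)]) auto
  show "((\<lambda>y. f (chart_inv c y)) has_derivative (\<lambda>v. differential c h x \<bullet> v)) (at (chart_map c x))"
    by (rule has_derivative_transform_within_open[OF C1_has_derivative[OF h c] op])
      (use assms in auto)
qed

lemma C1_const: "C1_function (\<lambda>x. r)"
  by (intro C1_I Ck_on_const)

lemma C1_mult: "C1_function f \<Longrightarrow> C1_function h \<Longrightarrow> C1_function (\<lambda>x. f x * h x)"
  by (rule C1_I, rule Ck_on_mult[OF open_chart(2) C1_D C1_D])

lemma C1_sum: "(\<And>i. i \<in> I \<Longrightarrow> C1_function (f i)) \<Longrightarrow> C1_function (\<lambda>x. \<Sum>i\<in>I. f i x)"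
  by (rule C1_I, rule Ck_on_sum[OF open_chart(2) C1_D])

lemma C1_compose:
  assumes "C1_function f" "Ck_on (Suc 0) UNIV h"
  shows "C1_function (\<lambda>x. h (f x))"
  by (rule C1_I, rule Ck_on_compose[OF open_chart(2) open_UNIV _ C1_D[OF assms(1)] assms(2)]) simp_all

lemma differential_zero:
  assumes "open U" "x \<in> U" "\<And>z. z \<in> U \<Longrightarrow> f z = 0" and c: "c \<in> A" "x \<in> chart_dom c"
  shows "differential c f x = 0"
proof -
  have "differential c f x = differential c (\<lambda>_. 0) x"
    using assms by (intro differential_cong[OF assms(1,2) _ c C1_const]) auto
  also have "\<dots> = 0" by (rule differential_unique) simp
  finally show ?thesis .
qed

lemma differential_off_support:
  assumes "compact K" "\<And>z. z \<notin> K \<Longrightarrow> f z = 0" "x \<notin> K" and c: "c \<in> A" "x \<in> chart_dom c"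
  shows "differential c f x = 0"
proof (rule differential_zero[OF _ _ _ c])
  show "open (- K)" by (rule open_Compl[OF compact_imp_closed[OF assms(1)]])
qed (use assms in auto)

lemma continuous_on_chart_dom:
  assumes "c \<in> A" "continuous_on (chart_ran c) (\<lambda>y. f (chart_inv c y))"
  shows "continuous_on (chart_dom c) f"
proof (rule continuous_on_eq)
  show "continuous_on (chart_dom c) (\<lambda>x. f (chart_inv c (chart_map c x)))"
    by (rule continuous_on_compose2[OF assms(2) chart_continuous(1)[OF assms(1)]])
      (use assms(1) in auto)
qed (use assms(1) in simp)

lemma continuous_of_charts:
  assumes "\<And>c. c \<in> A \<Longrightarrow> continuous_on (chart_ran c) (\<lambda>y. f (chart_inv c y))"
  shows "continuous_on UNIV f"
proof (intro continuous_at_imp_continuous_on ballI)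
  fix x
  have "continuous_on (chart_dom (chart_at A x)) f"
    by (rule continuous_on_chart_dom[OF chart_at(1) assms[OF chart_at(1)]])
  then show "isCont f x"
    using continuous_on_eq_continuous_at open_chart(1) chart_at by blast
qed

lemma C1_continuous: "C1_function f \<Longrightarrow> continuous_on UNIV f"
  by (rule continuous_of_charts, rule Ck_on_continuous[OF C1_D])

lemma continuous_on_differential:
  assumes "C1_function f" "c \<in> A"
  shows "continuous_on (chart_ran c) (\<lambda>y. differential c f (chart_inv c y) $ i)"
proof (rule continuous_on_eq)
  show "continuous_on (chart_ran c) (\<lambda>y. frechet_derivative (\<lambda>y. f (chart_inv c y)) (at y) (axis i 1))"
    using Ck_on_SucD(2)[OF C1_D[OF assms]] by simp
qed (use assms(2) in \<open>simp add: differential_def partial_deriv_def o_def\<close>)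

lemma differential_transform:
  assumes f: "C1_function f" and cd: "c \<in> A" "d \<in> A" "x \<in> chart_dom c" "x \<in> chart_dom d"
  shows "differential c f x \<bullet> v = differential d f x \<bullet> (transition_jacobian c d x *v v)"
proof -
  let ?U = "chart_map c ` (chart_dom c \<inter> chart_dom d)"
  have "((\<lambda>y. f (chart_inv d y)) has_derivative (\<lambda>v. differential d f x \<bullet> v))
      (at (transition c d (chart_map c x)))"
    using C1_has_derivative[OF f cd(2,4)] cd by simp
  from diff_chain_at[OF transition_has_derivative[OF cd] this]
  have chain: "((\<lambda>y. f (chart_inv d (transition c d y))) has_derivative
      (\<lambda>v. differential d f x \<bullet> (transition_jacobian c d x *v v))) (at (chart_map c x))"
    by (simp add: o_def)
  have "((\<lambda>y. f (chart_inv c y)) has_derivative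
      (\<lambda>v. differential d f x \<bullet> (transition_jacobian c d x *v v))) (at (chart_map c x))"
    by (rule has_derivative_transform_within_open[OF chain overlap_open[OF cd(1,2)]]) (use cd in auto)
  from has_derivative_unique[OF this C1_has_derivative[OF f cd(1,3)]]
  show ?thesis by (simp add: fun_eq_iff)
qed

lemma metric_grad: "c \<in> A \<Longrightarrow> x \<in> chart_dom c \<Longrightarrow> g c x *v grad g f c x = differential c f x"
  by (simp add: grad_def differential_def pos_def_inverse metric_pos_def)

lemma metric_symmetric:
  "c \<in> A \<Longrightarrow> x \<in> chart_dom c \<Longrightarrow> v \<bullet> (g c x *v w) = w \<bullet> (g c x *v v)"
  using pos_def_sym[OF metric_pos_def] .

text \<open>The gradient is determined by \<open>g(\<nabla>f, w) = df(w)\<close> for all \<open>w\<close>, in which the metric and the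
  differential transform correctly and the metric is nondegenerate.\<close>

lemma vector_field_grad:
  assumes f: "C1_function f"
  shows "vector_field A (grad g f)"
  unfolding vector_field_def
proof (intro ballI)
  fix c d x assume cd: "c \<in> A" "d \<in> A" "x \<in> chart_dom c \<inter> chart_dom d"
  let ?J = "transition_jacobian c d x" and ?K = "transition_jacobian d c x"
  have x: "x \<in> chart_dom c" "x \<in> chart_dom d" using cd by auto
  have "w \<bullet> (g d x *v (?J *v grad g f c x)) = w \<bullet> (g d x *v grad g f d x)" for w
  proof -
    have JK: "?J *v (?K *v w) = w" using transition_jacobian_inverse[OF cd(2,1) x(2,1)] .
    have "w \<bullet> (g d x *v (?J *v grad g f c x)) = (?K *v w) \<bullet> (g c x *v grad g f c x)"
      using metric_transform_inner[OF cd(1,2) x, of "?K *v w"] JK by simp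
    also have "\<dots> = differential d f x \<bullet> w"
      using differential_transform[OF f cd(1,2) x, of "?K *v w"] JK
      by (simp add: metric_grad[OF cd(1) x(1)] inner_commute)
    also have "\<dots> = w \<bullet> (g d x *v grad g f d x)"
      by (simp add: metric_grad[OF cd(2) x(2)] inner_commute)
    finally show ?thesis .
  qed
  then have "g d x *v (?J *v grad g f c x) = g d x *v grad g f d x"
    by (metis vector_eq_ldot)
  then show "grad g f d x = ?J *v grad g f c x"
    using pos_def_inj[OF metric_pos_def[OF cd(2) x(2)]] by metis
qed

lemma field_norm_chart:
  assumes X: "vector_field A X" and c: "c \<in> A" "x \<in> chart_dom c"
  shows "field_norm A g X x = sqrt (X c x \<bullet> (g c x *v X c x))"
proof -
  let ?d = "chart_at A x"
  have "X ?d x = transition_jacobian c ?d x *v X c x"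
    using X c chart_at[of x] unfolding vector_field_def by blast
  then show ?thesis
    using metric_transform_inner[OF c(1) chart_at(1) c(2) chart_at(2), of "X c x" "X c x"]
    by (simp add: field_norm_def metric_norm_def Let_def)
qed

lemma field_norm_nonneg: "field_norm A g X x \<ge> 0"
  using pos_def_nonneg[OF metric_pos_def[OF chart_at]] by (simp add: field_norm_def metric_norm_def Let_def)

text \<open>Evaluated in an arbitrary chart; for a \<open>C\<^sup>1\<close> function and a vector field the value does not
  depend on that choice.\<close>

definition derivation :: "('a, 'n) vfield \<Rightarrow> ('a \<Rightarrow> real) \<Rightarrow> 'a \<Rightarrow> real" where
  "derivation X f x = differential (chart_at A x) f x \<bullet> X (chart_at A x) x"

lemma derivation_chart:
  assumes f: "C1_function f" and X: "vector_field A X" and c: "c \<in> A" "x \<in> chart_dom c"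
  shows "derivation X f x = differential c f x \<bullet> X c x"
proof -
  have "X (chart_at A x) x = transition_jacobian c (chart_at A x) x *v X c x"
    using X c chart_at[of x] unfolding vector_field_def by blast
  then show ?thesis
    using differential_transform[OF f c(1) chart_at(1) c(2) chart_at(2), of "X c x"]
    by (simp add: derivation_def)
qed

lemma derivation_grad: "derivation (grad g f) f x = (field_norm A g (grad g f) x)\<^sup>2"
proof -
  let ?c = "chart_at A x"
  have "grad g f ?c x \<bullet> (g ?c x *v grad g f ?c x) \<ge> 0"
    by (rule pos_def_nonneg[OF metric_pos_def[OF chart_at]])
  then show ?thesis
    by (simp add: derivation_def field_norm_def metric_norm_def Let_def
        metric_grad[OF chart_at] inner_commute)
qed

lemma derivation_le: "\<bar>derivation (grad g f) h x\<bar> \<le> field_norm A g (grad g h) x * field_norm A g (grad g f) x"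
proof -
  let ?c = "chart_at A x"
  have "(derivation (grad g f) h x)\<^sup>2 = (grad g h ?c x \<bullet> (g ?c x *v grad g f ?c x))\<^sup>2"
    by (simp add: derivation_def metric_grad[OF chart_at, symmetric] inner_commute
        metric_symmetric[OF chart_at, of "grad g h ?c x"])
  also have "\<dots> \<le> (grad g h ?c x \<bullet> (g ?c x *v grad g h ?c x)) * (grad g f ?c x \<bullet> (g ?c x *v grad g f ?c x))"
    by (rule pos_def_Cauchy_Schwarz[OF metric_pos_def[OF chart_at]])
  finally show ?thesis
    by (simp add: field_norm_def metric_norm_def Let_def flip: real_sqrt_mult)
      (metis real_sqrt_abs real_sqrt_le_mono)
qed

section \<open>Bump functions on the manifold\<close>

text \<open>A Euclidean bump function is pulled back through a chart and extended by zero.  It vanishes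
  off a compact subset of the chart domain, hence near every point outside the domain, so the
  extension is smooth in every other chart as well.\<close>

lemma exists_test_function:
  assumes U: "open U" "x \<in> U" and c: "c \<in> A" "x \<in> chart_dom c"
  shows "\<exists>\<beta> K. test_function A \<beta> \<and> compact K \<and> K \<subseteq> U \<and> K \<subseteq> chart_dom c \<and>
    (\<forall>z. \<beta> z \<ge> 0) \<and> (\<forall>z. z \<notin> K \<longrightarrow> \<beta> z = 0) \<and> \<beta> x > 0"
proof -
  let ?V = "chart_map c ` (U \<inter> chart_dom c)"
  have "open ?V" using U(1) open_chart(1)[OF c(1)] by (intro open_chart_image[OF c(1)]) auto
  moreover have "chart_map c x \<in> ?V" using U(2) c by auto
  ultimately obtain r where r: "r > 0" "cball (chart_map c x) r \<subseteq> ?V"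
    using open_contains_cball by blast
  let ?z = "chart_map c x"
  have Vran: "?V \<subseteq> chart_ran c" using c(1) chart_inverse(3) by blast
  define K where "K = chart_inv c ` cball ?z r"
  have "continuous_on (cball ?z r) (chart_inv c)"
    using continuous_on_subset[OF chart_continuous(2)[OF c(1)]] r(2) Vran by blast
  then have K: "compact K" unfolding K_def by (intro compact_continuous_image) auto
  have K_sub: "K \<subseteq> U \<inter> chart_dom c"
  proof
    fix w assume "w \<in> K"
    then obtain y where y: "w = chart_inv c y" "y \<in> cball ?z r" by (auto simp: K_def)
    then obtain w' where w': "y = chart_map c w'" "w' \<in> U" "w' \<in> chart_dom c" using r(2) by blast
    then show "w \<in> U \<inter> chart_dom c" using y c(1) by simp
  qed
  have closed_K: "closed K" using K by (rule compact_imp_closed)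
  define \<beta> where "\<beta> w = (if w \<in> chart_dom c then bump ?z r (chart_map c w) else 0)" for w
  have \<beta>0: "\<beta> w = 0" if "w \<notin> K" for w
  proof (cases "w \<in> chart_dom c")
    case True
    then have "chart_map c w \<notin> ball ?z r"
      using that c(1) unfolding K_def by (metis ball_subset_cball chart_inverse(1) image_eqI subsetD)
    then show ?thesis by (simp add: \<beta>_def bump_eq_0[OF r(1)])
  qed (simp add: \<beta>_def)
  have "Ck_on k (chart_ran d) (\<lambda>y. \<beta> (chart_inv d y))" if d: "d \<in> A" for d k
  proof (rule Ck_on_locally)
    fix y assume y: "y \<in> chart_ran d"
    show "\<exists>T. open T \<and> y \<in> T \<and> Ck_on k T (\<lambda>y. \<beta> (chart_inv d y))"
    proof (cases "chart_inv d y \<in> chart_dom c")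
      case True
      let ?T = "chart_map d ` (chart_dom d \<inter> chart_dom c)"
      have op: "open ?T" by (rule overlap_open[OF d c(1)])
      have yT: "y \<in> ?T" using True y d by (metis IntI chart_inverse(2) chart_inverse(4) image_eqI)
      have "Ck_on k ?T (\<lambda>y. bump ?z r (transition d c y))"
        by (rule Ck_on_compose[OF op open_UNIV _ Ck_on_transition[OF d c(1)] Ck_on_bump]) simp
      then have "Ck_on k ?T (\<lambda>y. \<beta> (chart_inv d y))"
        by (rule Ck_on_cong[OF op, rotated]) (use d in \<open>auto simp: \<beta>_def\<close>)
      then show ?thesis using op yT by blast
    next
      case False
      let ?T = "chart_map d ` (chart_dom d - K)"
      have op: "open ?T" using open_chart(1)[OF d] closed_K by (intro open_chart_image[OF d]) (auto intro: open_Diff)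
      have "chart_inv d y \<notin> K" using False K_sub by auto
      then have yT: "y \<in> ?T" using y d by (metis DiffI chart_inverse(2) chart_inverse(4) image_eqI)
      have "Ck_on k ?T (\<lambda>y. \<beta> (chart_inv d y))"
        by (rule Ck_on_cong[OF op _ Ck_on_const[of _ _ 0]]) (use d \<beta>0 in auto)
      then show ?thesis using op yT by blast
    qed
  qed
  then have "smooth_function A \<beta>"
    by (simp add: smooth_function_def smooth_on_def o_def)
  moreover have "compact (closure {w. \<beta> w \<noteq> 0})"
  proof -
    have "closure {w. \<beta> w \<noteq> 0} \<subseteq> K"
      using \<beta>0 closed_K by (intro closure_minimal) auto
    then show ?thesis using compact_Int_closed[OF K closed_closure] by (metis Int_absorb1)
  qed
  ultimately have "test_function A \<beta>" by (simp add: test_function_def)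
  moreover have "\<beta> x > 0" using c r(1) by (simp add: \<beta>_def bump_pos_iff)
  moreover have "\<beta> w \<ge> 0" for w by (simp add: \<beta>_def bump_nonneg)
  ultimately show ?thesis using K K_sub \<beta>0 by (intro exI[of _ \<beta>] exI[of _ K]) auto
qed


section \<open>Regularity of the flux\<close>

definition C1_field :: "('a, 'n) vfield \<Rightarrow> bool" where
  "C1_field X \<longleftrightarrow> vector_field A X \<and>
     (\<forall>c\<in>A. \<forall>i. Ck_on (Suc 0) (chart_ran c) (\<lambda>y. X c (chart_inv c y) $ i))"

definition flux :: "real \<Rightarrow> ('a \<Rightarrow> real) \<Rightarrow> ('a, 'n) vfield" where
  "flux p u c x = field_norm A g (grad g u) x powr (p - 2) *\<^sub>R grad g u c x"

lemma Ck_on_smooth_differential: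
  assumes u: "smooth_function A u" and c: "c \<in> A"
  shows "Ck_on k (chart_ran c) (\<lambda>y. differential c u (chart_inv c y) $ i)"
proof (rule Ck_on_cong[OF open_chart(2)[OF c]])
  have "Ck_on (Suc k) (chart_ran c) (u \<circ> chart_inv c)"
    using u c by (auto simp: smooth_function_def smooth_on_def)
  then show "Ck_on k (chart_ran c) (\<lambda>y. frechet_derivative (u \<circ> chart_inv c) (at y) (axis i 1))"
    by (rule Ck_on_SucD(2))
qed (use c in \<open>simp add: differential_def partial_deriv_def\<close>)

lemma Ck_on_grad:
  assumes c: "c \<in> A" and u: "\<And>i. Ck_on k (chart_ran c) (\<lambda>y. differential c u (chart_inv c y) $ i)"
  shows "Ck_on k (chart_ran c) (\<lambda>y. grad g u c (chart_inv c y) $ i)"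
proof -
  have "Ck_on k (chart_ran c)
      (\<lambda>y. (matrix_inv (g c (chart_inv c y)) *v differential c u (chart_inv c y)) $ i)"
    using c by (intro Ck_on_matrix_inv_mult open_chart(2)[OF c] Ck_on_metric[OF c] u metric_pos_def) auto
  then show ?thesis by (simp add: grad_def differential_def)
qed

lemma axis_inner: "axis i (1::real) \<bullet> v = v $ i"
  by (simp add: inner_axis inner_commute)

text \<open>In a chart the flux is \<open>q\<^sup>(\<^sup>p\<^sup>-\<^sup>2\<^sup>)\<^sup>/\<^sup>2 \<nabla>u\<close> with \<open>q = \<bar>\<nabla>u\<bar>\<^sup>2\<close>, to which the lemma on
  degenerate powers applies.  For \<open>p = 2\<close> the exponent vanishes and the flux is the gradient,
  also at critical points, where \<open>0 powr 0 = 0\<close> multiplies the zero vector.\<close>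

lemma C1_field_flux:
  assumes p: "p \<ge> 2" and u: "smooth_function A u"
  shows "C1_field (flux p u)"
  unfolding C1_field_def
proof (intro conjI ballI allI)
  have vf: "vector_field A (grad g u)" by (rule vector_field_grad[OF smooth_imp_C1[OF u]])
  show "vector_field A (flux p u)"
    unfolding vector_field_def
  proof (intro ballI)
    fix c d x assume "c \<in> A" "d \<in> A" "x \<in> chart_dom c \<inter> chart_dom d"
    then have "grad g u d x = transition_jacobian c d x *v grad g u c x"
      using vf unfolding vector_field_def by blast
    then show "flux p u d x = transition_jacobian c d x *v flux p u c x"
      by (simp add: flux_def matrix_vector_mult_scaleR)
  qed
  fix c i assume c: "c \<in> A"
  let ?a = "\<lambda>j y. differential c u (chart_inv c y) $ j" and ?f = "\<lambda>j y. grad g u c (chart_inv c y) $ j"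
  let ?G = "\<lambda>y. g c (chart_inv c y)" and ?S = "chart_ran c"
  define q where "q y = (\<Sum>j\<in>UNIV. ?a j y * ?f j y)" for y
  note S = open_chart(2)[OF c]
  have G: "pos_def (?G y)" if "y \<in> ?S" for y
    using metric_pos_def[OF c] c that by simp
  have a: "differential c u (chart_inv c y) = ?G y *v grad g u c (chart_inv c y)" if "y \<in> ?S" for y
    using metric_grad[OF c] c that by simp
  have q_eq: "q y = grad g u c (chart_inv c y) \<bullet> (?G y *v grad g u c (chart_inv c y))" if "y \<in> ?S" for y
    using a[OF that] by (simp add: q_def inner_vec_def mult.commute)
  have q0: "q y \<ge> 0" if "y \<in> ?S" for y
    using q_eq[OF that] pos_def_nonneg[OF G[OF that]] by simp
  have norm: "field_norm A g (grad g u) (chart_inv c y) = sqrt (q y)" if "y \<in> ?S" for y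
    using field_norm_chart[OF vf c] c that q_eq[OF that] by simp
  have Ca: "Ck_on k ?S (?a j)" and Cf: "Ck_on k ?S (?f j)" for k j
    using Ck_on_smooth_differential[OF u c] by (simp_all add: Ck_on_grad[OF c])
  show "Ck_on (Suc 0) ?S (\<lambda>y. flux p u c (chart_inv c y) $ i)"
  proof (cases "p = 2")
    case True
    show ?thesis
    proof (rule Ck_on_cong[OF S _ Cf[of "Suc 0" i]])
      fix y assume y: "y \<in> ?S"
      show "?f i y = flux p u c (chart_inv c y) $ i"
        using norm[OF y] q_eq[OF y] pos_def_eq_0[OF G[OF y]] True
        by (cases "q y = 0") (auto simp: flux_def)
    qed
  next
    case False
    then have s: "(p - 2) / 2 > 0" using p by simp
    \<comment> \<open>A continuous bound for the squared components of \<open>du\<close> and \<open>\<nabla>u\<close> relative to \<open>q\<close>: the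
      traces of the metric and of its inverse.\<close>
    define Gi where "Gi j y = (matrix_inv (?G y) *v axis j 1) $ j" for j y
    define C where "C y = (\<Sum>j\<in>UNIV. ?G y $ j $ j) + (\<Sum>j\<in>UNIV. Gi j y)" for y
    have G_jj: "?G y $ j $ j = axis j 1 \<bullet> (?G y *v axis j 1)" for j y
      by (simp add: axis_inner matrix_vector_mult_basis column_def)
    have Gi_eq: "Gi j y = (matrix_inv (?G y) *v axis j 1) \<bullet> (?G y *v (matrix_inv (?G y) *v axis j 1))"
      if "y \<in> ?S" for j y
      using pos_def_inverse[OF G[OF that]] by (simp add: Gi_def inner_axis)
    have G_nn: "?G y $ j $ j \<ge> 0" "Gi j y \<ge> 0" if "y \<in> ?S" for j y
      using G_jj Gi_eq[OF that] pos_def_nonneg[OF G[OF that]] by simp_all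
    have G_le: "?G y $ j $ j \<le> C y" "Gi j y \<le> C y" if y: "y \<in> ?S" for j y
    proof -
      have "?G y $ j $ j \<le> (\<Sum>j\<in>UNIV. ?G y $ j $ j)" "Gi j y \<le> (\<Sum>j\<in>UNIV. Gi j y)"
        using G_nn[OF y] by (auto intro: member_le_sum)
      moreover have "(\<Sum>j\<in>UNIV. ?G y $ j $ j) \<ge> 0" "(\<Sum>j\<in>UNIV. Gi j y) \<ge> 0"
        using G_nn[OF y] by (auto intro: sum_nonneg)
      ultimately show "?G y $ j $ j \<le> C y" "Gi j y \<le> C y" by (auto simp: C_def)
    qed
    have cont_C: "continuous_on ?S C"
    proof -
      have "Ck_on 0 ?S (\<lambda>y. Gi j y)" for j
        unfolding Gi_def
        by (rule Ck_on_matrix_inv_mult[OF S Ck_on_metric[OF c] G Ck_on_const])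
      then show ?thesis
        unfolding C_def
        by (intro continuous_on_add continuous_on_sum Ck_on_continuous[OF Ck_on_metric[OF c, of 0]]) simp
    qed
    have "Ck_on (Suc 0) ?S (\<lambda>y. q y powr ((p - 2) / 2) * ?f i y)"
    proof (rule Ck_on_powr_mult_degenerate[OF S s Ca Cf q_def q0 cont_C])
      fix y j assume y: "y \<in> ?S"
      let ?v = "grad g u c (chart_inv c y)"
      \<comment> \<open>Both bounds are the Cauchy--Schwarz inequality of the metric, against the coordinate
        vector and against its image under the inverse metric.\<close>
      have "(?a j y)\<^sup>2 = (axis j 1 \<bullet> (?G y *v ?v))\<^sup>2"
        using a[OF y] by (simp add: axis_inner)
      also have "\<dots> \<le> ?G y $ j $ j * q y"
        unfolding G_jj q_eq[OF y] by (rule pos_def_Cauchy_Schwarz[OF G[OF y]])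
      also have "\<dots> \<le> C y * q y" using G_le[OF y] q0[OF y] by (intro mult_right_mono)
      finally show "(?a j y)\<^sup>2 \<le> C y * q y" .
      have "(?f j y)\<^sup>2 = ((matrix_inv (?G y) *v axis j 1) \<bullet> (?G y *v ?v))\<^sup>2"
        using pos_def_sym[OF G[OF y], of ?v] pos_def_inverse[OF G[OF y]]
        by (metis axis_inner inner_commute)
      also have "\<dots> \<le> Gi j y * q y"
        unfolding Gi_eq[OF y] q_eq[OF y] by (rule pos_def_Cauchy_Schwarz[OF G[OF y]])
      also have "\<dots> \<le> C y * q y" using G_le[OF y] q0[OF y] by (intro mult_right_mono)
      finally show "(?f j y)\<^sup>2 \<le> C y * q y" .
    qed
    then show ?thesis
    proof (rule Ck_on_cong[OF S, rotated])
      fix y assume y: "y \<in> ?S"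
      have "sqrt (q y) powr (p - 2) = q y powr ((p - 2) / 2)"
        using q0[OF y] by (simp add: powr_half_sqrt[symmetric] powr_powr)
      then show "q y powr ((p - 2) / 2) * ?f i y = flux p u c (chart_inv c y) $ i"
        using norm[OF y] by (simp add: flux_def)
    qed
  qed
qed

lemma derivation_flux: "derivation (flux p u) h x = field_norm A g (grad g u) x powr (p - 2) * derivation (grad g u) h x"
  by (simp add: derivation_def flux_def)

section \<open>The divergence theorem in a chart\<close>

text \<open>The divergence theorem is used in the form \<open>\<integral> (\<eta> div X + X\<eta>) = 0\<close>, the integrand being the
  divergence of \<open>\<eta> X\<close>; this separates the regularity of \<open>\<eta>\<close> and of \<open>X\<close>.\<close>

definition chart_divergence :: "('a, 'n) chart \<Rightarrow> ('a, 'n) vfield \<Rightarrow> 'a \<Rightarrow> real" where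
  "chart_divergence c X x =
     (\<Sum>i\<in>UNIV. partial_deriv i (\<lambda>y. dens c y * X c (chart_inv c y) $ i)
       (chart_map c x)) / volume_density g c x"

lemma divergence_chart_at: "divergence A g X x = chart_divergence (chart_at A x) X x"
  by (simp add: divergence_def chart_divergence_def Let_def)

lemma Ck_on_density_field:
  assumes "C1_field X" "c \<in> A"
  shows "Ck_on (Suc 0) (chart_ran c) (\<lambda>y. dens c y * X c (chart_inv c y) $ i)"
  using assms by (intro Ck_on_mult open_chart Ck_on_volume_density) (auto simp: C1_field_def)

lemma continuous_on_chart_divergence:
  assumes X: "C1_field X" and c: "c \<in> A"
  shows "continuous_on (chart_ran c) (\<lambda>y. chart_divergence c X (chart_inv c y))"
proof (rule continuous_on_eq)
  let ?F = "\<lambda>i y. dens c y * X c (chart_inv c y) $ i"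
  have "continuous_on (chart_ran c) (\<lambda>y. frechet_derivative (?F i) (at y) (axis i 1))" for i
    using Ck_on_SucD(2)[OF Ck_on_density_field[OF X c]] by simp
  moreover have "dens c y \<noteq> 0" if "y \<in> chart_ran c" for y
    using volume_density_pos[OF c chart_inverse(4)[OF c that]] by simp
  ultimately show "continuous_on (chart_ran c) (\<lambda>y. (\<Sum>i\<in>UNIV. frechet_derivative (?F i) (at y) (axis i 1))
      / dens c y)"
    by (intro continuous_intros Ck_on_continuous[OF Ck_on_volume_density[OF c]]) auto
qed (use c in \<open>simp add: chart_divergence_def partial_deriv_def\<close>)

lemma continuous_of_chart_support:
  assumes "c \<in> A" "continuous_on (chart_ran c) (\<lambda>y. h (chart_inv c y))"
    and "compact K" "K \<subseteq> chart_dom c" "\<And>x. x \<notin> K \<Longrightarrow> h x = (0::real)"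
  shows "continuous_on UNIV h"
proof -
  have "continuous_on (chart_dom c) h" by (rule continuous_on_chart_dom[OF assms(1,2)])
  moreover have "continuous_on (- K) h"
    by (rule continuous_on_eq[OF continuous_on_const[of _ 0]]) (use assms(5) in auto)
  moreover have "open (- K)" using assms(3) by (simp add: compact_imp_closed open_Compl)
  ultimately have "continuous_on (chart_dom c \<union> - K) h"
    using open_chart(1)[OF assms(1)] by (intro continuous_on_open_Un)
  moreover have "chart_dom c \<union> - K = UNIV" using assms(4) by auto
  ultimately show ?thesis by simp
qed

lemma continuous_on_derivation:
  assumes \<eta>: "C1_function \<eta>" and X: "C1_field X" and c: "c \<in> A"
  shows "continuous_on (chart_ran c) (\<lambda>y. derivation X \<eta> (chart_inv c y))"
proof (rule continuous_on_eq)
  show "continuous_on (chart_ran c)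
      (\<lambda>y. \<Sum>i\<in>UNIV. differential c \<eta> (chart_inv c y) $ i * X c (chart_inv c y) $ i)"
  proof (intro continuous_on_sum continuous_on_mult continuous_on_differential[OF \<eta> c])
    show "continuous_on (chart_ran c) (\<lambda>y. X c (chart_inv c y) $ i)" for i
      using X c unfolding C1_field_def by (blast intro: Ck_on_continuous)
  qed
  show "(\<Sum>i\<in>UNIV. differential c \<eta> (chart_inv c y) $ i * X c (chart_inv c y) $ i) =
      derivation X \<eta> (chart_inv c y)" if "y \<in> chart_ran c" for y
    using derivation_chart[OF \<eta>, of X c "chart_inv c y"] X c that
    by (simp add: C1_field_def inner_vec_def)
qed

lemma
  assumes c: "c \<in> A" and \<eta>: "C1_function \<eta>" and X: "C1_field X"
    and K: "compact K" "K \<subseteq> chart_dom c" "\<And>x. x \<notin> K \<Longrightarrow> \<eta> x = 0"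
  shows integrable_chart_divergence: "integrable vol (\<lambda>x. \<eta> x * chart_divergence c X x + derivation X \<eta> x)"
    and integral_chart_divergence: "(LINT x|vol. \<eta> x * chart_divergence c X x + derivation X \<eta> x) = 0"
proof -
  let ?w = "\<lambda>y. dens c y" and ?\<eta> = "\<lambda>y. \<eta> (chart_inv c y)"
  let ?X = "\<lambda>i y. X c (chart_inv c y) $ i" and ?S = "chart_ran c"
  let ?h = "\<lambda>x. \<eta> x * chart_divergence c X x + derivation X \<eta> x"
  let ?F = "\<lambda>i y. ?\<eta> y * (?w y * ?X i y)"
  have vf: "vector_field A X" using X by (simp add: C1_field_def)
  have h0: "?h x = 0" if "x \<notin> K" for x
  proof -
    have "differential (chart_at A x) \<eta> x = 0"
      by (rule differential_off_support[OF K(1,3) that chart_at])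
    then show ?thesis using K(3)[OF that] by (simp add: derivation_def)
  qed
  have cont: "continuous_on UNIV ?h"
    by (rule continuous_of_chart_support[OF c _ K(1,2) h0])
      (intro continuous_intros continuous_on_derivation[OF \<eta> X c]
        continuous_on_chart_divergence[OF X c] Ck_on_continuous[OF C1_D[OF \<eta> c]])
  then have meas: "?h \<in> borel_measurable borel" by (rule borel_measurable_continuous_onI)
  have h_dom: "?h x = 0" if "x \<notin> chart_dom c" for x using h0 K(2) that by blast
  have CF: "Ck_on (Suc 0) ?S (?F i)" for i
    by (rule Ck_on_mult[OF open_chart(2)[OF c] C1_D[OF \<eta> c] Ck_on_density_field[OF X c]])
  have KS: "compact (chart_map c ` K)" "chart_map c ` K \<subseteq> ?S"
    using K c continuous_on_subset[OF chart_continuous(1)[OF c] K(2)]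
    by (auto intro: compact_continuous_image)
  have F0: "?F i y = 0" if "y \<in> ?S" "y \<notin> chart_map c ` K" for i y
  proof -
    have "chart_inv c y \<notin> K" using that c by (metis chart_inverse(2) image_eqI)
    then show ?thesis using K(3) by simp
  qed
  have zero: "set_integrable lborel ?S (\<lambda>y. frechet_derivative (?F i) (at y) v)"
      "(LINT y:?S|lborel. frechet_derivative (?F i) (at y) v) = 0" for i v
    using F0 by (auto intro!: set_integral_derivative_eq_0[OF open_chart(2)[OF c] CF KS])
  \<comment> \<open>In coordinates the integrand, weighted by the density, is a Euclidean divergence.\<close>
  have eq: "?w y * ?h (chart_inv c y) = (\<Sum>i\<in>UNIV. frechet_derivative (?F i) (at y) (axis i 1))"
    if y: "y \<in> ?S" for y
  proof -
    let ?x = "chart_inv c y"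
    have x: "?x \<in> chart_dom c" using c y by simp
    have w: "?w y \<noteq> 0" using volume_density_pos[OF c x] by simp
    have "frechet_derivative (?F i) (at y) (axis i 1) =
        ?\<eta> y * partial_deriv i (\<lambda>y. ?w y * ?X i y) y + differential c \<eta> ?x $ i * (?w y * ?X i y)" for i
    proof -
      have "(?\<eta> has_derivative frechet_derivative ?\<eta> (at y)) (at y)"
        by (rule Ck_on_SucD(1)[OF C1_D[OF \<eta> c] y])
      moreover have "((\<lambda>y. ?w y * ?X i y) has_derivative frechet_derivative (\<lambda>y. ?w y * ?X i y) (at y)) (at y)"
        by (rule Ck_on_SucD(1)[OF Ck_on_density_field[OF X c] y])
      ultimately have "(?F i has_derivative (\<lambda>v. ?\<eta> y * frechet_derivative (\<lambda>y. ?w y * ?X i y) (at y) v +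
          frechet_derivative ?\<eta> (at y) v * (?w y * ?X i y))) (at y)"
        by (rule has_derivative_mult)
      from frechet_derivative_at[OF this, symmetric] show ?thesis
        using c y by (simp add: partial_deriv_def differential_def o_def)
    qed
    then have "(\<Sum>i\<in>UNIV. frechet_derivative (?F i) (at y) (axis i 1)) =
        ?\<eta> y * (\<Sum>i\<in>UNIV. partial_deriv i (\<lambda>y. ?w y * ?X i y) y) +
        ?w y * (\<Sum>i\<in>UNIV. differential c \<eta> ?x $ i * ?X i y)"
      by (simp add: sum.distrib sum_distrib_left mult_ac)
    also have "(\<Sum>i\<in>UNIV. differential c \<eta> ?x $ i * ?X i y) = derivation X \<eta> ?x"
      using derivation_chart[OF \<eta> vf c x] by (simp add: inner_vec_def)
    also have "(\<Sum>i\<in>UNIV. partial_deriv i (\<lambda>y. ?w y * ?X i y) y) = ?w y * chart_divergence c X ?x"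
      using w c y by (simp add: chart_divergence_def)
    finally show ?thesis by (simp add: algebra_simps)
  qed
  have int: "set_integrable lborel ?S (\<lambda>y. \<Sum>i\<in>UNIV. frechet_derivative (?F i) (at y) (axis i 1))"
    using zero(1) unfolding set_integrable_def scaleR_sum_right by (intro Bochner_Integration.integrable_sum) auto
  show "integrable vol ?h"
  proof (rule integrable_vol_chart[OF c meas h_dom, THEN iffD2])
    have "set_integrable lborel ?S (\<lambda>y. ?w y * ?h (chart_inv c y)) \<longleftrightarrow>
        set_integrable lborel ?S (\<lambda>y. \<Sum>i\<in>UNIV. frechet_derivative (?F i) (at y) (axis i 1))"
      by (rule set_integrable_cong[OF refl refl eq])
    then show "set_integrable lborel ?S (\<lambda>y. ?w y * ?h (chart_inv c y))" using int by blast
  qed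
  have "(LINT x|vol. ?h x) = (LINT y:?S|lborel. \<Sum>i\<in>UNIV. frechet_derivative (?F i) (at y) (axis i 1))"
  proof (rule trans[OF integral_vol_chart[OF c meas h_dom]])
    show "(LINT y:?S|lborel. ?w y * ?h (chart_inv c y)) =
        (LINT y:?S|lborel. \<Sum>i\<in>UNIV. frechet_derivative (?F i) (at y) (axis i 1))"
      using open_chart(2)[OF c] eq by (intro set_lebesgue_integral_cong) auto
  qed
  also have "\<dots> = (\<Sum>i\<in>UNIV. LINT y:?S|lborel. frechet_derivative (?F i) (at y) (axis i 1))"
    using zero(1) unfolding set_integrable_def set_lebesgue_integral_def scaleR_sum_right
    by (intro Bochner_Integration.integral_sum) auto
  also have "\<dots> = 0" using zero(2) by simp
  finally show "(LINT x|vol. ?h x) = 0" .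
qed

text \<open>The coordinate expressions for the divergence in two charts agree because both are
  determined by the integration-by-parts identity tested against bump functions.\<close>

lemma chart_divergence_eq:
  assumes X: "C1_field X" and cd: "c \<in> A" "d \<in> A" "x \<in> chart_dom c" "x \<in> chart_dom d"
  shows "chart_divergence c X x = chart_divergence d X x"
proof (rule ccontr)
  \<comment> \<open>A bump function supported where \<open>\<delta>\<close> has the sign of \<open>\<delta> x\<close> gives a contradiction.\<close>
  define \<delta> where "\<delta> z = chart_divergence c X z - chart_divergence d X z" for z
  assume "chart_divergence c X x \<noteq> chart_divergence d X x"
  then have \<delta>x: "\<delta> x \<noteq> 0" by (simp add: \<delta>_def)
  let ?W = "chart_dom c \<inter> chart_dom d"
  have "continuous_on ?W \<delta>"
    unfolding \<delta>_def
    by (intro continuous_intros continuous_on_subset[OF continuous_on_chart_dom[OF cd(1) continuous_on_chart_divergence[OF X cd(1)]]]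
        continuous_on_subset[OF continuous_on_chart_dom[OF cd(2) continuous_on_chart_divergence[OF X cd(2)]]]) auto
  then have "continuous_on ?W (\<lambda>z. \<delta> z * \<delta> x)" by (intro continuous_intros)
  moreover have W: "open ?W" using open_chart(1)[OF cd(1)] open_chart(1)[OF cd(2)] by (rule open_Int)
  ultimately have "open (?W \<inter> (\<lambda>z. \<delta> z * \<delta> x) -` {0<..})"
    by (metis Int_commute continuous_on_open_vimage open_greaterThan)
  moreover define U where "U = ?W \<inter> (\<lambda>z. \<delta> z * \<delta> x) -` {0<..}"
  ultimately have U: "open U" "x \<in> U" "U \<subseteq> ?W" "\<And>z. z \<in> U \<Longrightarrow> \<delta> z * \<delta> x > 0"
    using \<delta>x cd by (auto simp: zero_less_mult_iff)
  obtain \<beta> K where \<beta>: "test_function A \<beta>" "compact K" "K \<subseteq> U" "\<And>z. \<beta> z \<ge> 0" "\<And>z. z \<notin> K \<Longrightarrow> \<beta> z = 0" "\<beta> x > 0"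
    using exists_test_function[OF U(1,2) cd(1,3)] by blast
  have C1: "C1_function \<beta>" using \<beta>(1) by (rule test_imp_C1)
  have Kc: "K \<subseteq> chart_dom c" "K \<subseteq> chart_dom d" using \<beta>(3) U(3) by auto
  let ?h = "\<lambda>e z. \<beta> z * chart_divergence e X z + derivation X \<beta> z"
  have int: "integrable vol (?h c)" "integrable vol (?h d)"
    using integrable_chart_divergence[OF cd(1) C1 X \<beta>(2) Kc(1) \<beta>(5)]
      integrable_chart_divergence[OF cd(2) C1 X \<beta>(2) Kc(2) \<beta>(5)] by auto
  let ?f = "\<lambda>z. \<beta> z * (\<delta> z * \<delta> x)"
  have f_eq: "?f = (\<lambda>z. (?h c z - ?h d z) * \<delta> x)" by (auto simp: \<delta>_def algebra_simps)
  have "(LINT z|vol. ?f z) = 0"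
  proof -
    have "(LINT z|vol. ?h c z - ?h d z) = 0"
      using Bochner_Integration.integral_diff[OF int]
        integral_chart_divergence[OF cd(1) C1 X \<beta>(2) Kc(1) \<beta>(5)]
        integral_chart_divergence[OF cd(2) C1 X \<beta>(2) Kc(2) \<beta>(5)] by simp
    then show ?thesis unfolding f_eq by (simp only: integral_mult_left_zero)
  qed
  moreover have "integrable vol ?f"
    unfolding f_eq by (intro integrable_mult_left Bochner_Integration.integrable_diff int)
  moreover have f_nn: "?f z \<ge> 0" for z
  proof (cases "z \<in> K")
    case True
    then have "\<delta> z * \<delta> x \<ge> 0" using U(4)[of z] \<beta>(3) by auto
    then show ?thesis using \<beta>(4)[of z] by (rule mult_nonneg_nonneg[rotated])
  qed (simp add: \<beta>(5))
  ultimately have "AE z in vol. ?f z = 0"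
    by (subst (asm) integral_nonneg_eq_0_iff_AE) auto
  moreover define P where "P = {z. \<beta> z > 0}"
  ultimately have "AE z in vol. z \<notin> P"
  proof (elim AE_mp, intro AE_I2 impI)
    fix z assume "?f z = 0"
    show "z \<notin> P"
    proof
      assume "z \<in> P"
      then have "\<beta> z > 0" "z \<in> K" using \<beta>(5)[of z] by (auto simp: P_def)
      then show False using \<open>?f z = 0\<close> U(4)[of z] \<beta>(3) by auto
    qed
  qed
  moreover have "open P"
    unfolding P_def using C1_continuous[OF C1] by (intro open_Collect_less continuous_on_const)
  ultimately have "P = {}" by (intro AE_vol_notin_open)
  then show False using \<beta>(6) by (auto simp: P_def)
qed

lemma divergence_chart:
  "C1_field X \<Longrightarrow> c \<in> A \<Longrightarrow> x \<in> chart_dom c \<Longrightarrow> divergence A g X x = chart_divergence c X x"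
  unfolding divergence_chart_at by (rule chart_divergence_eq) (use chart_at in auto)


section \<open>The divergence theorem for compactly supported test functions\<close>

lemma measurable_vol: "f \<in> measurable vol N \<longleftrightarrow> f \<in> measurable borel N"
  by (simp add: measurable_cong_sets[OF sets_vol refl])

lemma integrable_continuous_compact_support:
  fixes f :: "'a \<Rightarrow> real"
  assumes f: "continuous_on UNIV f" and K: "compact K" "\<And>x. x \<notin> K \<Longrightarrow> f x = 0"
  shows "integrable vol f"
proof -
  obtain B where "B \<ge> 0" and B: "\<And>x. \<bar>f x\<bar> \<le> B"
    by (rule continuous_compact_support_bounded[OF continuous_on_subset[OF f subset_UNIV] K(1)])
      (erule K(2), rule that)
  have "K \<in> sets borel" using K(1) by (simp add: compact_imp_closed borel_closed)
  then show ?thesis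
    using emeasure_vol_compact_finite[OF K(1)] B K(2) f
    by (intro integrableI_bounded_set[of K _ _ B]) (auto simp: measurable_vol intro: borel_measurable_continuous_onI)
qed

text \<open>Multiplication by the normalised bump functions of a finite cover of the support splits
  \<open>\<eta>\<close> into pieces that each live in one chart.\<close>

lemma chart_decomposition:
  assumes \<eta>: "C1_function \<eta>" and K: "compact K" "\<And>x. x \<notin> K \<Longrightarrow> \<eta> x = 0"
  obtains I :: "'a set" and \<zeta> :: "'a \<Rightarrow> 'a \<Rightarrow> real" and L :: "'a \<Rightarrow> 'a set"
  where "finite I" "\<And>i. i \<in> I \<Longrightarrow> C1_function (\<zeta> i)" "\<And>i. i \<in> I \<Longrightarrow> compact (L i)"
    "\<And>i. i \<in> I \<Longrightarrow> L i \<subseteq> chart_dom (chart_at A i)" "\<And>i x. i \<in> I \<Longrightarrow> x \<notin> L i \<Longrightarrow> \<zeta> i x = 0"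
    "\<eta> = (\<lambda>x. \<Sum>i\<in>I. \<zeta> i x)"
proof -
  have "\<exists>\<beta> L. test_function A \<beta> \<and> compact L \<and> L \<subseteq> chart_dom (chart_at A i) \<and>
      (\<forall>z. \<beta> z \<ge> 0) \<and> (\<forall>z. z \<notin> L \<longrightarrow> \<beta> z = 0) \<and> \<beta> i > 0" for i
  proof -
    from exists_test_function[OF open_UNIV UNIV_I chart_at, of i]
    obtain \<beta> L where "test_function A \<beta> \<and> compact L \<and> L \<subseteq> UNIV \<and> L \<subseteq> chart_dom (chart_at A i) \<and>
      (\<forall>z. \<beta> z \<ge> 0) \<and> (\<forall>z. z \<notin> L \<longrightarrow> \<beta> z = 0) \<and> \<beta> i > 0" by (elim exE)
    then show ?thesis by (intro exI[of _ \<beta>] exI[of _ L]) simp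
  qed
  then obtain \<beta> L where \<beta>: "\<And>i. test_function A (\<beta> i)" "\<And>i. compact (L i)"
      "\<And>i. L i \<subseteq> chart_dom (chart_at A i)" "\<And>i z. \<beta> i z \<ge> 0" "\<And>i z. z \<notin> L i \<Longrightarrow> \<beta> i z = 0" "\<And>i. \<beta> i i > 0"
    by metis
  have C1_\<beta>: "C1_function (\<beta> i)" for i using \<beta>(1) by (rule test_imp_C1)
  have op: "open {z. \<beta> i z > 0}" for i
    using C1_continuous[OF C1_\<beta>] by (intro open_Collect_less continuous_on_const)
  have cover: "K \<subseteq> (\<Union>i\<in>K. {z. \<beta> i z > 0})" using \<beta>(6) by blast
  obtain I where I: "I \<subseteq> K" "finite I" "K \<subseteq> (\<Union>i\<in>I. {z. \<beta> i z > 0})"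
    by (rule compactE_image[OF K(1) op cover]) (rule that)
  define S where "S z = (\<Sum>i\<in>I. \<beta> i z)" for z
  have C1_S: "C1_function S" unfolding S_def[abs_def] by (intro C1_sum C1_\<beta>)
  have S_pos: "S z > 0" if "z \<in> K" for z
  proof -
    obtain i where "i \<in> I" "\<beta> i z > 0" using I(3) \<open>z \<in> K\<close> by blast
    then show ?thesis unfolding S_def by (rule sum_pos2[OF I(2)]) (rule \<beta>(4))
  qed
  \<comment> \<open>Where \<open>S\<close> vanishes, \<open>\<eta>\<close> vanishes in a neighbourhood, so the case distinction does not
    destroy differentiability.\<close>
  define \<zeta> where "\<zeta> i z = (if S z > 0 then \<eta> z * \<beta> i z / S z else 0)" for i z
  have C1_\<zeta>: "C1_function (\<zeta> i)" for i
  proof (rule C1_I, rule Ck_on_locally)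
    fix c y assume c: "c \<in> A" and y: "y \<in> chart_ran c"
    show "\<exists>T. open T \<and> y \<in> T \<and> Ck_on (Suc 0) T (\<lambda>y. \<zeta> i (chart_inv c y))"
    proof (cases "S (chart_inv c y) > 0")
      case True
      let ?T = "chart_ran c \<inter> (\<lambda>y. S (chart_inv c y)) -` {0<..}"
      have T: "open ?T"
        using Ck_on_continuous[OF C1_D[OF C1_S c]] open_chart(2)[OF c]
        by (metis Int_commute continuous_on_open_vimage open_greaterThan)
      have sub: "Ck_on (Suc 0) ?T (\<lambda>y. f (chart_inv c y))" if "C1_function f" for f
        using C1_D[OF that c] by (rule Ck_on_subset) auto
      have "Ck_on (Suc 0) ?T (\<lambda>y. \<eta> (chart_inv c y) * \<beta> i (chart_inv c y) / S (chart_inv c y))"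
        using T by (intro Ck_on_divide Ck_on_mult sub \<eta> C1_\<beta> C1_S) auto
      then have "Ck_on (Suc 0) ?T (\<lambda>y. \<zeta> i (chart_inv c y))"
        by (rule Ck_on_cong[OF T, rotated]) (simp add: \<zeta>_def)
      then show ?thesis using T y True by blast
    next
      case False
      let ?T = "chart_map c ` (chart_dom c - K)"
      have T: "open ?T"
        using open_chart(1)[OF c] K(1) by (intro open_chart_image[OF c]) (auto intro: open_Diff compact_imp_closed)
      have "chart_inv c y \<notin> K" using False S_pos by blast
      then have yT: "y \<in> ?T" using y c by (metis DiffI chart_inverse(2) chart_inverse(4) image_eqI)
      have "Ck_on (Suc 0) ?T (\<lambda>y. \<zeta> i (chart_inv c y))"
        by (rule Ck_on_cong[OF T _ Ck_on_const[of _ _ 0]]) (use c K(2) in \<open>auto simp: \<zeta>_def\<close>)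
      then show ?thesis using T yT by blast
    qed
  qed
  have sum: "\<eta> z = (\<Sum>i\<in>I. \<zeta> i z)" for z
  proof (cases "S z > 0")
    case True
    have "(\<Sum>i\<in>I. \<zeta> i z) = \<eta> z * S z / S z"
      using True by (simp add: \<zeta>_def S_def sum_distrib_left sum_divide_distrib)
    then show ?thesis using True by simp
  next
    case False
    then have "z \<notin> K" using S_pos by blast
    then show ?thesis using False K(2) by (simp add: \<zeta>_def)
  qed
  show thesis
  proof (rule that[of I \<zeta> L])
    show "\<zeta> i x = 0" if "x \<notin> L i" for i x using \<beta>(5)[OF that] by (simp add: \<zeta>_def)
    show "\<eta> = (\<lambda>x. \<Sum>i\<in>I. \<zeta> i x)" using sum by (rule ext)
  qed (rule I(2) C1_\<zeta> \<beta>(2,3))+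
qed

theorem
  assumes X: "C1_field X" and \<eta>: "C1_function \<eta>" and K: "compact K" "\<And>x. x \<notin> K \<Longrightarrow> \<eta> x = 0"
  shows integrable_divergence: "integrable vol (\<lambda>x. \<eta> x * divergence A g X x + derivation X \<eta> x)"
    and integral_divergence: "(LINT x|vol. \<eta> x * divergence A g X x + derivation X \<eta> x) = 0"
proof -
  obtain I \<zeta> L where I: "finite I" and \<zeta>: "\<And>i. i \<in> I \<Longrightarrow> C1_function (\<zeta> i)"
    and L: "\<And>i. i \<in> I \<Longrightarrow> compact (L i)" "\<And>i. i \<in> I \<Longrightarrow> L i \<subseteq> chart_dom (chart_at A i)"
    and \<zeta>0: "\<And>i x. i \<in> I \<Longrightarrow> x \<notin> L i \<Longrightarrow> \<zeta> i x = 0" and sum: "\<eta> = (\<lambda>x. \<Sum>i\<in>I. \<zeta> i x)"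
    by (rule chart_decomposition[OF \<eta> K(1)]) (erule K(2), rule that)
  let ?h = "\<lambda>i x. \<zeta> i x * divergence A g X x + derivation X (\<zeta> i) x"
  have h: "?h i = (\<lambda>x. \<zeta> i x * chart_divergence (chart_at A i) X x + derivation X (\<zeta> i) x)" if i: "i \<in> I" for i
  proof
    fix x
    show "?h i x = \<zeta> i x * chart_divergence (chart_at A i) X x + derivation X (\<zeta> i) x"
      using divergence_chart[OF X chart_at(1), of x i] L(2)[OF i] \<zeta>0[OF i, of x] by (cases "x \<in> L i") auto
  qed
  have int: "integrable vol (?h i)" and zero: "(LINT x|vol. ?h i x) = 0" if i: "i \<in> I" for i
    unfolding h[OF i]
    using integrable_chart_divergence[OF chart_at(1) \<zeta>[OF i] X L(1)[OF i] L(2)[OF i] \<zeta>0[OF i]]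
      integral_chart_divergence[OF chart_at(1) \<zeta>[OF i] X L(1)[OF i] L(2)[OF i] \<zeta>0[OF i]] by blast+
  have eq: "(\<lambda>x. \<eta> x * divergence A g X x + derivation X \<eta> x) = (\<lambda>x. \<Sum>i\<in>I. ?h i x)"
  proof
    fix x
    have "differential (chart_at A x) (\<lambda>x. \<Sum>i\<in>I. \<zeta> i x) x = (\<Sum>i\<in>I. differential (chart_at A x) (\<zeta> i) x)"
      by (rule differential_sum[OF \<zeta> chart_at])
    then show "\<eta> x * divergence A g X x + derivation X \<eta> x = (\<Sum>i\<in>I. ?h i x)"
      unfolding sum derivation_def by (simp add: sum.distrib sum_distrib_right inner_sum_left)
  qed
  show "integrable vol (\<lambda>x. \<eta> x * divergence A g X x + derivation X \<eta> x)"
    unfolding eq by (rule Bochner_Integration.integrable_sum[OF int])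
  have "(LINT x|vol. (\<Sum>i\<in>I. ?h i x)) = (\<Sum>i\<in>I. (LINT x|vol. ?h i x))"
    by (rule Bochner_Integration.integral_sum[OF int])
  also have "\<dots> = 0" using zero by (rule sum.neutral[OF ballI])
  finally show "(LINT x|vol. \<eta> x * divergence A g X x + derivation X \<eta> x) = 0"
    unfolding eq .
qed

section \<open>The weighted inequality for test functions\<close>

lemma field_norm_grad_zero:
  assumes "compact K" "\<And>x. x \<notin> K \<Longrightarrow> f x = 0" "x \<notin> K"
  shows "field_norm A g (grad g f) x = 0"
proof -
  have "differential (chart_at A x) f x = 0"
    by (rule differential_off_support[OF assms chart_at])
  then have "grad g f (chart_at A x) x = 0"
    using pos_def_inj[OF metric_pos_def[OF chart_at], of x "grad g f (chart_at A x) x" 0]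
      metric_grad[OF chart_at] by simp
  then show ?thesis by (simp add: field_norm_def metric_norm_def Let_def)
qed

lemma continuous_on_grad_component:
  assumes f: "C1_function f" and c: "c \<in> A"
  shows "continuous_on (chart_ran c) (\<lambda>y. grad g f c (chart_inv c y) $ i)"
proof -
  have "Ck_on 0 (chart_ran c) (\<lambda>y. differential c f (chart_inv c y) $ i)" for i
    using continuous_on_differential[OF f c] by simp
  then have "Ck_on 0 (chart_ran c) (\<lambda>y. grad g f c (chart_inv c y) $ i)"
    by (rule Ck_on_grad[OF c])
  then show ?thesis by simp
qed

lemma continuous_on_grad:
  assumes f: "C1_function f" and c: "c \<in> A"
  shows "continuous_on (chart_dom c) (grad g f c)"
proof -
  have "continuous_on (chart_ran c) (\<lambda>y. \<chi> i. grad g f c (chart_inv c y) $ i)"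
    by (intro continuous_on_vec_lambda continuous_on_grad_component[OF f c])
  then show ?thesis by (intro continuous_on_chart_dom[OF c]) simp
qed

lemma continuous_field_norm_grad:
  assumes f: "C1_function f"
  shows "continuous_on UNIV (field_norm A g (grad g f))"
proof (rule continuous_of_charts, rule continuous_on_eq)
  fix c assume c: "c \<in> A"
  show "continuous_on (chart_ran c) (\<lambda>y. sqrt (\<Sum>i\<in>UNIV. grad g f c (chart_inv c y) $ i *
      differential c f (chart_inv c y) $ i))"
    by (intro continuous_on_real_sqrt continuous_on_sum continuous_on_mult
        continuous_on_grad_component[OF f c] continuous_on_differential[OF f c])
  fix y assume y: "y \<in> chart_ran c"
  show "sqrt (\<Sum>i\<in>UNIV. grad g f c (chart_inv c y) $ i * differential c f (chart_inv c y) $ i) =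
      field_norm A g (grad g f) (chart_inv c y)"
    using field_norm_chart[OF vector_field_grad[OF f] c chart_inverse(4)[OF c y]]
      metric_grad[OF c chart_inverse(4)[OF c y], of f] by (simp add: inner_vec_def)
qed

lemma test_function_support:
  assumes "test_function A \<phi>"
  obtains K where "compact K" "\<And>x. x \<notin> K \<Longrightarrow> \<phi> x = 0"
proof (rule that)
  show "compact (closure {x. \<phi> x \<noteq> 0})" using assms by (simp add: test_function_def)
  show "\<phi> x = 0" if x: "x \<notin> closure {x. \<phi> x \<noteq> 0}" for x
    using x closure_subset[of "{x. \<phi> x \<noteq> 0}"] by (metis (mono_tags, lifting) mem_Collect_eq subsetD)
qed

lemma continuous_on_abs_powr:
  "p > 0 \<Longrightarrow> continuous_on S f \<Longrightarrow> continuous_on S (\<lambda>x. \<bar>f x :: real\<bar> powr p)"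
  by (intro continuous_on_powr' continuous_intros) auto

lemma integrable_test_function:
  assumes \<phi>: "test_function A \<phi>" and p: "p > 0" and w: "continuous_on UNIV w"
  shows "integrable vol (\<lambda>x. w x * \<bar>\<phi> x\<bar> powr p)"
    and "integrable vol (\<lambda>x. w x * field_norm A g (grad g \<phi>) x powr p)"
proof -
  obtain K where K: "compact K" "\<And>x. x \<notin> K \<Longrightarrow> \<phi> x = 0" 
    by (rule test_function_support[OF \<phi>]) (rule that)
  have C1: "C1_function \<phi>" by (rule test_imp_C1[OF \<phi>])
  have "continuous_on UNIV (\<lambda>x. w x * \<bar>\<phi> x\<bar> powr p)"
    by (rule continuous_on_mult[OF w continuous_on_abs_powr[OF p C1_continuous[OF C1]]])
  then show "integrable vol (\<lambda>x. w x * \<bar>\<phi> x\<bar> powr p)"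
    by (rule integrable_continuous_compact_support[OF _ K(1)]) (simp add: K(2))
  have "continuous_on UNIV (\<lambda>x. w x * \<bar>field_norm A g (grad g \<phi>) x\<bar> powr p)"
    by (rule continuous_on_mult[OF w continuous_on_abs_powr[OF p continuous_field_norm_grad[OF C1]]])
  then show "integrable vol (\<lambda>x. w x * field_norm A g (grad g \<phi>) x powr p)"
    using field_norm_grad_zero[OF K]
    by (intro integrable_continuous_compact_support[OF _ K(1)]) (auto simp: field_norm_nonneg)
qed

text \<open>Testing \<open>\<Delta>\<^sub>p u \<ge> k\<close> with \<open>\<bar>\<phi>\<bar>\<^sup>p exp ((p - 1) u)\<close>.  Differentiating the exponential
  produces \<open>(p - 1) \<bar>\<phi>\<bar>\<^sup>p \<bar>\<nabla>u\<bar>\<^sup>p\<close>, which by Young's inequality absorbs the part of the mixed term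
  \<open>p \<bar>\<phi>\<bar>\<^sup>p\<^sup>-\<^sup>1 \<bar>\<nabla>\<phi>\<bar> \<bar>\<nabla>u\<bar>\<^sup>p\<^sup>-\<^sup>1\<close> that contains the gradient of \<open>u\<close>; the exponent \<open>p - 1\<close> is the
  one that makes the two match.\<close>

lemma test_function_inequality:
  assumes p: "p \<ge> 2" and u: "smooth_function A u" and k: "\<And>x. p_laplacian A g p u x \<ge> k"
    and \<phi>: "test_function A \<phi>"
  shows "k * (LINT x|vol. exp ((p - 1) * u x) * \<bar>\<phi> x\<bar> powr p) \<le>
    (LINT x|vol. exp ((p - 1) * u x) * field_norm A g (grad g \<phi>) x powr p)"
proof -
  obtain K where K: "compact K" "\<And>x. x \<notin> K \<Longrightarrow> \<phi> x = 0" 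
    by (rule test_function_support[OF \<phi>]) (rule that)
  let ?E = "\<lambda>x. exp ((p - 1) * u x)" and ?X = "flux p u"
  let ?\<eta> = "\<lambda>x. \<bar>\<phi> x\<bar> powr p * ?E x"
  let ?N = "field_norm A g (grad g u)" and ?F = "field_norm A g (grad g \<phi>)"
  have p1: "p > 1" using p by simp
  have C1u: "C1_function u" by (rule smooth_imp_C1[OF u])
  have C1\<phi>: "C1_function \<phi>" by (rule test_imp_C1[OF \<phi>])
  have C1E: "C1_function ?E"
  proof (rule C1_compose[OF C1u])
    show "Ck_on (Suc 0) UNIV (\<lambda>t. exp ((p - 1) * t))"
      by (rule Ck_on_compose[OF open_UNIV open_UNIV _ _ Ck_on_exp])
        (auto intro!: Ck_on_mult Ck_on_const Ck_on_id)
  qed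
  have C1P: "C1_function (\<lambda>x. \<bar>\<phi> x\<bar> powr p)" by (rule C1_compose[OF C1\<phi> Ck_on_abs_powr[OF p1]])
  have C1\<eta>: "C1_function ?\<eta>" by (rule C1_mult[OF C1P C1E])
  have X: "C1_field ?X" by (rule C1_field_flux[OF p u])
  have \<eta>0: "?\<eta> x = 0" if "x \<notin> K" for x using K(2)[OF that] by simp
  have lap: "divergence A g ?X x = p_laplacian A g p u x" for x
    by (simp add: p_laplacian_def flux_def[abs_def])
  have contE: "continuous_on UNIV ?E" by (rule C1_continuous[OF C1E])
  have p0: "p > 0" using p by simp
  note int = integrable_test_function[OF \<phi> p0 contE]
  have pointwise: "?E x * (k * \<bar>\<phi> x\<bar> powr p - ?F x powr p) \<le> ?\<eta> x * divergence A g ?X x + derivation ?X ?\<eta> x" for x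
  proof -
    let ?c = "chart_at A x"
    define e where "e = ?E x"
    define s where "s = \<bar>\<phi> x\<bar>"
    define N where "N = ?N x"
    define F where "F = ?F x"
    have nn: "e > 0" "s \<ge> 0" "N \<ge> 0" "F \<ge> 0"
      by (auto simp: e_def s_def N_def F_def field_norm_nonneg)
    have dE: "differential ?c ?E x = (e * (p - 1)) *\<^sub>R differential ?c u x"
      unfolding e_def by (rule differential_compose[OF C1u chart_at]) (auto intro!: derivative_eq_intros)
    have dP: "differential ?c (\<lambda>x. \<bar>\<phi> x\<bar> powr p) x = (p * s powr (p - 1) * sgn (\<phi> x)) *\<^sub>R differential ?c \<phi> x"
      unfolding s_def by (rule differential_compose[OF C1\<phi> chart_at has_real_derivative_abs_powr[OF p1]])
    have d\<eta>: "derivation ?X ?\<eta> x = s powr p * (e * (p - 1)) * derivation ?X u x +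
        e * (p * s powr (p - 1) * sgn (\<phi> x)) * derivation ?X \<phi> x"
      unfolding derivation_def differential_mult[OF C1P C1E chart_at] dE dP
      by (simp add: inner_add_left s_def e_def)
    have Xu: "derivation ?X u x = N powr p"
    proof -
      have "derivation ?X u x = N powr (p - 2) * N\<^sup>2"
        by (simp add: derivation_flux derivation_grad N_def)
      also have "\<dots> = N powr p"
        using nn(3) by (cases "N = 0") (auto simp: powr_diff powr_numeral)
      finally show ?thesis .
    qed
    have X\<phi>: "\<bar>derivation ?X \<phi> x\<bar> \<le> N powr (p - 1) * F"
    proof -
      have "\<bar>derivation ?X \<phi> x\<bar> \<le> N powr (p - 2) * (F * N)"
        using derivation_le[of u \<phi> x] unfolding derivation_flux abs_mult N_def F_def
        by (intro mult_mono) auto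
      also have "\<dots> = N powr (p - 1) * F"
        using nn(3) by (cases "N = 0") (auto simp: powr_diff power2_eq_square)
      finally show ?thesis .
    qed
    have "\<bar>s powr (p - 1) * sgn (\<phi> x) * derivation ?X \<phi> x\<bar> \<le> s powr (p - 1) * (N powr (p - 1) * F)"
    proof -
      have "\<bar>s powr (p - 1) * sgn (\<phi> x) * derivation ?X \<phi> x\<bar> = (s powr (p - 1) * \<bar>sgn (\<phi> x)\<bar>) * \<bar>derivation ?X \<phi> x\<bar>"
        by (simp add: abs_mult)
      also have "\<dots> \<le> (s powr (p - 1) * 1) * (N powr (p - 1) * F)"
        using X\<phi> by (intro mult_mono) (auto simp: abs_sgn_eq)
      finally show ?thesis by simp
    qed
    moreover have "s powr (p - 1) * (N powr (p - 1) * F) = (s * N) powr (p - 1) * F"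
      using nn by (simp add: powr_mult)
    ultimately have "- ((s * N) powr (p - 1) * F) \<le> s powr (p - 1) * sgn (\<phi> x) * derivation ?X \<phi> x"
      by linarith
    then have mixed: "p * (s powr (p - 1) * sgn (\<phi> x) * derivation ?X \<phi> x) \<ge> - (p * ((s * N) powr (p - 1) * F))"
      using mult_left_mono[of "- ((s * N) powr (p - 1) * F)" _ p] p0 by simp
    have young: "p * ((s * N) powr (p - 1) * F) \<le> (p - 1) * (s powr p * N powr p) + F powr p"
      using Young_weighted[OF p1, of "s * N" F] nn by (simp add: powr_mult)
    have "e * (k * s powr p - F powr p) \<le> e * (s powr p * divergence A g ?X x +
        ((p - 1) * (s powr p * N powr p) + p * (s powr (p - 1) * sgn (\<phi> x) * derivation ?X \<phi> x)))"
    proof (rule mult_left_mono)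
      have "s powr p * k \<le> s powr p * divergence A g ?X x"
        using k[of x] unfolding lap by (intro mult_left_mono) auto
      then show "k * s powr p - F powr p \<le> s powr p * divergence A g ?X x +
          ((p - 1) * (s powr p * N powr p) + p * (s powr (p - 1) * sgn (\<phi> x) * derivation ?X \<phi> x))"
        using mixed young by (simp add: mult.commute)
    qed (use nn in simp)
    also have "\<dots> = ?\<eta> x * divergence A g ?X x + derivation ?X ?\<eta> x"
      unfolding d\<eta> Xu by (simp add: s_def e_def algebra_simps)
    finally show ?thesis by (simp add: e_def s_def F_def)
  qed
  have split: "?E x * (k * \<bar>\<phi> x\<bar> powr p - ?F x powr p) = k * (?E x * \<bar>\<phi> x\<bar> powr p) - ?E x * ?F x powr p" for x
    by (simp add: algebra_simps)
  have "integrable vol (\<lambda>x. ?E x * (k * \<bar>\<phi> x\<bar> powr p - ?F x powr p))"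
    unfolding split using int by (intro Bochner_Integration.integrable_diff integrable_mult_right)
  from integral_mono[OF this integrable_divergence[OF X C1\<eta> K(1) \<eta>0] pointwise]
  have "(LINT x|vol. ?E x * (k * \<bar>\<phi> x\<bar> powr p - ?F x powr p)) \<le> 0"
    using integral_divergence[OF X C1\<eta> K(1) \<eta>0] by simp
  moreover have "(LINT x|vol. ?E x * (k * \<bar>\<phi> x\<bar> powr p - ?F x powr p)) =
      k * (LINT x|vol. ?E x * \<bar>\<phi> x\<bar> powr p) - (LINT x|vol. ?E x * ?F x powr p)"
    unfolding split using int by (subst Bochner_Integration.integral_diff) auto
  ultimately show ?thesis by simp
qed

text \<open>The weight \<open>exp ((p - 1) u)\<close> is removed at the cost of the ratio \<open>exp (2 (p - 1) M)\<close> of its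
  largest to its smallest possible value.\<close>

lemma test_function_Poincare:
  assumes p: "p \<ge> 2" and u: "smooth_function A u" and k: "k > 0" "\<And>x. p_laplacian A g p u x \<ge> k"
    and M: "\<And>x. \<bar>u x\<bar> \<le> M" and \<phi>: "test_function A \<phi>"
  shows "(LINT x|vol. \<bar>\<phi> x\<bar> powr p) \<le>
    exp (2 * (p - 1) * M) / k * (LINT x|vol. field_norm A g (grad g \<phi>) x powr p)"
proof -
  let ?E = "\<lambda>x. exp ((p - 1) * u x)" and ?F = "field_norm A g (grad g \<phi>)"
  let ?a = "(p - 1) * M"
  have p0: "p > 0" using p by simp
  have C1u: "C1_function u" by (rule smooth_imp_C1[OF u])
  have contE: "continuous_on UNIV ?E"
    by (intro continuous_intros C1_continuous[OF C1u])
  have int1: "integrable vol (\<lambda>x. \<bar>\<phi> x\<bar> powr p)" "integrable vol (\<lambda>x. ?F x powr p)"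
    using integrable_test_function[OF \<phi> p0 continuous_on_const[of _ 1]] by simp_all
  note intE = integrable_test_function[OF \<phi> p0 contE]
  have E: "exp (- ?a) \<le> ?E x" "?E x \<le> exp ?a" for x
  proof -
    have "(p - 1) * \<bar>u x\<bar> \<le> ?a" using M[of x] p by (intro mult_left_mono) auto
    moreover have "\<bar>(p - 1) * u x\<bar> = (p - 1) * \<bar>u x\<bar>" using p by (simp add: abs_mult)
    ultimately have "\<bar>(p - 1) * u x\<bar> \<le> ?a" by simp
    then show "exp (- ?a) \<le> ?E x" "?E x \<le> exp ?a" by (simp_all add: abs_le_iff)
  qed
  have "k * (exp (- ?a) * (LINT x|vol. \<bar>\<phi> x\<bar> powr p)) = k * (LINT x|vol. exp (- ?a) * \<bar>\<phi> x\<bar> powr p)"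
    by simp
  also have "\<dots> \<le> k * (LINT x|vol. ?E x * \<bar>\<phi> x\<bar> powr p)"
    using k(1) E(1) int1 intE by (intro mult_left_mono integral_mono mult_right_mono) auto
  also have "\<dots> \<le> (LINT x|vol. ?E x * ?F x powr p)"
    by (rule test_function_inequality[OF p u k(2) \<phi>])
  also have "\<dots> \<le> (LINT x|vol. exp ?a * ?F x powr p)"
    using E(2) int1 intE by (intro integral_mono mult_right_mono) auto
  also have "\<dots> = exp ?a * (LINT x|vol. ?F x powr p)" by simp
  finally have "exp (- ?a) * (LINT x|vol. \<bar>\<phi> x\<bar> powr p) \<le> exp ?a * (LINT x|vol. ?F x powr p) / k"
    using k(1) by (simp add: field_simps)
  then have "exp ?a * (exp (- ?a) * (LINT x|vol. \<bar>\<phi> x\<bar> powr p)) \<le> exp ?a * (exp ?a * (LINT x|vol. ?F x powr p) / k)"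
    by (intro mult_left_mono) auto
  moreover have "exp ?a * (exp (- ?a) * I) = I" for I by (simp add: exp_minus)
  moreover have "exp (2 * (p - 1) * M) = exp ?a * exp ?a" by (simp add: mult_exp_exp algebra_simps)
  ultimately show ?thesis by simp
qed

section \<open>Passage to the Sobolev space\<close>


lemma field_norm_diff_le: "field_norm A g (\<lambda>c x. X c x - Y c x) x \<le> field_norm A g X x + field_norm A g Y x"
  using pos_def_triangle[OF metric_pos_def[OF chart_at]] by (simp add: field_norm_def metric_norm_def Let_def)

lemma vector_field_diff:
  assumes "vector_field A X" "vector_field A Y"
  shows "vector_field A (\<lambda>c x. X c x - Y c x)"
  unfolding vector_field_def
proof (intro ballI)
  fix c d x assume cdx: "c \<in> A" "d \<in> A" "x \<in> chart_dom c \<inter> chart_dom d"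
  have "X d x = transition_jacobian c d x *v X c x" "Y d x = transition_jacobian c d x *v Y c x"
    using assms cdx unfolding vector_field_def by blast+
  then show "X d x - Y d x = transition_jacobian c d x *v (X c x - Y c x)"
    by (simp add: matrix_vector_mult_diff_distrib)
qed

text \<open>The chart in which the norm is evaluated at a point is an arbitrary choice, which need not
  depend measurably on the point.  Measurability is therefore checked on each domain of a
  countable subatlas, where a fixed chart gives the same value.\<close>

lemma measurable_field_norm:
  assumes X: "vector_field A X" "\<And>c. c \<in> A \<Longrightarrow> X c \<in> borel_measurable (restrict_space borel (chart_dom c))"
  shows "field_norm A g X \<in> borel_measurable borel"
proof -
  obtain C where C: "countable C" "C \<subseteq> A" "(\<Union>c\<in>C. chart_dom c) = UNIV"
    using countable_subatlas by blast
  show ?thesis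
  proof (rule measurable_piecewise_restrict)
    show "countable (chart_dom ` C)" using C(1) by simp
    show "space borel \<subseteq> \<Union> (chart_dom ` C)" using C(3) by simp
    fix W assume "W \<in> chart_dom ` C"
    then obtain c where c: "c \<in> A" "W = chart_dom c" using C(2) by blast
    show "W \<inter> space borel \<in> sets borel" using open_chart(1)[OF c(1)] c(2) by simp
    let ?R = "restrict_space borel W"
    have comp: "(\<lambda>x. X c x $ i) \<in> borel_measurable ?R" for i
    proof -
      have "(\<lambda>x. X c x \<bullet> axis i 1) \<in> borel_measurable ?R"
        using X(2)[OF c(1)] c(2) by (intro borel_measurable_inner) auto
      then show ?thesis by (simp add: inner_axis)
    qed
    have met: "(\<lambda>x. g c x $ i $ j) \<in> borel_measurable ?R" for i j
      unfolding c(2)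
      by (rule borel_measurable_continuous_on_restrict[OF continuous_on_chart_dom[OF c(1)
          Ck_on_continuous[OF Ck_on_metric[OF c(1), of 0]]]])
    have "(\<lambda>x. sqrt (\<Sum>i\<in>UNIV. X c x $ i * (\<Sum>j\<in>UNIV. g c x $ i $ j * X c x $ j))) \<in> borel_measurable ?R"
      using comp met by measurable
    moreover have "field_norm A g X x = sqrt (\<Sum>i\<in>UNIV. X c x $ i * (\<Sum>j\<in>UNIV. g c x $ i $ j * X c x $ j))"
      if x: "x \<in> space ?R" for x
    proof -
      have "x \<in> chart_dom c" using x c(2) by (simp add: space_restrict_space)
      then show ?thesis
        using field_norm_chart[OF X(1) c(1)] by (simp add: inner_vec_def matrix_vector_mult_def)
    qed
    ultimately show "field_norm A g X \<in> borel_measurable ?R"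
      by (subst measurable_cong)
  qed
qed

text \<open>The classical gradient is a weak gradient by integration by parts in the charts, and the
  constant sequence approximates.  This makes the infimum defining the first eigenvalue range
  over a nonempty set.\<close>

lemma test_function_sobolev0:
  assumes \<phi>: "test_function A \<phi>" and p: "p > 0"
  shows "(\<phi>, grad g \<phi>) \<in> sobolev0 A g p"
proof -
  have C1: "C1_function \<phi>" by (rule test_imp_C1[OF \<phi>])
  have weak: "weak_gradient A g \<phi> (grad g \<phi>)"
    unfolding weak_gradient_def
  proof (intro conjI ballI allI impI)
    show "vector_field A (grad g \<phi>)" by (rule vector_field_grad[OF C1])
    show "grad g \<phi> c \<in> borel_measurable (restrict_space borel (chart_dom c))" if "c \<in> A" for c
      by (rule borel_measurable_continuous_on_restrict[OF continuous_on_grad[OF C1 that]])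
    fix c i and \<psi> :: "real^'n \<Rightarrow> real"
    assume c: "c \<in> A" and \<psi>: "smooth_on UNIV \<psi> \<and> compact (closure {y. \<psi> y \<noteq> 0}) \<and>
        closure {y. \<psi> y \<noteq> 0} \<subseteq> chart_ran c"
    let ?K = "closure {y. \<psi> y \<noteq> 0}" and ?S = "chart_ran c" and ?\<phi> = "\<lambda>y. \<phi> (chart_inv c y)"
    have K: "compact ?K" "?K \<subseteq> ?S" using \<psi> by auto
    have \<psi>0: "\<psi> y = 0" if "y \<notin> ?K" for y
      using that closure_subset[of "{y. \<psi> y \<noteq> 0}"] by (metis (mono_tags, lifting) mem_Collect_eq subsetD)
    have C\<psi>: "Ck_on (Suc 0) ?S \<psi>"
      using \<psi> Ck_on_subset[OF smooth_on_Ck] by blast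
    note C\<phi> = C1_D[OF C1 c]
    note S = open_chart(2)[OF c]
    have D\<psi>0: "partial_deriv i \<psi> y = 0" if y: "y \<notin> ?K" for y
    proof -
      have "frechet_derivative \<psi> (at y) = (\<lambda>v. 0)"
      proof (rule frechet_derivative_eq_0[of "- ?K" y \<psi> 0])
        show "open (- ?K)" by (rule open_Compl[OF closed_closure])
        show "y \<in> - ?K" using y by simp
        show "\<psi> z = 0" if "z \<in> - ?K" for z using \<psi>0[of z] that by simp
      qed
      then show ?thesis by (simp add: partial_deriv_def)
    qed
    have cont\<psi>: "continuous_on ?S (partial_deriv i \<psi>)" and cont\<phi>: "continuous_on ?S (partial_deriv i ?\<phi>)"
      using Ck_on_SucD(2)[OF C\<psi>] Ck_on_SucD(2)[OF C\<phi>] by (simp_all add: partial_deriv_def[abs_def])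
    have int1: "set_integrable lborel ?S (\<lambda>y. ?\<phi> y * partial_deriv i \<psi> y)"
    proof (rule set_integrable_compact_support[OF _ K])
      show "continuous_on ?S (\<lambda>y. ?\<phi> y * partial_deriv i \<psi> y)"
        by (rule continuous_on_mult[OF Ck_on_continuous[OF C\<phi>] cont\<psi>])
      show "?\<phi> y * partial_deriv i \<psi> y = 0" if "y \<notin> ?K" for y
        by (simp only: D\<psi>0[OF that] mult_zero_right)
    qed
    have int2: "set_integrable lborel ?S (\<lambda>y. partial_deriv i ?\<phi> y * \<psi> y)"
    proof (rule set_integrable_compact_support[OF _ K])
      show "continuous_on ?S (\<lambda>y. partial_deriv i ?\<phi> y * \<psi> y)"
        by (rule continuous_on_mult[OF cont\<phi> Ck_on_continuous[OF C\<psi>]])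
      show "partial_deriv i ?\<phi> y * \<psi> y = 0" if "y \<notin> ?K" for y
        by (simp only: \<psi>0[OF that] mult_zero_right)
    qed
    have der: "frechet_derivative (\<lambda>y. ?\<phi> y * \<psi> y) (at y) (axis i 1) =
        ?\<phi> y * partial_deriv i \<psi> y + partial_deriv i ?\<phi> y * \<psi> y" if y: "y \<in> ?S" for y
      unfolding partial_deriv_def
      by (rule fun_cong[OF frechet_derivative_at[OF has_derivative_mult[OF
          Ck_on_SucD(1)[OF C\<phi> y] Ck_on_SucD(1)[OF C\<psi> y]], symmetric]])
    have "(LINT y:?S|lborel. frechet_derivative (\<lambda>y. ?\<phi> y * \<psi> y) (at y) (axis i 1)) = 0"
    proof (rule set_integral_derivative_eq_0(2)[OF S Ck_on_mult[OF S C\<phi> C\<psi>] K])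
      show "?\<phi> y * \<psi> y = 0" if "y \<notin> ?K" for y
        by (simp only: \<psi>0[OF that] mult_zero_right)
    qed
    moreover have "(LINT y:?S|lborel. frechet_derivative (\<lambda>y. ?\<phi> y * \<psi> y) (at y) (axis i 1)) =
        (LINT y:?S|lborel. ?\<phi> y * partial_deriv i \<psi> y + partial_deriv i ?\<phi> y * \<psi> y)"
      using S der by (intro set_lebesgue_integral_cong) auto
    moreover have "\<dots> = (LINT y:?S|lborel. ?\<phi> y * partial_deriv i \<psi> y) + (LINT y:?S|lborel. partial_deriv i ?\<phi> y * \<psi> y)"
      by (rule set_integral_add(2)[OF int1 int2])
    moreover have "(LINT y:?S|lborel. partial_deriv i ?\<phi> y * \<psi> y) =
        (LINT y:?S|lborel. (g c (chart_inv c y) *v grad g \<phi> c (chart_inv c y)) $ i * \<psi> y)"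
      using S c by (intro set_lebesgue_integral_cong)
        (auto simp: metric_grad differential_def o_def simp del: split_paired_All)
    ultimately show "(LINT y:?S|lborel. ?\<phi> y * partial_deriv i \<psi> y) =
        - (LINT y:?S|lborel. (g c (chart_inv c y) *v grad g \<phi> c (chart_inv c y)) $ i * \<psi> y)"
      by linarith
  qed
  have "integrable vol (\<lambda>x. \<bar>\<phi> x\<bar> powr p)" "integrable vol (\<lambda>x. field_norm A g (grad g \<phi>) x powr p)"
    using integrable_test_function[OF \<phi> p continuous_on_const[of _ 1]] by simp_all
  then have sob: "(\<phi>, grad g \<phi>) \<in> sobolev A g p"
    using weak C1_continuous[OF C1] by (simp add: sobolev_def borel_measurable_continuous_onI)
  have zero: "sobolev_norm A g p (\<lambda>x. \<phi> x - \<phi> x) (\<lambda>c x. grad g \<phi> c x - grad g \<phi> c x) = 0"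
    by (simp add: sobolev_norm_def field_norm_def metric_norm_def Let_def)
  have "\<exists>\<phi>' :: nat \<Rightarrow> 'a \<Rightarrow> real. (\<forall>k. test_function A (\<phi>' k)) \<and>
      (\<lambda>k. sobolev_norm A g p (\<lambda>x. \<phi> x - \<phi>' k x) (\<lambda>c x. grad g \<phi> c x - grad g (\<phi>' k) c x)) \<longlonglongrightarrow> 0"
    by (rule exI[of _ "\<lambda>k. \<phi>"]) (simp only: \<phi> zero, simp)
  then show ?thesis using sob by (simp add: sobolev0_def)
qed

lemma exists_nonzero_sobolev0:
  assumes "p > 0"
  shows "\<exists>f X. (f, X) \<in> sobolev0 A g p \<and> \<not> (AE x in vol. f x = 0)"
proof -
  fix x0 :: 'a
  obtain \<beta> K where \<beta>: "test_function A \<beta>" "\<beta> x0 > 0"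
    using exists_test_function[OF open_UNIV UNIV_I chart_at, of x0] by (elim exE conjE) (rule that)
  define P where "P = {x. \<beta> x > 0}"
  have P: "open P" "P \<noteq> {}"
    using C1_continuous[OF test_imp_C1[OF \<beta>(1)]] \<beta>(2)
    by (auto simp: P_def intro!: open_Collect_less continuous_on_const)
  have "\<not> (AE x in vol. \<beta> x = 0)"
  proof
    assume "AE x in vol. \<beta> x = 0"
    then have "AE x in vol. x \<notin> P" by (rule AE_mp) (simp add: P_def)
    then show False using AE_vol_notin_open[OF P(1)] P(2) by blast
  qed
  then show ?thesis using test_function_sobolev0[OF \<beta>(1) assms] by blast
qed

text \<open>The Poincare inequality survives the limit, with a worse constant because
  \<open>(a + b)\<^sup>p \<le> 2\<^sup>p (a\<^sup>p + b\<^sup>p)\<close> is used instead of Minkowski's inequality; only positivity of the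
  constant matters.\<close>

lemma sobolev0_Poincare:
  assumes p: "p > 0" and C: "C \<ge> 0"
    and test: "\<And>\<phi>. test_function A \<phi> \<Longrightarrow>
      (LINT x|vol. \<bar>\<phi> x\<bar> powr p) \<le> C * (LINT x|vol. field_norm A g (grad g \<phi>) x powr p)"
    and fX: "(f, X) \<in> sobolev0 A g p"
  shows "(LINT x|vol. \<bar>f x\<bar> powr p) \<le> 2 powr p * (2 powr p * C) * (LINT x|vol. field_norm A g X x powr p)"
proof -
  let ?N = "field_norm A g" and ?t = "2 powr p :: real"
  define B where "B = (LINT x|vol. ?N X x powr p)"
  have sob: "(f, X) \<in> sobolev A g p" using fX by (simp add: sobolev0_def)
  have f_meas: "f \<in> borel_measurable borel" and weak: "weak_gradient A g f X"
    and int_f: "integrable vol (\<lambda>x. \<bar>f x\<bar> powr p)" and int_X: "integrable vol (\<lambda>x. ?N X x powr p)"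
    using sob by (simp_all add: sobolev_def)
  have X_vf: "vector_field A X" and X_meas: "\<And>c. c \<in> A \<Longrightarrow> X c \<in> borel_measurable (restrict_space borel (chart_dom c))"
    using weak unfolding weak_gradient_def by blast+
  obtain \<phi> :: "nat \<Rightarrow> 'a \<Rightarrow> real" where \<phi>: "\<And>k. test_function A (\<phi> k)"
    and lim: "(\<lambda>k. sobolev_norm A g p (\<lambda>x. f x - \<phi> k x) (\<lambda>c x. X c x - grad g (\<phi> k) c x)) \<longlonglongrightarrow> 0"
    using fX unfolding sobolev0_def by blast
  define S1 where "S1 k = (LINT x|vol. \<bar>f x - \<phi> k x\<bar> powr p)" for k
  define S2 where "S2 k = (LINT x|vol. ?N (\<lambda>c x. X c x - grad g (\<phi> k) c x) x powr p)" for k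
  define S where "S k = S1 k + S2 k" for k
  have S_nn: "S1 k \<ge> 0" "S2 k \<ge> 0" for k
    by (simp_all add: S1_def S2_def)
  have S_eq: "S k = sobolev_norm A g p (\<lambda>x. f x - \<phi> k x) (\<lambda>c x. X c x - grad g (\<phi> k) c x) powr p" for k
    using S_nn[of k] p by (simp add: sobolev_norm_def S_def S1_def S2_def powr_powr)
  have S_lim: "S \<longlonglongrightarrow> 0"
    unfolding S_eq[abs_def]
    by (rule tendsto_zero_powrI[OF lim tendsto_const]) (use p in \<open>simp_all add: sobolev_norm_def\<close>)
  have bound: "(LINT x|vol. \<bar>f x\<bar> powr p) \<le> ?t * (S k + C * (?t * (S k + B)))" for k
  proof -
    have C1: "C1_function (\<phi> k)" by (rule test_imp_C1[OF \<phi>])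
    let ?Y = "\<lambda>c x. X c x - grad g (\<phi> k) c x"
    have int_\<phi>: "integrable vol (\<lambda>x. \<bar>\<phi> k x\<bar> powr p)" "integrable vol (\<lambda>x. ?N (grad g (\<phi> k)) x powr p)"
      using integrable_test_function[OF \<phi> p continuous_on_const[of _ 1]] by simp_all
    have \<phi>_meas: "\<phi> k \<in> borel_measurable borel"
      using C1_continuous[OF C1] by (rule borel_measurable_continuous_onI)
    have int_d: "integrable vol (\<lambda>x. \<bar>f x - \<phi> k x\<bar> powr p)"
    proof (rule Bochner_Integration.integrable_bound)
      show "integrable vol (\<lambda>x. ?t * (\<bar>f x\<bar> powr p + \<bar>\<phi> k x\<bar> powr p))"
        by (intro integrable_mult_right Bochner_Integration.integrable_add int_f int_\<phi>)
      show "(\<lambda>x. \<bar>f x - \<phi> k x\<bar> powr p) \<in> borel_measurable vol"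
        unfolding measurable_vol using f_meas \<phi>_meas by measurable
      have "\<bar>f x - \<phi> k x\<bar> powr p \<le> ?t * (\<bar>f x\<bar> powr p + \<bar>\<phi> k x\<bar> powr p)" for x
        by (rule powr_add_le) (use p in auto)
      then show "AE x in vol. norm (\<bar>f x - \<phi> k x\<bar> powr p) \<le> norm (?t * (\<bar>f x\<bar> powr p + \<bar>\<phi> k x\<bar> powr p))"
        by (intro AE_I2) (simp add: abs_mult)
    qed
    have Y_meas: "?N ?Y \<in> borel_measurable borel"
    proof (rule measurable_field_norm[OF vector_field_diff[OF X_vf vector_field_grad[OF C1]]])
      show "?Y c \<in> borel_measurable (restrict_space borel (chart_dom c))" if c: "c \<in> A" for c
        by (rule borel_measurable_diff[OF X_meas[OF c]
            borel_measurable_continuous_on_restrict[OF continuous_on_grad[OF C1 c]]])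
    qed
    have int_Y: "integrable vol (\<lambda>x. ?N ?Y x powr p)"
    proof (rule Bochner_Integration.integrable_bound)
      show "integrable vol (\<lambda>x. ?t * (?N X x powr p + ?N (grad g (\<phi> k)) x powr p))"
        by (intro integrable_mult_right Bochner_Integration.integrable_add int_X int_\<phi>)
      show "(\<lambda>x. ?N ?Y x powr p) \<in> borel_measurable vol"
        unfolding measurable_vol using Y_meas by measurable
      have "?N ?Y x powr p \<le> ?t * (?N X x powr p + ?N (grad g (\<phi> k)) x powr p)" for x
        by (rule powr_add_le[OF field_norm_nonneg field_norm_nonneg field_norm_nonneg field_norm_diff_le])
          (use p in simp)
      then show "AE x in vol. norm (?N ?Y x powr p) \<le> norm (?t * (?N X x powr p + ?N (grad g (\<phi> k)) x powr p))"
        by (intro AE_I2) (simp add: abs_mult)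
    qed
    have grad_eq: "?N (grad g (\<phi> k)) x \<le> ?N X x + ?N ?Y x" for x
    proof -
      have "?N (\<lambda>c x. X c x - ?Y c x) x \<le> ?N X x + ?N ?Y x" by (rule field_norm_diff_le)
      then show ?thesis by (simp add: field_norm_def metric_norm_def Let_def)
    qed
    have "(LINT x|vol. \<bar>f x\<bar> powr p) \<le> (LINT x|vol. ?t * (\<bar>f x - \<phi> k x\<bar> powr p + \<bar>\<phi> k x\<bar> powr p))"
      by (intro integral_mono integrable_mult_right Bochner_Integration.integrable_add int_f int_d int_\<phi> powr_add_le)
        (use p in auto)
    also have "\<dots> = ?t * (S1 k + (LINT x|vol. \<bar>\<phi> k x\<bar> powr p))"
      using int_d int_\<phi> by (simp add: S1_def)
    also have "\<dots> \<le> ?t * (S1 k + C * (LINT x|vol. ?N (grad g (\<phi> k)) x powr p))"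
      using test[OF \<phi>] by (intro mult_left_mono add_left_mono) auto
    also have "\<dots> \<le> ?t * (S1 k + C * (LINT x|vol. ?t * (?N X x powr p + ?N ?Y x powr p)))"
      by (intro mult_left_mono add_left_mono C integral_mono integrable_mult_right
          Bochner_Integration.integrable_add int_X int_Y int_\<phi> powr_add_le grad_eq field_norm_nonneg)
        (use p in auto)
    also have "\<dots> = ?t * (S1 k + C * (?t * (B + S2 k)))"
      using int_X int_Y by (simp add: S2_def B_def)
    also have "\<dots> \<le> ?t * (S k + C * (?t * (S k + B)))"
    proof -
      have "B + S2 k \<le> S k + B" "S1 k \<le> S k" using S_nn[of k] by (simp_all add: S_def)
      moreover from this have "C * (?t * (B + S2 k)) \<le> C * (?t * (S k + B))"
        using C by (intro mult_left_mono) simp_all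
      ultimately have "S1 k + C * (?t * (B + S2 k)) \<le> S k + C * (?t * (S k + B))" by linarith
      then show ?thesis by (rule mult_left_mono) simp
    qed
    finally show ?thesis .
  qed
  have "(\<lambda>k. ?t * (S k + C * (?t * (S k + B)))) \<longlonglongrightarrow> ?t * (0 + C * (?t * (0 + B)))"
    by (intro tendsto_intros S_lim)
  then have "(LINT x|vol. \<bar>f x\<bar> powr p) \<le> ?t * (0 + C * (?t * (0 + B)))"
    by (rule LIMSEQ_le_const) (use bound in auto)
  then show ?thesis by (simp add: B_def mult_ac)
qed

theorem first_eigenvalue_pos:
  assumes p: "p \<ge> 2" and u: "smooth_function A u" and k: "k > 0" "\<And>x. p_laplacian A g p u x \<ge> k"
    and M: "\<And>x. \<bar>u x\<bar> \<le> M"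
  shows "first_eigenvalue A g p > 0"
proof -
  have p0: "p > 0" using p by simp
  define C where "C = exp (2 * (p - 1) * M) / k"
  define m where "m = 1 / (2 powr p * (2 powr p * C))"
  have C: "C > 0" using k(1) by (simp add: C_def)
  then have m: "m > 0" by (simp add: m_def)
  let ?Q = "{(LINT x|vol. field_norm A g X x powr p) / (LINT x|vol. \<bar>f x\<bar> powr p) |f X.
      (f, X) \<in> sobolev0 A g p \<and> \<not> (AE x in vol. f x = 0)}"
  have "m \<le> Inf ?Q"
  proof (rule cInf_greatest)
    show "?Q \<noteq> {}" using exists_nonzero_sobolev0[OF p0] by blast
    fix r assume "r \<in> ?Q"
    then obtain f X where fX: "(f, X) \<in> sobolev0 A g p" "\<not> (AE x in vol. f x = 0)"
      and r: "r = (LINT x|vol. field_norm A g X x powr p) / (LINT x|vol. \<bar>f x\<bar> powr p)"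
      by blast
    have int: "integrable vol (\<lambda>x. \<bar>f x\<bar> powr p)" using fX(1) by (simp add: sobolev0_def sobolev_def)
    have "(LINT x|vol. \<bar>f x\<bar> powr p) \<noteq> 0"
      using fX(2) integral_nonneg_eq_0_iff_AE[OF int] by simp
    moreover have "(LINT x|vol. \<bar>f x\<bar> powr p) \<ge> 0" by simp
    ultimately have pos: "(LINT x|vol. \<bar>f x\<bar> powr p) > 0" by linarith
    have "(LINT x|vol. \<bar>f x\<bar> powr p) \<le> 2 powr p * (2 powr p * C) * (LINT x|vol. field_norm A g X x powr p)"
    proof (rule sobolev0_Poincare[OF p0 less_imp_le[OF C] _ fX(1)])
      fix \<phi> assume "test_function A \<phi>"
      then show "(LINT x|vol. \<bar>\<phi> x\<bar> powr p) \<le> C * (LINT x|vol. field_norm A g (grad g \<phi>) x powr p)"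
        unfolding C_def by (rule test_function_Poincare[OF p u k M])
    qed
    then show "m \<le> r"
      using pos C unfolding r m_def by (simp add: field_simps)
  qed
  then show ?thesis using m by (simp add: first_eigenvalue_def)
qed

end

theorem theorem1p1:
  fixes A :: "('a::{second_countable_topology,t2_space}, 'n::finite) chart set"
    and g :: "('a, 'n) metric"
    and p :: real
    and u :: "'a \<Rightarrow> real"
  assumes "p \<ge> 2"
    and "riemannian_manifold A g"
    and "riem_complete A g"
    and "\<not> compact (UNIV :: 'a set)"
    and "first_eigenvalue A g p = 0"
    and "strongly_p_subharmonic A g p u"
  shows "\<not> bounded (range u)"
proof
  interpret riemannian A g using assms(2) by unfold_locales
  assume "bounded (range u)"
  then obtain M where M: "\<And>x. \<bar>u x\<bar> \<le> M" by (auto simp: bounded_iff)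
  obtain k where k: "k > 0" "\<And>x. p_laplacian A g p u x \<ge> k" and u: "smooth_function A u"
    using assms(6) by (auto simp: strongly_p_subharmonic_def)
  show False
    using first_eigenvalue_pos[OF assms(1) u k M] assms(5) by simp
qed

end
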